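(* For any $r\ge 0$, the point $(r+c(r),c(r))$ is the first nontrivial point of $\Sigma_L$ in the intersection of $\Sigma_L$ with the line $\{(r+t,t):t\in\mathbb{R}\}$ parallel to the diagonal through $(r,0)$; that is, $(r+c(r),c(r))$ is a nontrivial point of $\Sigma_L$, and there is no $t<c(r)$ such that $(r+t,t)$ is a nontrivial point of $\Sigma_L$.
   Context: Let $N\ge 1$ be an integer and let $\Omega\subset\mathbb{R}^N$ be a bounded domain (open and connected) with $C^{1,1}$ boundary. $\|\cdot\|_2$ is the $L^2(\Omega)$ norm; $u^\pm=\max\{\pm u,0\}$, so $u=u^+-u^-$. Put $c_N=\pi^{-N/2}\Gamma(N/2)$ and $\rho_N=2\ln 2+\psi(N/2)-\gamma$, with $\psi=\Gamma'/\Gamma$ the digamma function and $\gamma=-\Gamma'(1)$; $B_1$ is the unit ball centred at $0$, $k(z)=\mathbf 1_{B_1}(z)|z|^{-N}$, $j(z)=\mathbf 1_{\mathbb{R}^N\setminus B_1}(z)|z|^{-N}$ for $z\neq 0$. $\mathbb{H}(\Omega)$ is the Hilbert space of all $u\in L^2(\Omega)$, extended by $u=0$ in $\mathbb{R}^N\setminus\Omega$, with $\iint_{\mathbb{R}^{2N}}|u(x)-u(y)|^2k(x-y)\,dx\,dy<\infty$, with inner product $\mathcal{E}(u,v)=\frac{c_N}{2}\iint_{\mathbb{R}^{2N}}(u(x)-u(y))(v(x)-v(y))k(x-y)\,dx\,dy$ and norm $\|u\|=\mathcal{E}(u,u)^{1/2}$. The quadratic form of the logarithmic Laplacian $L_\Delta$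 (the operator with Fourier symbol $2\ln|\xi|$) is $$\mathcal{E}_L(u,v)=\mathcal{E}(u,v)-c_N\iint_{\mathbb{R}^{2N}}u(x)v(y)j(x-y)\,dx\,dy+\rho_N\int_{\mathbb{R}^N}uv\,dx .$$ The Fučík spectrum $\Sigma_L$ is the set of $(\alpha,\beta)\in\mathbb{R}^2$ for which there is a nontrivial $u\in\mathbb{H}(\Omega)$ with $\mathcal{E}_L(u,v)=\int_\Omega(\alpha u^+-\beta u^-)v\,dx$ for all $v\in\mathbb{H}(\Omega)$ (i.e. a nontrivial weak solution of $L_\Delta u=\alpha u^+-\beta u^-$ in $\Omega$, $u=0$ in $\mathbb{R}^N\setminus\Omega$). The first eigenvalue is $\lambda_1^L=\min\{\mathcal{E}_L(u,u):u\in\mathbb{H}(\Omega),\|u\|_2=1\}$; it is simple, and $\varphi_1>0$ denotes the associated eigenfunction with $\|\varphi_1\|_2=1$. A point of $\Sigma_L$ is called nontrivial if it does not lie on the lines $\{\lambda_1^L\}\times\mathbb{R}$ and $\mathbb{R}\times\{\lambda_1^L\}$. Let $\mathcal{P}=\{u\in\mathbb{H}(\Omega): \int_\Omega u^2\,dx=1\}$ (with the topology of $\mathbb{H}(\Omega)$), $E_r(u)=\mathcal{E}_L(u,u)-r\int_\Omega(u^+)^2\,dx$, $\Gamma=\{\gamma\in C([-1,1],\mathcal{P}):\gamma(-1)=-\varphi_1,\ \gamma(1)=\varphi_1\}$, and $c(r)=\inf_{\gamma\in\Gamma}\max_{u\in\gamma[-1,1]}E_r(u)$. *)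

theory Defs
  imports "HOL-Analysis.Analysis"
begin

text \<open>
  The space \<open>\<real>\<^sup>N\<close> is a type \<open>'a :: euclidean_space\<close> with \<open>N = DIM('a)\<close>. Elements of \<open>L\<^sup>2\<close> and of
  \<open>\<bbbH>(\<Omega>)\<close> are represented by Borel functions on the whole space that vanish outside \<open>\<Omega>\<close>; equality
  of elements is equality almost everywhere.
\<close>

text \<open>
  Near each boundary point and after a rotation taking the last coordinate axis to \<open>\<nu>\<close>, the set is
  the open epigraph of a function \<open>g\<close> of the remaining \<open>N - 1\<close> coordinates. These coordinates are
  the projection to the hyperplane orthogonal to \<open>\<nu>\<close>; a \<open>C\<^sup>1\<^sup>,\<^sup>1\<close> function on the hyperplane is the
  same as the restriction of a \<open>C\<^sup>1\<^sup>,\<^sup>1\<close> function on the whole space (extend it constantly along \<open>\<nu>\<close>).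
\<close>

definition C11_function :: "('a::euclidean_space \<Rightarrow> real) \<Rightarrow> bool" where
  "C11_function g \<longleftrightarrow>
     (\<exists>G C. (\<forall>x. (g has_derivative (\<lambda>h. G x \<bullet> h)) (at x)) \<and> C-lipschitz_on UNIV G)"

definition C11_boundary :: "'a::euclidean_space set \<Rightarrow> bool" where
  "C11_boundary \<Omega> \<longleftrightarrow>
     (\<forall>x0\<in>frontier \<Omega>. \<exists>\<epsilon> \<nu> g. \<epsilon> > 0 \<and> norm \<nu> = 1 \<and> C11_function g \<and>
        \<Omega> \<inter> ball x0 \<epsilon> = {x \<in> ball x0 \<epsilon>. x \<bullet> \<nu> > g (x - (x \<bullet> \<nu>) *\<^sub>R \<nu>)})"

definition bounded_C11_domain :: "'a::euclidean_space set \<Rightarrow> bool" where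
  "bounded_C11_domain \<Omega> \<longleftrightarrow>
     \<Omega> \<noteq> {} \<and> open \<Omega> \<and> connected \<Omega> \<and> bounded \<Omega> \<and> C11_boundary \<Omega>"

definition pos_part :: "('a \<Rightarrow> real) \<Rightarrow> 'a \<Rightarrow> real" where
  "pos_part u = (\<lambda>x. max (u x) 0)"

definition neg_part :: "('a \<Rightarrow> real) \<Rightarrow> 'a \<Rightarrow> real" where
  "neg_part u = (\<lambda>x. max (- u x) 0)"

definition c_const :: "nat \<Rightarrow> real" where
  "c_const N = pi powr (- real N / 2) * Gamma (real N / 2)"

definition rho_const :: "nat \<Rightarrow> real" where
  "rho_const N = 2 * ln 2 + Digamma (real N / 2) - euler_mascheroni"

lemma Digamma_eq_deriv_Gamma:
  assumes "x > (0::real)"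
  shows "Digamma x = deriv Gamma x / Gamma x"
proof -
  have "x \<notin> \<int>\<^sub>\<le>\<^sub>0" using assms by (auto elim!: nonpos_Ints_cases)
  then have "(Gamma has_field_derivative Gamma x * Digamma x) (at x)"
    by (rule has_field_derivative_Gamma)
  then have "deriv Gamma x = Gamma x * Digamma x" by (rule DERIV_imp_deriv)
  then show ?thesis using Gamma_real_pos[OF assms] by simp
qed

lemma euler_mascheroni_eq_deriv_Gamma: "euler_mascheroni = - deriv Gamma (1::real)"
  using Digamma_eq_deriv_Gamma[of 1] by (simp add: Digamma_1)

text \<open>At \<open>z = 0\<close> both kernels take the value 0, as division by zero yields 0.\<close>

definition kernel_k :: "'a::euclidean_space \<Rightarrow> real" where
  "kernel_k z = indicat_real (ball 0 1) z / norm z ^ DIM('a)"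

definition kernel_j :: "'a::euclidean_space \<Rightarrow> real" where
  "kernel_j z = indicat_real (- ball 0 1) z / norm z ^ DIM('a)"

definition H_space :: "'a::euclidean_space set \<Rightarrow> ('a \<Rightarrow> real) set" where
  "H_space \<Omega> = {u. u \<in> borel_measurable lborel \<and>
      set_integrable lborel \<Omega> (\<lambda>x. (u x)\<^sup>2) \<and>
      (\<forall>x. x \<notin> \<Omega> \<longrightarrow> u x = 0) \<and>
      integrable (lborel \<Otimes>\<^sub>M lborel) (\<lambda>(x, y). \<bar>u x - u y\<bar>\<^sup>2 * kernel_k (x - y))}"

definition form_E :: "('a::euclidean_space \<Rightarrow> real) \<Rightarrow> ('a \<Rightarrow> real) \<Rightarrow> real" where
  "form_E u v = c_const DIM('a) / 2 *
     (LINT (x, y)|(lborel \<Otimes>\<^sub>M lborel). (u x - u y) * (v x - v y) * kernel_k (x - y))"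

definition H_norm :: "('a::euclidean_space \<Rightarrow> real) \<Rightarrow> real" where
  "H_norm u = sqrt (form_E u u)"

definition form_EL :: "('a::euclidean_space \<Rightarrow> real) \<Rightarrow> ('a \<Rightarrow> real) \<Rightarrow> real" where
  "form_EL u v = form_E u v
     - c_const DIM('a) * (LINT (x, y)|(lborel \<Otimes>\<^sub>M lborel). u x * v y * kernel_j (x - y))
     + rho_const DIM('a) * (LINT x|lborel. u x * v x)"

definition fucik_spectrum :: "'a::euclidean_space set \<Rightarrow> (real \<times> real) set" where
  "fucik_spectrum \<Omega> = {(\<alpha>, \<beta>). \<exists>u\<in>H_space \<Omega>. \<not> (AE x in lborel. u x = 0) \<and>
     (\<forall>v\<in>H_space \<Omega>.
        form_EL u v = (LINT x:\<Omega>|lborel. (\<alpha> * pos_part u x - \<beta> * neg_part u x) * v x))}"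

definition L2_sphere :: "'a::euclidean_space set \<Rightarrow> ('a \<Rightarrow> real) set" where
  "L2_sphere \<Omega> = {u \<in> H_space \<Omega>. (LINT x:\<Omega>|lborel. (u x)\<^sup>2) = 1}"

definition lambda1 :: "'a::euclidean_space set \<Rightarrow> real" where
  "lambda1 \<Omega> = (INF u\<in>L2_sphere \<Omega>. form_EL u u)"

definition is_first_eigenfunction :: "'a::euclidean_space set \<Rightarrow> ('a \<Rightarrow> real) \<Rightarrow> bool" where
  "is_first_eigenfunction \<Omega> \<phi> \<longleftrightarrow> \<phi> \<in> L2_sphere \<Omega> \<and>
     (AE x in lborel. x \<in> \<Omega> \<longrightarrow> \<phi> x > 0) \<and>
     (\<forall>v\<in>H_space \<Omega>. form_EL \<phi> v = lambda1 \<Omega> * (LINT x:\<Omega>|lborel. \<phi> x * v x))"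

definition nontrivial_fucik_point :: "'a::euclidean_space set \<Rightarrow> real \<times> real \<Rightarrow> bool" where
  "nontrivial_fucik_point \<Omega> p \<longleftrightarrow>
     p \<in> fucik_spectrum \<Omega> \<and> p \<notin> {lambda1 \<Omega>} \<times> UNIV \<and> p \<notin> UNIV \<times> {lambda1 \<Omega>}"

definition E_r :: "'a::euclidean_space set \<Rightarrow> real \<Rightarrow> ('a \<Rightarrow> real) \<Rightarrow> real" where
  "E_r \<Omega> r u = form_EL u u - r * (LINT x:\<Omega>|lborel. (pos_part u x)\<^sup>2)"

text \<open>Paths are continuous with respect to \<open>H_norm\<close>.\<close>

definition paths :: "'a::euclidean_space set \<Rightarrow> ('a \<Rightarrow> real) \<Rightarrow> (real \<Rightarrow> 'a \<Rightarrow> real) set" where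
  "paths \<Omega> \<phi> = {\<gamma>. (\<forall>t\<in>{-1..1}. \<gamma> t \<in> L2_sphere \<Omega>) \<and>
     (\<forall>t\<in>{-1..1}. ((\<lambda>s. H_norm (\<lambda>x. \<gamma> s x - \<gamma> t x)) \<longlongrightarrow> 0) (at t within {-1..1})) \<and>
     (AE x in lborel. \<gamma> (-1) x = - \<phi> x) \<and> (AE x in lborel. \<gamma> 1 x = \<phi> x)}"

text \<open>The inner supremum is a maximum, \<open>E_r\<close> being continuous along a path.\<close>

definition minimax_c :: "'a::euclidean_space set \<Rightarrow> ('a \<Rightarrow> real) \<Rightarrow> real \<Rightarrow> real" where
  "minimax_c \<Omega> \<phi> r = (INF \<gamma>\<in>paths \<Omega> \<phi>. SUP t\<in>{-1..1}. E_r \<Omega> r (\<gamma> t))"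

end

theory Submission
  imports Defs "HOL-Complex_Analysis.Great_Picard"
begin

text \<open>
  The equation \<open>L u = (r + c) u\<^sup>+ - c u\<^sup>-\<close> reads \<open>L u - r u\<^sup>+ = c u\<close>, so its solutions of \<open>L\<^sup>2\<close> norm one
  are the critical points of \<open>E_r\<close> on the \<open>L\<^sup>2\<close> sphere, and \<open>c\<close> is the critical value. Let \<open>\<langle>u, v\<rangle>\<close> be
  the \<open>L\<^sup>2\<close> inner product, \<open>\<mu>\<close> the first eigenvalue, \<open>\<phi>\<close> the first eigenfunction, and
  \<open>Q(u, v) = E_L(u, v) + M \<langle>u, v\<rangle>\<close> with \<open>M\<close> so large that \<open>Q(u, u) \<ge> E(u, u) + \<langle>u, u\<rangle>\<close>. Four facts
  carry the proof.

  \<^item> The minimax value \<open>c\<close> is critical (\<open>minimax_critical\<close>). One step of a nonlinear inverse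
    iteration takes the place of a deformation along a gradient flow. With \<open>s = M + c\<close> let \<open>T u\<close> be
    the solution of \<open>Q(T u, w) = \<langle>r u\<^sup>+ + s u, w\<rangle>\<close> for all \<open>w\<close>. The functional
    \<open>\<Phi>(w) = E_r(w) - c \<langle>w, w\<rangle>\<close> is \<open>Q(w, w)\<close> minus a convex function of \<open>w\<close> that is homogeneous of
    degree two, and completing the square gives \<open>\<Phi>(T u) \<le> \<Phi>(u) - Q(u - T u, u - T u)\<close>. The fixed
    points of \<open>T\<close> on the sphere are the critical points at level \<open>c\<close>. If there are none, compactness
    bounds \<open>Q(u - T u, u - T u)\<close> below by some \<open>\<delta> > 0\<close> at bounded energy, and \<open>T\<close> followed by
    normalization turns a path with maximum below \<open>c + \<delta> / 2\<close> into a path with maximum below \<open>c\<close>.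
    The end points survive because \<open>T (\<plusminus>\<phi>)\<close> is a positive multiple of \<open>\<plusminus>\<phi>\<close>.

  \<^item> \<open>c > \<mu>\<close> (\<open>minimax_gt\<close>). Each path crosses the set \<open>\<langle>u\<^sup>+, u\<^sup>+\<rangle> = \<eta>\<close>. For small \<open>\<eta>\<close> the functional
    exceeds \<open>\<mu>\<close> there by a fixed amount: otherwise functions \<open>u_n\<close> with vanishing positive part
    converge to a multiple of \<open>\<phi>\<close>, while their normalized positive parts converge to a nonnegative
    function orthogonal to \<open>\<phi>\<close>, which is impossible since \<open>\<phi> > 0\<close>.

  \<^item> A nontrivial point \<open>(r + t, t)\<close> has \<open>t \<ge> c\<close> (\<open>minimax_le_nontrivial\<close>). Testing with \<open>\<phi>\<close> shows
    that a solution \<open>u\<close> changes sign. Both kernels contribute nonpositive terms to \<open>E_L(u\<^sup>+, u\<^sup>-)\<close>, and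
    therefore the polygon from \<open>-\<phi>\<close> over \<open>-u\<^sup>-\<close> and \<open>u\<^sup>+\<close> to \<open>\<phi>\<close>, projected to the sphere, stays at
    levels at most \<open>t\<close>. On the outer segments this uses that \<open>\<phi>\<close> is an eigenfunction, which turns the
    mixed terms into multiples of \<open>\<langle>\<phi>, u\<^sup>\<plusminus>\<rangle> \<ge> 0\<close>.

  \<^item> Sets bounded in energy are relatively compact in \<open>L\<^sup>2\<close> (\<open>H_compact\<close>). The kernel \<open>|z|\<^sup>-\<^sup>N\<close> is barely
    not integrable: it dominates a sum of \<open>m\<close> dilated bumps of equal mass. The squared
    \<open>L\<^sup>2\<close> distance of a function to its average against this sum is at most a constant times its
    energy divided by \<open>m\<close>, and the averages are equicontinuous.
\<close>

section \<open>Positive semidefinite bilinear forms on spaces of functions\<close>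

abbreviation lborel2 :: "('a::euclidean_space \<times> 'a) measure" where
  "lborel2 \<equiv> lborel \<Otimes>\<^sub>M lborel"

abbreviation sq_dist ::
  "(('a \<Rightarrow> real) \<Rightarrow> ('a \<Rightarrow> real) \<Rightarrow> real) \<Rightarrow> ('a \<Rightarrow> real) \<Rightarrow> ('a \<Rightarrow> real) \<Rightarrow> real" where
  "sq_dist b u v \<equiv> b (\<lambda>x. u x - v x) (\<lambda>x. u x - v x)"

text \<open>
  Functions that agree almost everywhere are not identified, so the inner products of this theory
  vanish on nonzero functions. Semidefiniteness is all that the Cauchy-Schwarz inequality and the
  continuity of the form along convergent nets need.
\<close>
locale psd_form =
  fixes V :: "('a \<Rightarrow> real) set" and b :: "('a \<Rightarrow> real) \<Rightarrow> ('a \<Rightarrow> real) \<Rightarrow> real"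
  assumes add_mem: "u \<in> V \<Longrightarrow> v \<in> V \<Longrightarrow> (\<lambda>x. u x + v x) \<in> V"
    and scale_mem: "u \<in> V \<Longrightarrow> (\<lambda>x. c * u x) \<in> V"
    and sym: "u \<in> V \<Longrightarrow> v \<in> V \<Longrightarrow> b u v = b v u"
    and add_left: "u \<in> V \<Longrightarrow> v \<in> V \<Longrightarrow> w \<in> V \<Longrightarrow> b (\<lambda>x. u x + v x) w = b u w + b v w"
    and scale_left: "u \<in> V \<Longrightarrow> v \<in> V \<Longrightarrow> b (\<lambda>x. c * u x) v = c * b u v"
    and nonneg: "u \<in> V \<Longrightarrow> 0 \<le> b u u"
begin

lemma add_right: "u \<in> V \<Longrightarrow> v \<in> V \<Longrightarrow> w \<in> V \<Longrightarrow> b w (\<lambda>x. u x + v x) = b w u + b w v"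
  by (simp only: sym[of w] add_mem add_left)

lemma scale_right: "u \<in> V \<Longrightarrow> v \<in> V \<Longrightarrow> b v (\<lambda>x. c * u x) = c * b v u"
  by (simp only: sym[of v] scale_mem scale_left)

lemma minus_mem: "u \<in> V \<Longrightarrow> (\<lambda>x. - u x) \<in> V"
  using scale_mem[of u "-1"] by simp

lemma diff_mem: "u \<in> V \<Longrightarrow> v \<in> V \<Longrightarrow> (\<lambda>x. u x - v x) \<in> V"
  using add_mem[OF _ minus_mem, of u v] by simp

lemma lin_mem: "u \<in> V \<Longrightarrow> v \<in> V \<Longrightarrow> (\<lambda>x. c * u x + d * v x) \<in> V"
  by (intro add_mem scale_mem)

lemma minus_left: "u \<in> V \<Longrightarrow> v \<in> V \<Longrightarrow> b (\<lambda>x. - u x) v = - b u v"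
  using scale_left[of u v "-1"] by simp

lemma minus_right: "u \<in> V \<Longrightarrow> v \<in> V \<Longrightarrow> b v (\<lambda>x. - u x) = - b v u"
  using scale_right[of u v "-1"] by simp

lemma diff_left: "u \<in> V \<Longrightarrow> v \<in> V \<Longrightarrow> w \<in> V \<Longrightarrow> b (\<lambda>x. u x - v x) w = b u w - b v w"
  using add_left[OF _ minus_mem, of u v w] minus_left[of v w] by simp

lemma diff_right: "u \<in> V \<Longrightarrow> v \<in> V \<Longrightarrow> w \<in> V \<Longrightarrow> b w (\<lambda>x. u x - v x) = b w u - b w v"
  using add_right[OF _ minus_mem, of u v w] minus_right[of v w] by simp

lemma lin_sq:
  assumes "u \<in> V" "v \<in> V"
  shows "b (\<lambda>x. c * u x + d * v x) (\<lambda>x. c * u x + d * v x)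
     = c\<^sup>2 * b u u + 2 * c * d * b u v + d\<^sup>2 * b v v"
  using assms sym[OF assms]
  by (simp add: add_left add_right scale_left scale_right scale_mem add_mem power2_eq_square algebra_simps)

lemma scale_sq: "u \<in> V \<Longrightarrow> b (\<lambda>x. c * u x) (\<lambda>x. c * u x) = c\<^sup>2 * b u u"
  by (simp add: scale_left scale_right scale_mem power2_eq_square)

lemma minus_sq: "u \<in> V \<Longrightarrow> b (\<lambda>x. - u x) (\<lambda>x. - u x) = b u u"
  by (simp add: minus_left minus_right minus_mem)

lemma diff_sq:
  assumes "u \<in> V" "v \<in> V"
  shows "sq_dist b u v = b u u - 2 * b u v + b v v"
  using lin_sq[OF assms, of 1 "-1"] by simp

lemma diff_comm:
  assumes "u \<in> V" "v \<in> V"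
  shows "sq_dist b u v = sq_dist b v u"
  using assms sym[OF assms] by (simp add: diff_sq)

lemma cauchy_schwarz:
  assumes "u \<in> V" "v \<in> V"
  shows "(b u v)\<^sup>2 \<le> b u u * b v v"
proof -
  have q: "0 \<le> b u u + 2 * t * b u v + t\<^sup>2 * b v v" for t
    using lin_sq[OF assms, of 1 t] nonneg[OF lin_mem[OF assms, of 1 t]] by simp
  show ?thesis
  proof (cases "b v v = 0")
    case True
    show ?thesis
    proof (rule ccontr)
      assume "\<not> ?thesis"
      then have "b u v \<noteq> 0" using True by auto
      then show False using q[of "- (b u u + 1) / (2 * b u v)"] True by (simp add: field_simps)
    qed
  next
    case False
    then have "b v v > 0" using nonneg[OF assms(2)] by simp
    then show ?thesis using q[of "- b u v / b v v"]
      by (simp add: field_simps power2_eq_square)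
  qed
qed

lemma abs_le_sqrt: "u \<in> V \<Longrightarrow> v \<in> V \<Longrightarrow> \<bar>b u v\<bar> \<le> sqrt (b u u) * sqrt (b v v)"
  using real_le_rsqrt[of "\<bar>b u v\<bar>", OF _] cauchy_schwarz[of u v] by (simp add: real_sqrt_mult[symmetric])

lemma null_right: "u \<in> V \<Longrightarrow> v \<in> V \<Longrightarrow> b u u = 0 \<Longrightarrow> b u v = 0"
  using cauchy_schwarz[of u v] by simp

lemma lin_sq_le:
  assumes "u \<in> V" "v \<in> V"
  shows "b (\<lambda>x. c * u x + d * v x) (\<lambda>x. c * u x + d * v x) \<le> 2 * c\<^sup>2 * b u u + 2 * d\<^sup>2 * b v v"
  using lin_sq[OF assms, of c d] lin_sq[OF assms, of c "-d"] nonneg[OF lin_mem[OF assms, of c "-d"]]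
  by (simp add: algebra_simps)

lemma diff_sq_le:
  assumes "u \<in> V" "v \<in> V" "w \<in> V"
  shows "sq_dist b u w
     \<le> 2 * sq_dist b u v + 2 * sq_dist b v w"
  using lin_sq_le[OF diff_mem[OF assms(1,2)] diff_mem[OF assms(2,3)], of 1 1] by simp

lemma tendsto_form:
  assumes mem: "\<And>s. s \<in> T \<Longrightarrow> p s \<in> V" "\<And>s. s \<in> T \<Longrightarrow> q s \<in> V" "u \<in> V" "v \<in> V"
    and ev: "\<forall>\<^sub>F s in F. s \<in> T"
    and lim: "((\<lambda>s. sq_dist b (p s) u) \<longlongrightarrow> 0) F"
      "((\<lambda>s. sq_dist b (q s) v) \<longlongrightarrow> 0) F"
  shows "((\<lambda>s. b (p s) (q s)) \<longlongrightarrow> b u v) F"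
proof -
  define P where "P s = sq_dist b (p s) u" for s
  define Q where "Q s = sq_dist b (q s) v" for s
  have "((\<lambda>s. sqrt (P s) * sqrt (Q s) + sqrt (P s) * sqrt (b v v) + sqrt (b u u) * sqrt (Q s))
      \<longlongrightarrow> sqrt 0 * sqrt 0 + sqrt 0 * sqrt (b v v) + sqrt (b u u) * sqrt 0) F"
    by (intro tendsto_intros lim[folded P_def Q_def])
  then have l: "((\<lambda>s. sqrt (P s) * sqrt (Q s) + sqrt (P s) * sqrt (b v v) + sqrt (b u u) * sqrt (Q s))
      \<longlongrightarrow> 0) F" by simp
  have "\<forall>\<^sub>F s in F. norm (b (p s) (q s) - b u v)
     \<le> sqrt (P s) * sqrt (Q s) + sqrt (P s) * sqrt (b v v) + sqrt (b u u) * sqrt (Q s)"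
    using ev
  proof eventually_elim
    case (elim s)
    have m: "(\<lambda>x. p s x - u x) \<in> V" "(\<lambda>x. q s x - v x) \<in> V" using elim mem diff_mem by auto
    have e: "b (p s) (q s) - b u v = b (\<lambda>x. p s x - u x) (\<lambda>x. q s x - v x)
        + b (\<lambda>x. p s x - u x) v + b u (\<lambda>x. q s x - v x)"
      using elim mem m by (simp add: diff_left diff_right)
    show ?case unfolding e
      using abs_le_sqrt[OF m] abs_le_sqrt[OF m(1) mem(4)] abs_le_sqrt[OF mem(3) m(2)]
      unfolding P_def Q_def by simp
  qed
  from Lim_null_comparison[OF this l] show ?thesis
    by (rule LIM_zero_cancel)
qed

lemma tendsto_sq:
  assumes "\<And>s. s \<in> T \<Longrightarrow> p s \<in> V" "u \<in> V" "\<forall>\<^sub>F s in F. s \<in> T"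
    and "((\<lambda>s. sq_dist b (p s) u) \<longlongrightarrow> 0) F"
  shows "((\<lambda>s. b (p s) (p s)) \<longlongrightarrow> b u u) F"
  by (rule tendsto_form[OF assms(1,1,2,2,3,4,4)])

lemma tendsto_left:
  assumes "\<And>s. s \<in> T \<Longrightarrow> p s \<in> V" "u \<in> V" "v \<in> V" "\<forall>\<^sub>F s in F. s \<in> T"
    and "((\<lambda>s. sq_dist b (p s) u) \<longlongrightarrow> 0) F"
  shows "((\<lambda>s. b (p s) v) \<longlongrightarrow> b u v) F"
proof (rule tendsto_form[OF assms(1) _ assms(2,3,4,5)])
  show "((\<lambda>s. sq_dist b v v) \<longlongrightarrow> 0) F"
    using diff_sq[OF assms(3,3)] by simp
qed (use assms in auto)

end

section \<open>The function spaces and their forms\<close>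

lemma integrable_mult_square_integrable:
  fixes f g :: "'b \<Rightarrow> real"
  assumes [measurable]: "f \<in> borel_measurable M" "g \<in> borel_measurable M"
    and "integrable M (\<lambda>z. (f z)\<^sup>2)" "integrable M (\<lambda>z. (g z)\<^sup>2)"
  shows "integrable M (\<lambda>z. f z * g z)"
proof (rule Bochner_Integration.integrable_bound)
  show "integrable M (\<lambda>z. (f z)\<^sup>2 + (g z)\<^sup>2)" using assms by simp
  have "\<bar>f z * g z\<bar> \<le> (f z)\<^sup>2 + (g z)\<^sup>2" for z
  proof -
    have "2 * (\<bar>f z\<bar> * \<bar>g z\<bar>) \<le> (f z)\<^sup>2 + (g z)\<^sup>2" using sum_squares_bound[of "\<bar>f z\<bar>" "\<bar>g z\<bar>"] by simp
    moreover have "0 \<le> \<bar>f z\<bar> * \<bar>g z\<bar>" by simp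
    ultimately show ?thesis unfolding abs_mult by linarith
  qed
  then show "AE z in M. norm (f z * g z) \<le> norm ((f z)\<^sup>2 + (g z)\<^sup>2)" by (intro AE_I2) simp
qed measurable

lemma integrable_lin_square:
  fixes f g :: "'b \<Rightarrow> real"
  assumes [measurable]: "f \<in> borel_measurable M" "g \<in> borel_measurable M"
    and "integrable M (\<lambda>z. (f z)\<^sup>2)" "integrable M (\<lambda>z. (g z)\<^sup>2)"
  shows "integrable M (\<lambda>z. (c * f z + d * g z)\<^sup>2)"
proof -
  have e: "(\<lambda>z. (c * f z + d * g z)\<^sup>2)
      = (\<lambda>z. c\<^sup>2 * (f z)\<^sup>2 + 2 * c * d * (f z * g z) + d\<^sup>2 * (g z)\<^sup>2)"
    by (auto simp: power2_eq_square algebra_simps)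
  show ?thesis unfolding e
    using integrable_mult_square_integrable[OF assms] assms(3,4) by (intro Bochner_Integration.integrable_add) auto
qed

text \<open>
  Both the \<open>L\<^sup>2\<close> product and the energy have this form, with \<open>\<Phi>\<close> the identity and the weighted
  difference quotient.
\<close>
lemma psd_form_integral:
  fixes \<Phi> :: "('a \<Rightarrow> real) \<Rightarrow> 'b \<Rightarrow> real"
  assumes V: "\<And>u v. u \<in> V \<Longrightarrow> v \<in> V \<Longrightarrow> (\<lambda>x. u x + v x) \<in> V" "\<And>c u. u \<in> V \<Longrightarrow> (\<lambda>x. c * u x) \<in> V"
    and meas: "\<And>u. u \<in> V \<Longrightarrow> \<Phi> u \<in> borel_measurable M"
    and int: "\<And>u. u \<in> V \<Longrightarrow> integrable M (\<lambda>z. (\<Phi> u z)\<^sup>2)"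
    and add: "\<And>u v z. \<Phi> (\<lambda>x. u x + v x) z = \<Phi> u z + \<Phi> v z"
    and scale: "\<And>c u z. \<Phi> (\<lambda>x. c * u x) z = c * \<Phi> u z"
  shows "psd_form V (\<lambda>u v. LINT z|M. \<Phi> u z * \<Phi> v z)"
proof
  have i: "integrable M (\<lambda>z. \<Phi> u z * \<Phi> v z)" if "u \<in> V" "v \<in> V" for u v
    using integrable_mult_square_integrable that meas int by blast
  fix u v w :: "'a \<Rightarrow> real" and c :: real
  assume u: "u \<in> V"
  show "(\<lambda>x. c * u x) \<in> V" using V u by blast
  show "0 \<le> (LINT z|M. \<Phi> u z * \<Phi> u z)" by simp
  assume v: "v \<in> V"
  show "(\<lambda>x. u x + v x) \<in> V" using V u v by blast
  show "(LINT z|M. \<Phi> u z * \<Phi> v z) = (LINT z|M. \<Phi> v z * \<Phi> u z)"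
    by (simp add: mult.commute)
  show "(LINT z|M. \<Phi> (\<lambda>x. c * u x) z * \<Phi> v z) = c * (LINT z|M. \<Phi> u z * \<Phi> v z)"
    by (simp add: scale mult.assoc)
  assume w: "w \<in> V"
  show "(LINT z|M. \<Phi> (\<lambda>x. u x + v x) z * \<Phi> w z) = (LINT z|M. \<Phi> u z * \<Phi> w z) + (LINT z|M. \<Phi> v z * \<Phi> w z)"
    using i[OF u w] i[OF v w] by (simp add: add distrib_right)
qed

lemma integrable_pair_mult:
  fixes f :: "'a::euclidean_space \<Rightarrow> real" and g :: "'a \<Rightarrow> real"
  assumes f: "integrable lborel f" and g: "integrable lborel g"
  shows "integrable lborel2 (\<lambda>(x, y). f x * g y)" (is "integrable _ ?h")
    and "(LINT (x, y)|lborel2. f x * g y) = (LINT x|lborel. f x) * (LINT x|lborel. g x)"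
proof -
  have [measurable]: "f \<in> borel_measurable borel" "g \<in> borel_measurable borel"
    using f g by auto
  show 1: "integrable lborel2 (\<lambda>(x, y). f x * g y)"
  proof (rule lborel_pair.Fubini_integrable)
    show "integrable lborel (\<lambda>x. LINT y|lborel. norm (case (x, y) of (x, y) \<Rightarrow> f x * g y))"
      using f by (simp add: abs_mult)
    show "AE x in lborel. integrable lborel (\<lambda>y. case (x, y) of (x, y) \<Rightarrow> f x * g y)"
      using g by simp
  qed measurable
  show "(LINT (x, y)|lborel2. f x * g y) = (LINT x|lborel. f x) * (LINT x|lborel. g x)"
    using lborel_pair.integral_fst'[OF 1] by simp
qed

text \<open>An exceptional null set spoils only a horizontal and a vertical null strip of the product.\<close>
lemma AE_lborel_pair:
  fixes P Q :: "'a::euclidean_space \<Rightarrow> bool"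
  assumes "AE x in lborel. P x"
  shows "AE z in (lborel2 :: ('a \<times> 'a) measure). P (fst z) \<and> P (snd z)"
proof -
  obtain N where N: "N \<in> null_sets lborel" "{x. \<not> P x} \<subseteq> N"
    using assms by (auto simp: eventually_ae_filter)
  then have [measurable]: "N \<in> sets borel" and N0: "emeasure lborel N = 0" by auto
  have "emeasure (lborel2 :: ('a \<times> 'a) measure) (N \<times> UNIV) = 0"
    by (subst lborel.emeasure_pair_measure_Times) (auto simp: N0)
  moreover have "emeasure (lborel2 :: ('a \<times> 'a) measure) (UNIV \<times> N) = 0"
    by (subst lborel.emeasure_pair_measure_Times) (auto simp: N0)
  ultimately have "N \<times> UNIV \<union> UNIV \<times> N \<in> null_sets (lborel2 :: ('a \<times> 'a) measure)"
    by (intro null_sets.Un null_setsI) (auto intro!: pair_measureI)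
  then show ?thesis by (rule AE_I') (use N in force)
qed

lemma kernel_k_measurable [measurable]: "kernel_k \<in> borel_measurable borel"
  unfolding kernel_k_def
  by (intro borel_measurable_divide borel_measurable_indicator borel_measurable_power borel_measurable_norm) auto

lemma kernel_j_measurable [measurable]: "kernel_j \<in> borel_measurable borel"
  unfolding kernel_j_def
  by (intro borel_measurable_divide borel_measurable_indicator borel_measurable_power borel_measurable_norm) auto

lemma kernel_k_nonneg: "0 \<le> kernel_k z" and kernel_j_nonneg: "0 \<le> kernel_j z"
  by (auto simp: kernel_k_def kernel_j_def)

lemma kernel_j_le_1: "kernel_j z \<le> 1"
  by (cases "norm z < 1") (auto simp: kernel_j_def indicator_def divide_le_eq_1 one_le_power)

lemma kernel_k_commute: "kernel_k (x - y) = kernel_k (y - x)"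
  by (simp add: kernel_k_def indicator_def norm_minus_commute)

lemma kernel_j_commute: "kernel_j (x - y) = kernel_j (y - x)"
  by (simp add: kernel_j_def indicator_def norm_minus_commute)

lemma kernel_sum_pos: "z \<noteq> 0 \<Longrightarrow> 0 < kernel_k z + kernel_j z"
  by (auto simp: kernel_k_def kernel_j_def indicator_def)

lemma c_const_pos: "0 < c_const DIM('a::euclidean_space)"
  unfolding c_const_def by (intro mult_pos_pos Gamma_real_pos) auto

definition L2 :: "'a::euclidean_space set \<Rightarrow> ('a \<Rightarrow> real) set" where
  "L2 \<Omega> = {u \<in> borel_measurable borel. integrable lborel (\<lambda>x. (u x)\<^sup>2) \<and> (\<forall>x. x \<notin> \<Omega> \<longrightarrow> u x = 0)}"

definition ip :: "('a::euclidean_space \<Rightarrow> real) \<Rightarrow> ('a \<Rightarrow> real) \<Rightarrow> real" where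
  "ip u v = (LINT x|lborel. u x * v x)"

definition form_J :: "('a::euclidean_space \<Rightarrow> real) \<Rightarrow> ('a \<Rightarrow> real) \<Rightarrow> real" where
  "form_J u v = (LINT (x, y)|lborel2. u x * v y * kernel_j (x - y))"

lemma L2_measurable: "u \<in> L2 \<Omega> \<Longrightarrow> u \<in> borel_measurable borel"
  and L2_integrable: "u \<in> L2 \<Omega> \<Longrightarrow> integrable lborel (\<lambda>x. (u x)\<^sup>2)"
  and L2_zero: "u \<in> L2 \<Omega> \<Longrightarrow> x \<notin> \<Omega> \<Longrightarrow> u x = 0"
  by (auto simp: L2_def)

lemma L2_lin:
  assumes "u \<in> L2 \<Omega>" "v \<in> L2 \<Omega>"
  shows "(\<lambda>x. c * u x + d * v x) \<in> L2 \<Omega>"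
  using assms integrable_lin_square[of u lborel v c d] by (auto simp: L2_def)

lemma psd_form_ip: "psd_form (L2 \<Omega>) ip"
  unfolding ip_def
proof (rule psd_form_integral[where \<Phi> = "\<lambda>u. u"])
  show "\<And>u v. u \<in> L2 \<Omega> \<Longrightarrow> v \<in> L2 \<Omega> \<Longrightarrow> (\<lambda>x. u x + v x) \<in> L2 \<Omega>"
    using L2_lin[of _ \<Omega> _ 1 1] by simp
  show "\<And>c u. u \<in> L2 \<Omega> \<Longrightarrow> (\<lambda>x. c * u x) \<in> L2 \<Omega>"
    using L2_lin[of _ \<Omega> _ _ 0] by simp
qed (auto simp: L2_def)

interpretation ip: psd_form "L2 \<Omega>" ip for \<Omega> :: "'a::euclidean_space set" by (rule psd_form_ip)

lemma L2_mult_integrable: "u \<in> L2 \<Omega> \<Longrightarrow> v \<in> L2 \<Omega> \<Longrightarrow> integrable lborel (\<lambda>x. u x * v x)"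
  by (rule integrable_mult_square_integrable) (auto simp: L2_def)

lemma ip_eq_0_iff: "u \<in> L2 \<Omega> \<Longrightarrow> ip u u = 0 \<longleftrightarrow> (AE x in lborel. u x = 0)"
  unfolding ip_def using integral_nonneg_eq_0_iff_AE[of lborel "\<lambda>x. u x * u x"]
  by (simp add: L2_mult_integrable)

lemma ip_cong_AE:
  assumes "AE x in lborel. u x = u' x" "AE x in lborel. v x = v' x"
    and [measurable]: "u \<in> borel_measurable borel" "u' \<in> borel_measurable borel"
    "v \<in> borel_measurable borel" "v' \<in> borel_measurable borel"
  shows "ip u v = ip u' v'"
  unfolding ip_def by (rule integral_cong_AE) (use assms in auto)

lemma ip_mono:
  assumes "u \<in> L2 \<Omega>" "v \<in> L2 \<Omega>" "\<And>x. \<bar>u x\<bar> \<le> \<bar>v x\<bar>"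
  shows "ip u u \<le> ip v v"
  unfolding ip_def
  by (rule integral_mono)
     (use assms L2_integrable in \<open>auto simp: abs_le_square_iff power2_eq_square[symmetric]\<close>)

lemma L2_contraction:
  assumes "u \<in> L2 \<Omega>" "w \<in> borel_measurable borel" "\<And>x. \<bar>w x\<bar> \<le> \<bar>u x\<bar>"
  shows "w \<in> L2 \<Omega>"
proof -
  have "integrable lborel (\<lambda>x. (w x)\<^sup>2)"
  proof (rule Bochner_Integration.integrable_bound)
    show "integrable lborel (\<lambda>x. (u x)\<^sup>2)" using assms(1) by (rule L2_integrable)
    show "AE x in lborel. norm ((w x)\<^sup>2) \<le> norm ((u x)\<^sup>2)"
      using assms(3) by (simp add: abs_le_square_iff)
  qed (use assms(2) in measurable)
  then show ?thesis using assms L2_zero[OF assms(1)] assms(3)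
    by (auto simp: L2_def) (metis abs_le_zero_iff abs_zero)
qed

lemma H_space_iff:
  "u \<in> H_space \<Omega> \<longleftrightarrow> u \<in> L2 \<Omega> \<and>
     integrable lborel2 (\<lambda>(x, y). (u x - u y)\<^sup>2 * kernel_k (x - y))"
proof -
  have "(\<lambda>x. indicat_real \<Omega> x *\<^sub>R (u x)\<^sup>2) = (\<lambda>x. (u x)\<^sup>2)" if "\<forall>x. x \<notin> \<Omega> \<longrightarrow> u x = 0"
    using that by (auto simp: indicator_def fun_eq_iff)
  then show ?thesis by (auto simp: H_space_def L2_def set_integrable_def)
qed

lemma H_L2: "u \<in> H_space \<Omega> \<Longrightarrow> u \<in> L2 \<Omega>"
  by (simp add: H_space_iff)

text \<open>
  Half of the kernel is moved into each factor, which writes the energy as the \<open>L\<^sup>2\<close> product of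
  \<open>grad_k u\<close> and \<open>grad_k v\<close> on the product space.
\<close>
definition grad_k :: "('a::euclidean_space \<Rightarrow> real) \<Rightarrow> 'a \<times> 'a \<Rightarrow> real" where
  "grad_k u z = sqrt (c_const DIM('a) / 2 * kernel_k (fst z - snd z)) * (u (fst z) - u (snd z))"

lemma grad_k_measurable:
  assumes [measurable]: "u \<in> borel_measurable borel"
  shows "grad_k u \<in> borel_measurable lborel2"
  unfolding grad_k_def by measurable

lemma grad_k_mult: "grad_k u (x, y) * grad_k v (x, y)
   = c_const DIM('a) / 2 * ((u x - u y) * (v x - v y) * kernel_k (x - (y::'a::euclidean_space)))"
proof -
  let ?s = "sqrt (c_const DIM('a) / 2 * kernel_k (x - y))"
  have "?s * ?s = c_const DIM('a) / 2 * kernel_k (x - y)"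
    using c_const_pos[where 'a='a] kernel_k_nonneg[of "x - y"] by simp
  moreover have "grad_k u (x, y) * grad_k v (x, y) = (?s * ?s) * ((u x - u y) * (v x - v y))"
    unfolding grad_k_def by (simp only: fst_conv snd_conv mult_ac)
  ultimately show ?thesis by simp
qed

lemma form_E_grad: "form_E u v = (LINT z|lborel2. grad_k u z * grad_k v z)"
  unfolding form_E_def
  by (subst integral_mult_right_zero[symmetric], rule arg_cong[where f = "integral\<^sup>L _"])
     (auto simp: grad_k_mult)

lemma H_space_iff_grad:
  "u \<in> H_space \<Omega> \<longleftrightarrow> u \<in> L2 \<Omega> \<and> integrable lborel2 (\<lambda>z. (grad_k u z)\<^sup>2)"
proof -
  let ?c = "c_const DIM('a) / 2"
  let ?f = "\<lambda>(x, y). (u x - u y)\<^sup>2 * kernel_k (x - y)"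
  have e: "(\<lambda>z. (grad_k u z)\<^sup>2) = (\<lambda>z. ?c * ?f z)"
    by (rule ext, simp only: power2_eq_square split: prod.split) (simp add: grad_k_mult)
  have c: "?c \<noteq> 0" using c_const_pos[where 'a='a] by simp
  have "integrable lborel2 (\<lambda>z. ?c * ?f z) \<longleftrightarrow> integrable lborel2 ?f"
    using integrable_mult_left_iff[of "lborel2" ?c ?f] c by simp
  then show ?thesis unfolding H_space_iff e by (simp only:)
qed

lemma grad_k_lin: "grad_k (\<lambda>x. c * u x + d * v x) z = c * grad_k u z + d * grad_k v z"
  by (simp add: grad_k_def algebra_simps)

lemma H_lin:
  assumes "u \<in> H_space \<Omega>" "v \<in> H_space \<Omega>"
  shows "(\<lambda>x. c * u x + d * v x) \<in> H_space \<Omega>"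
  using assms L2_lin[of u \<Omega> v c d] L2_measurable
  unfolding H_space_iff_grad grad_k_lin by (auto intro!: integrable_lin_square grad_k_measurable)

lemma psd_form_E: "psd_form (H_space \<Omega>) form_E"
  unfolding form_E_grad
proof (rule psd_form_integral[where \<Phi> = grad_k])
  show "\<And>u v. u \<in> H_space \<Omega> \<Longrightarrow> v \<in> H_space \<Omega> \<Longrightarrow> (\<lambda>x. u x + v x) \<in> H_space \<Omega>"
    using H_lin[of _ \<Omega> _ 1 1] by simp
  show "\<And>c u. u \<in> H_space \<Omega> \<Longrightarrow> (\<lambda>x. c * u x) \<in> H_space \<Omega>"
    using H_lin[of _ \<Omega> _ _ 0] by simp
  show "\<And>u. u \<in> H_space \<Omega> \<Longrightarrow> grad_k u \<in> borel_measurable lborel2"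
    by (intro grad_k_measurable L2_measurable H_L2)
  show "\<And>u. u \<in> H_space \<Omega> \<Longrightarrow> integrable lborel2 (\<lambda>z. (grad_k u z)\<^sup>2)"
    by (simp add: H_space_iff_grad)
qed (auto simp: grad_k_def algebra_simps)

interpretation E: psd_form "H_space \<Omega>" form_E for \<Omega> :: "'a::euclidean_space set" by (rule psd_form_E)

lemma grad_k_mult_integrable:
  "u \<in> H_space \<Omega> \<Longrightarrow> v \<in> H_space \<Omega> \<Longrightarrow> integrable lborel2 (\<lambda>z. grad_k u z * grad_k v z)"
  by (rule integrable_mult_square_integrable)
     (auto simp: H_space_iff_grad intro: grad_k_measurable L2_measurable)

text \<open>In particular the space is closed under positive and negative parts.\<close>
lemma H_contraction:
  assumes u: "u \<in> H_space \<Omega>" and w: "w \<in> borel_measurable borel" "\<And>x. \<bar>w x\<bar> \<le> \<bar>u x\<bar>"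
    and c: "\<And>x y. \<bar>w x - w y\<bar> \<le> \<bar>u x - u y\<bar>"
  shows "w \<in> H_space \<Omega>"
proof -
  have "\<bar>grad_k w z\<bar> \<le> \<bar>grad_k u z\<bar>" for z
    unfolding grad_k_def abs_mult by (intro mult_left_mono c) auto
  then have "(grad_k w z)\<^sup>2 \<le> (grad_k u z)\<^sup>2" for z by (simp add: abs_le_square_iff)
  then have "integrable lborel2 (\<lambda>z. (grad_k w z)\<^sup>2)"
    using u w(1) unfolding H_space_iff_grad
    by (intro Bochner_Integration.integrable_bound[of _ "\<lambda>z. (grad_k u z)\<^sup>2" "\<lambda>z. (grad_k w z)\<^sup>2"])
      (auto intro!: borel_measurable_power grad_k_measurable)
  then show ?thesis using L2_contraction[OF H_L2[OF u] w] by (simp add: H_space_iff_grad)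
qed

lemma
  assumes [measurable]: "u \<in> borel_measurable borel"
  shows pos_part_measurable: "pos_part u \<in> borel_measurable borel"
    and neg_part_measurable: "neg_part u \<in> borel_measurable borel"
  unfolding pos_part_def neg_part_def by measurable

lemma parts_abs_le:
  "\<bar>pos_part u x\<bar> \<le> \<bar>u x\<bar>" "\<bar>neg_part u x\<bar> \<le> \<bar>u x\<bar>"
  "\<bar>pos_part u x - pos_part u y\<bar> \<le> \<bar>u x - u y\<bar>" "\<bar>neg_part u x - neg_part u y\<bar> \<le> \<bar>u x - u y\<bar>"
  by (auto simp: pos_part_def neg_part_def)

lemma
  assumes "u \<in> H_space \<Omega>"
  shows H_pos: "pos_part u \<in> H_space \<Omega>" and H_neg: "neg_part u \<in> H_space \<Omega>"
proof -
  have "u \<in> borel_measurable borel" by (rule L2_measurable[OF H_L2[OF assms]])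
  then show "pos_part u \<in> H_space \<Omega>" "neg_part u \<in> H_space \<Omega>"
    by (auto intro!: H_contraction[OF assms] parts_abs_le pos_part_measurable neg_part_measurable)
qed

lemma parts_diff: "pos_part u x - neg_part u x = u x"
  and parts_mult: "pos_part u x * neg_part u x = 0"
  and pos_part_nonneg: "0 \<le> pos_part u x" and neg_part_nonneg: "0 \<le> neg_part u x"
  by (auto simp: pos_part_def neg_part_def max_def)

text \<open>
  The far kernel is bounded by 1, so on a set of finite measure its form is controlled by the \<open>L\<^sup>2\<close>
  norm: \<open>|u(x) v(y)| \<le> (u(x)\<^sup>2 + v(y)\<^sup>2) / 2\<close>, and each summand is integrated over the set in the other
  variable.
\<close>
lemma form_J_le:
  assumes "\<Omega> \<in> sets borel" "emeasure lborel \<Omega> < \<infinity>" "u \<in> L2 \<Omega>" "v \<in> L2 \<Omega>"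
  shows "integrable lborel2 (\<lambda>(x, y). u x * v y * kernel_j (x - y))"
    and "\<bar>form_J u v\<bar> \<le> measure lborel \<Omega> * (ip u u + ip v v) / 2"
proof -
  note [measurable] = assms(1) L2_measurable[OF assms(3)] L2_measurable[OF assms(4)]
  have ind: "integrable lborel (indicat_real \<Omega>)" using assms(1,2) by simp
  note L2_integrable[OF assms(3)] L2_integrable[OF assms(4)]
  note a = integrable_pair_mult[OF L2_integrable[OF assms(3)] ind]
  note b = integrable_pair_mult[OF ind L2_integrable[OF assms(4)]]
  let ?g = "\<lambda>z. (1/2) * ((case z of (x, y) \<Rightarrow> (u x)\<^sup>2 * indicat_real \<Omega> y) + (case z of (x, y) \<Rightarrow> indicat_real \<Omega> x * (v y)\<^sup>2))"
  have g: "integrable lborel2 ?g" using a(1) b(1) by (intro integrable_mult_right Bochner_Integration.integrable_add) auto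
  have le: "\<bar>u x * v y * kernel_j (x - y)\<bar> \<le> ?g (x, y)" for x y
  proof (cases "x \<in> \<Omega> \<and> y \<in> \<Omega>")
    case True
    have "\<bar>u x * v y * kernel_j (x - y)\<bar> \<le> \<bar>u x\<bar> * \<bar>v y\<bar>"
      using kernel_j_nonneg[of "x - y"] kernel_j_le_1[of "x - y"]
      by (simp add: abs_mult mult_left_le)
    then show ?thesis using True sum_squares_bound[of "\<bar>u x\<bar>" "\<bar>v y\<bar>"] by simp
  next
    case False
    then show ?thesis using L2_zero[OF assms(3), of x] L2_zero[OF assms(4), of y] by auto
  qed
  show i: "integrable lborel2 (\<lambda>(x, y). u x * v y * kernel_j (x - y))"
    by (rule Bochner_Integration.integrable_bound[OF g]) (use le in \<open>auto intro!: AE_I2\<close>)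
  have "\<bar>form_J u v\<bar> \<le> (LINT z|lborel2. ?g z)"
    unfolding form_J_def
    by (rule integral_abs_bound[THEN order_trans], rule integral_mono)
       (use le i g in \<open>auto intro!: integrable_abs\<close>)
  also have "\<dots> = measure lborel \<Omega> * (ip u u + ip v v) / 2"
    using a b by (simp add: ip_def power2_eq_square algebra_simps)
  finally show "\<bar>form_J u v\<bar> \<le> measure lborel \<Omega> * (ip u u + ip v v) / 2" .
qed

section \<open>Semicontinuity of the energy and completeness of the square integrable functions\<close>

lemma nn_integral_translate:
  fixes f :: "'a::euclidean_space \<Rightarrow> ennreal"
  assumes [measurable]: "f \<in> borel_measurable borel"
  shows "(\<integral>\<^sup>+x. f (c + x) \<partial>lborel) = (\<integral>\<^sup>+x. f x \<partial>lborel)"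
proof -
  have "(\<integral>\<^sup>+x. f x \<partial>lborel) = (\<integral>\<^sup>+x. f x \<partial>(distr lborel borel ((+) c)))"
    by (simp add: lborel_distr_plus)
  also have "\<dots> = (\<integral>\<^sup>+x. f (c + x) \<partial>lborel)" by (subst nn_integral_distr) auto
  finally show ?thesis by simp
qed

lemma form_E_nn:
  assumes "u \<in> H_space \<Omega>"
  shows "(\<integral>\<^sup>+z. ennreal ((grad_k u z)\<^sup>2) \<partial>lborel2) = ennreal (form_E u u)"
  unfolding form_E_grad using assms
  by (subst nn_integral_eq_integral) (auto simp: H_space_iff_grad power2_eq_square)

lemma ip_nn:
  assumes "u \<in> L2 \<Omega>"
  shows "(\<integral>\<^sup>+x. ennreal ((u x)\<^sup>2) \<partial>lborel) = ennreal (ip u u)"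
  unfolding ip_def using L2_integrable[OF assms]
  by (subst nn_integral_eq_integral) (auto simp: power2_eq_square)

lemma energy_nn:
  fixes u :: "'a::euclidean_space \<Rightarrow> real"
  assumes "u \<in> H_space \<Omega>"
  shows "(\<integral>\<^sup>+x. \<integral>\<^sup>+y. ennreal ((u x - u y)\<^sup>2 * kernel_k (x - y)) \<partial>lborel \<partial>lborel)
    = ennreal (2 / c_const DIM('a) * form_E u u)"
proof -
  have [measurable]: "u \<in> borel_measurable borel" using assms by (auto dest: H_L2 L2_measurable)
  let ?f = "\<lambda>(x, y). (u x - u y)\<^sup>2 * kernel_k (x - y)"
  have i: "integrable lborel2 ?f" using assms by (simp add: H_space_iff)
  have "(\<integral>\<^sup>+x. \<integral>\<^sup>+y. ennreal (?f (x, y)) \<partial>lborel \<partial>lborel) = (\<integral>\<^sup>+z. ennreal (?f z) \<partial>lborel2)"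
    by (rule lborel.nn_integral_fst) measurable
  also have "\<dots> = ennreal (LINT z|lborel2. ?f z)"
    using i by (rule nn_integral_eq_integral) (auto simp: kernel_k_nonneg)
  also have "(LINT z|lborel2. ?f z) = 2 / c_const DIM('a) * form_E u u"
    using c_const_pos[where 'a='a] unfolding form_E_def by (simp add: power2_eq_square)
  finally show ?thesis by simp
qed

text \<open>
  Fatou's lemma on the product space. The limit is only known to be square integrable; a bound for
  the energies along the sequence makes its energy finite.
\<close>
lemma form_E_Fatou:
  assumes u: "\<And>n. u n \<in> H_space \<Omega>" and v: "v \<in> L2 \<Omega>"
    and ae: "AE x in lborel. (\<lambda>n. u n x) \<longlonglongrightarrow> v x"
    and le: "\<And>n. form_E (u n) (u n) \<le> e n" and e: "e \<longlonglongrightarrow> l"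
  shows "v \<in> H_space \<Omega>" and "form_E v v \<le> l"
proof -
  let ?M = "lborel2 :: ('a \<times> 'a) measure"
  have [measurable]: "grad_k (u n) \<in> borel_measurable ?M" "grad_k v \<in> borel_measurable ?M" for n
    using u v by (auto intro: grad_k_measurable dest: H_L2 L2_measurable)
  have "AE z in ?M. ennreal ((grad_k v z)\<^sup>2) = liminf (\<lambda>n. ennreal ((grad_k (u n) z)\<^sup>2))"
    using AE_lborel_pair[OF ae]
  proof eventually_elim
    case (elim z)
    have "(\<lambda>n. ennreal ((grad_k (u n) z)\<^sup>2)) \<longlonglongrightarrow> ennreal ((grad_k v z)\<^sup>2)"
      unfolding grad_k_def using elim by (intro tendsto_ennrealI tendsto_intros) auto
    from lim_imp_Liminf[OF trivial_limit_sequentially this] show ?case by (rule sym)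
  qed
  then have "(\<integral>\<^sup>+z. ennreal ((grad_k v z)\<^sup>2) \<partial>?M) = (\<integral>\<^sup>+z. liminf (\<lambda>n. ennreal ((grad_k (u n) z)\<^sup>2)) \<partial>?M)"
    by (rule nn_integral_cong_AE)
  also have "\<dots> \<le> liminf (\<lambda>n. \<integral>\<^sup>+z. ennreal ((grad_k (u n) z)\<^sup>2) \<partial>?M)"
    by (rule nn_integral_liminf) measurable
  also have "\<dots> = liminf (\<lambda>n. ennreal (form_E (u n) (u n)))"
    by (simp add: form_E_nn[OF u])
  also have "\<dots> \<le> liminf (\<lambda>n. ennreal (e n))"
    by (intro Liminf_mono always_eventually allI ennreal_leI le)
  also have "\<dots> = ennreal l"
    by (intro lim_imp_Liminf tendsto_ennrealI e) simp
  finally have b: "(\<integral>\<^sup>+z. ennreal ((grad_k v z)\<^sup>2) \<partial>?M) \<le> ennreal l" .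
  have "integrable ?M (\<lambda>z. (grad_k v z)\<^sup>2)"
    by (rule integrableI_bounded) (use b in \<open>auto simp: less_top[symmetric] top_unique\<close>)
  then show H: "v \<in> H_space \<Omega>" using v by (simp add: H_space_iff_grad)
  have "0 \<le> l"
    by (rule LIMSEQ_le_const[OF e]) (intro exI allI impI order_trans[OF E.nonneg[OF u] le])
  then show "form_E v v \<le> l" using b unfolding form_E_nn[OF H] by (simp add: ennreal_le_iff)
qed

lemma L2_tendsto_AE_subseq:
  assumes u: "\<And>n. u n \<in> L2 \<Omega>" and v: "v \<in> L2 \<Omega>"
    and lim: "(\<lambda>n. sq_dist ip (u n) v) \<longlonglongrightarrow> 0"
  obtains r :: "nat \<Rightarrow> nat" where "strict_mono r" "AE x in lborel. (\<lambda>n. u (r n) x) \<longlonglongrightarrow> v x"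
proof -
  have d: "(\<lambda>x. u n x - v x) \<in> L2 \<Omega>" for n using u v ip.diff_mem by blast
  have "(\<lambda>n. \<integral>x. norm ((u n x - v x)\<^sup>2) \<partial>lborel) \<longlonglongrightarrow> 0"
    using lim by (simp add: ip_def power2_eq_square)
  from tendsto_L1_AE_subseq[OF L2_integrable[OF d] this]
  obtain r :: "nat \<Rightarrow> nat" where r: "strict_mono r" "AE x in lborel. (\<lambda>n. (u (r n) x - v x)\<^sup>2) \<longlonglongrightarrow> 0"
    by auto
  from r(2) have "AE x in lborel. (\<lambda>n. u (r n) x) \<longlonglongrightarrow> v x"
  proof eventually_elim
    case (elim x)
    then have "(\<lambda>n. sqrt ((u (r n) x - v x)\<^sup>2)) \<longlonglongrightarrow> sqrt 0" by (intro tendsto_real_sqrt)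
    then have "(\<lambda>n. u (r n) x - v x) \<longlonglongrightarrow> 0" by (simp add: tendsto_rabs_zero_iff)
    then show ?case by (rule LIM_zero_cancel)
  qed
  with r(1) show ?thesis by (rule that)
qed

lemma form_E_lsc:
  assumes u: "\<And>n. u n \<in> H_space \<Omega>" and v: "v \<in> L2 \<Omega>"
    and lim: "(\<lambda>n. sq_dist ip (u n) v) \<longlonglongrightarrow> 0"
    and le: "\<And>n. form_E (u n) (u n) \<le> e n" and e: "e \<longlonglongrightarrow> l"
  shows "v \<in> H_space \<Omega>" and "form_E v v \<le> l"
proof -
  obtain r :: "nat \<Rightarrow> nat" where r: "strict_mono r" "AE x in lborel. (\<lambda>n. u (r n) x) \<longlonglongrightarrow> v x"
    using L2_tendsto_AE_subseq[OF H_L2[OF u] v lim] by blast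
  have "(\<lambda>n. e (r n)) \<longlonglongrightarrow> l" using LIMSEQ_subseq_LIMSEQ[OF e r(1)] by (simp add: o_def)
  from form_E_Fatou[OF u v r(2) le this] show "v \<in> H_space \<Omega>" "form_E v v \<le> l" .
qed

lemma L2_integrable_1:
  assumes \<Omega>: "\<Omega> \<in> sets borel" "emeasure lborel \<Omega> < \<infinity>" and u: "u \<in> L2 \<Omega>"
  shows "integrable lborel u" and "(LINT x|lborel. \<bar>u x\<bar>) \<le> ip u u + measure lborel \<Omega>"
proof -
  have le: "\<bar>u x\<bar> \<le> u x * u x + indicat_real \<Omega> x" for x
  proof (cases "x \<in> \<Omega>")
    case True
    have "0 \<le> (2 * \<bar>u x\<bar> - 1)\<^sup>2" by simp
    then show ?thesis using True by (simp add: power2_eq_square algebra_simps)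
  qed (simp add: L2_zero[OF u])
  have g: "integrable lborel (\<lambda>x. u x * u x + indicat_real \<Omega> x)"
    using L2_mult_integrable[OF u u] \<Omega> by simp
  show i: "integrable lborel u"
    by (rule Bochner_Integration.integrable_bound[OF g]) (use le L2_measurable[OF u] in \<open>auto intro!: AE_I2\<close>)
  have "(LINT x|lborel. \<bar>u x\<bar>) \<le> (LINT x|lborel. u x * u x + indicat_real \<Omega> x)"
    by (rule integral_mono) (use i g le in auto)
  also have "\<dots> = ip u u + measure lborel \<Omega>"
    using L2_mult_integrable[OF u u] \<Omega> by (simp add: ip_def)
  finally show "(LINT x|lborel. \<bar>u x\<bar>) \<le> ip u u + measure lborel \<Omega>" .
qed

text \<open>
  A subsequence whose squared steps are at most \<open>4\<^sup>-\<^sup>k\<close> has, on a set of finite measure, summable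
  \<open>L\<^sup>1\<close> norms of its steps, hence converges almost everywhere; Fatou's lemma turns this into
  convergence in \<open>L\<^sup>2\<close>.
\<close>
lemma L2_complete:
  fixes u :: "nat \<Rightarrow> 'a::euclidean_space \<Rightarrow> real"
  assumes \<Omega>: "\<Omega> \<in> sets borel" "emeasure lborel \<Omega> < \<infinity>" and u: "\<And>n. u n \<in> L2 \<Omega>"
    and C: "\<And>e. 0 < e \<Longrightarrow> \<exists>N. \<forall>n\<ge>N. \<forall>m\<ge>N. sq_dist ip (u n) (u m) < e"
  obtains v where "v \<in> L2 \<Omega>" "(\<lambda>n. sq_dist ip (u n) v) \<longlonglongrightarrow> 0"
proof -
  define D where "D n m = sq_dist ip (u n) (u m)" for n m
  have um[measurable]: "u n \<in> borel_measurable borel" for n using u L2_measurable by blast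
  have "\<exists>N. \<forall>k. \<forall>n\<ge>N k. \<forall>m\<ge>N k. D n m < (1/4)^k"
    unfolding D_def by (rule choice, rule allI, rule C) simp
  then obtain N :: "nat \<Rightarrow> nat" where N: "\<And>k n m. N k \<le> n \<Longrightarrow> N k \<le> m \<Longrightarrow> D n m < (1/4)^k" by blast
  \<comment> \<open>the summand \<open>k\<close> makes the sequence strictly increasing, the sum makes it pass each \<open>N k\<close>\<close>
  define r where "r k = (\<Sum>i\<le>k. N i) + k" for k
  have r: "N k \<le> r k" for k unfolding r_def by (meson member_le_sum atMost_iff finite_atMost le_refl trans_le_add1 zero_le)
  have rs: "strict_mono r" unfolding strict_mono_Suc_iff r_def by simp
  have rm: "r k \<le> r m" if "k \<le> m" for k m using strict_mono_mono[OF rs] that by (simp add: mono_def)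
  have Dr: "D n m < (1/4)^k" if "r k \<le> n" "r k \<le> m" for k n m
    using N r that order_trans by blast
  define V where "V = measure lborel \<Omega>"
  have V: "0 \<le> V" by (simp add: V_def)
  define d where "d k x = u (r (Suc k)) x - u (r k) x" for k x
  have dL: "d k \<in> L2 \<Omega>" for k unfolding d_def[abs_def] using u ip.diff_mem by blast
  have d_int: "(\<integral>\<^sup>+x. ennreal \<bar>d k x\<bar> \<partial>lborel) \<le> ennreal ((1 + V) * (1/2)^k)" for k
  proof -
    have "ip (d k) (d k) \<le> (1/4)^k"
      using Dr[of k "r (Suc k)" "r k"] rm[of k "Suc k"] by (simp add: D_def d_def[abs_def])
    then have "(2^k)\<^sup>2 * ip (d k) (d k) \<le> (2^k)\<^sup>2 * (1/4)^k" by (intro mult_left_mono) auto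
    also have "\<dots> = 1" by (simp add: power_even_eq[symmetric] power_mult power_mult_distrib[symmetric] power2_eq_square)
    finally have "2^k * (LINT x|lborel. \<bar>d k x\<bar>) \<le> 1 + V"
      using L2_integrable_1(2)[OF \<Omega> ip.scale_mem[OF dL[of k], of "2^k"]] ip.scale_sq[OF dL[of k], of "2^k"]
      by (simp add: abs_mult V_def)
    then have "(LINT x|lborel. \<bar>d k x\<bar>) \<le> (1 + V) * (1/2)^k" by (simp add: field_simps)
    then show ?thesis using L2_integrable_1(1)[OF \<Omega> dL[of k]]
      by (subst nn_integral_eq_integral) (auto intro: ennreal_leI)
  qed
  have "(\<integral>\<^sup>+x. (\<Sum>k. ennreal \<bar>d k x\<bar>) \<partial>lborel) = (\<Sum>k. \<integral>\<^sup>+x. ennreal \<bar>d k x\<bar> \<partial>lborel)"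
    using L2_measurable[OF dL] by (intro nn_integral_suminf) simp
  also have "\<dots> \<le> (\<Sum>k. ennreal ((1 + V) * (1/2)^k))"
    by (intro suminf_le d_int) auto
  also have "\<dots> < \<infinity>"
    using V by (subst suminf_ennreal2) (auto intro!: summable_mult summable_geometric)
  finally have "AE x in lborel. (\<Sum>k. ennreal \<bar>d k x\<bar>) \<noteq> \<infinity>"
    using L2_measurable[OF dL] by (intro nn_integral_noteq_infinite) (auto intro!: borel_measurable_suminf_order)
  then have conv: "AE x in lborel. convergent (\<lambda>k. u (r k) x)"
  proof eventually_elim
    case (elim x)
    have "summable (\<lambda>k. \<bar>d k x\<bar>)" by (rule summable_suminf_not_top) (use elim in auto)
    then have "summable (\<lambda>k. d k x)" by (rule summable_rabs_cancel)
    then have "convergent (\<lambda>n. u (r 0) x + (\<Sum>k<n. d k x))"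
      by (intro convergent_add convergent_const) (simp add: summable_iff_convergent)
    moreover have "u (r 0) x + (\<Sum>k<n. d k x) = u (r n) x" for n
      unfolding d_def using sum_lessThan_telescope[of "\<lambda>k. u (r k) x" n] by simp
    ultimately show ?case by simp
  qed
  define v where "v x = lim (\<lambda>k. u (r k) x)" for x
  have vm[measurable]: "v \<in> borel_measurable borel" unfolding v_def[abs_def] by measurable
  have v0: "v x = 0" if "x \<notin> \<Omega>" for x unfolding v_def using L2_zero[OF u that] by simp
  have b: "(\<integral>\<^sup>+x. ennreal ((u (r k) x - v x)\<^sup>2) \<partial>lborel) \<le> ennreal ((1/4)^k)" for k
  proof -
    have "AE x in lborel. ennreal ((u (r k) x - v x)\<^sup>2) = liminf (\<lambda>m. ennreal ((u (r k) x - u (r m) x)\<^sup>2))"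
      using conv
    proof eventually_elim
      case (elim x)
      then have "(\<lambda>m. u (r m) x) \<longlonglongrightarrow> v x" unfolding v_def by (simp add: convergent_LIMSEQ_iff)
      then have "(\<lambda>m. ennreal ((u (r k) x - u (r m) x)\<^sup>2)) \<longlonglongrightarrow> ennreal ((u (r k) x - v x)\<^sup>2)"
        by (intro tendsto_ennrealI tendsto_intros)
      from lim_imp_Liminf[OF trivial_limit_sequentially this] show ?case by (rule sym)
    qed
    then have "(\<integral>\<^sup>+x. ennreal ((u (r k) x - v x)\<^sup>2) \<partial>lborel)
        = (\<integral>\<^sup>+x. liminf (\<lambda>m. ennreal ((u (r k) x - u (r m) x)\<^sup>2)) \<partial>lborel)"
      by (rule nn_integral_cong_AE)
    also have "\<dots> \<le> liminf (\<lambda>m. \<integral>\<^sup>+x. ennreal ((u (r k) x - u (r m) x)\<^sup>2) \<partial>lborel)"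
      by (rule nn_integral_liminf) measurable
    also have "\<dots> = liminf (\<lambda>m. ennreal (D (r k) (r m)))"
      unfolding D_def by (simp add: ip_nn[OF ip.diff_mem[OF u u]])
    also have "\<dots> \<le> liminf (\<lambda>m. ennreal ((1/4)^k))"
      using Dr[of k "r k"] rm
      by (intro Liminf_mono eventually_sequentiallyI[of k] ennreal_leI less_imp_le) auto
    also have "\<dots> = ennreal ((1/4)^k)" by (simp add: Liminf_const)
    finally show ?thesis .
  qed
  have wL: "(\<lambda>x. u (r k) x - v x) \<in> L2 \<Omega>" for k
  proof -
    have "integrable lborel (\<lambda>x. (u (r k) x - v x)\<^sup>2)"
      by (rule integrableI_bounded) (use b[of k] in \<open>auto simp: less_top[symmetric] top_unique\<close>)
    then show ?thesis using L2_zero[OF u] v0 by (auto simp: L2_def)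
  qed
  have vL: "v \<in> L2 \<Omega>" using ip.diff_mem[OF u[of "r 0"] wL[of 0]] by simp
  have vb: "sq_dist ip (u (r k)) v \<le> (1/4)^k" for k
    using b[of k] unfolding ip_nn[OF wL] by (subst (asm) ennreal_le_iff) auto
  have "(\<lambda>n. sq_dist ip (u n) v) \<longlonglongrightarrow> 0"
  proof (rule LIMSEQ_I)
    fix e :: real assume "0 < e"
    then obtain k where k: "(1/4::real)^k < e / 4" using real_arch_pow_inv[of "e/4" "1/4"] by auto
    have "norm (sq_dist ip (u n) v - 0) < e" if "n \<ge> r k" for n
    proof -
      have "sq_dist ip (u n) v
         \<le> 2 * D n (r k) + 2 * sq_dist ip (u (r k)) v"
        unfolding D_def by (rule ip.diff_sq_le[OF u u vL])
      also have "\<dots> < e" using Dr[OF that order_refl] vb[of k] k by simp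
      finally show ?thesis using ip.nonneg[OF ip.diff_mem[OF u vL]] by simp
    qed
    then show "\<exists>no. \<forall>n\<ge>no. norm (sq_dist ip (u n) v - 0) < e" by blast
  qed
  with vL show ?thesis by (rule that)
qed

section \<open>Compactness of bounded energy sets\<close>

definition hat :: "nat \<Rightarrow> 'a::euclidean_space \<Rightarrow> real" where
  "hat i z = (2 ^ DIM('a)) ^ i * max 0 (1 - 2 ^ i * norm z)"

definition hat_sum :: "nat \<Rightarrow> 'a::euclidean_space \<Rightarrow> real" where
  "hat_sum m z = (\<Sum>i=1..m. hat i z) / 2"

lemma hat_nonneg: "0 \<le> hat i z"
  by (simp add: hat_def)

lemma hat_sum_nonneg: "0 \<le> hat_sum m z"
  by (simp add: hat_sum_def sum_nonneg hat_nonneg)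

lemma hat_measurable [measurable]: "hat i \<in> borel_measurable borel"
  unfolding hat_def by measurable

lemma hat_sum_measurable [measurable]: "hat_sum m \<in> borel_measurable borel"
  unfolding hat_sum_def by measurable

lemma hat_le: "hat i (z::'a::euclidean_space) \<le> (2 ^ DIM('a)) ^ i"
  unfolding hat_def by (rule mult_left_le) auto

lemma hat_outside: "1 \<le> 2 ^ i * norm z \<Longrightarrow> hat i z = 0"
  by (simp add: hat_def)

text \<open>
  At a point \<open>z\<close> only the bumps with \<open>2\<^sup>i |z| < 1\<close> contribute, and their heights \<open>2\<^sup>i\<^sup>N\<close> form a geometric
  series that is at most twice its last term, which in turn is below \<open>|z|\<^sup>-\<^sup>N\<close>. The factor 1/2 in
  the definition of \<open>hat_sum\<close> absorbs this 2. The induction carries both bounds because the first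
  one is what the step needs while new bumps still contribute.
\<close>
lemma hat_sum_le_kernel:
  fixes z :: "'a::euclidean_space"
  assumes "z \<noteq> 0"
  shows "hat_sum m z \<le> kernel_k z"
proof (cases "norm z < 1")
  case True
  have D: "(2::real) \<le> 2 ^ DIM('a)" using DIM_positive[where 'a='a] by (simp add: self_le_power)
  have "(\<Sum>i=1..m. hat i z) \<le> 2 * (2 ^ DIM('a)) ^ m \<and> (\<Sum>i=1..m. hat i z) \<le> 2 / norm z ^ DIM('a)"
  proof (induction m)
    case 0
    then show ?case by simp
  next
    case (Suc m)
    let ?P = "(2 ^ DIM('a)) :: real"
    have mono: "2 * ?P ^ m \<le> ?P ^ Suc m" using D by simp
    show ?case
    proof (cases "1 \<le> 2 ^ Suc m * norm z")
      case True
      from hat_outside[OF this] have "(\<Sum>i=1..Suc m. hat i z) = (\<Sum>i=1..m. hat i z)"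
        by simp
      moreover have "?P ^ Suc m \<le> 2 * ?P ^ Suc m" by simp
      ultimately show ?thesis using Suc.IH mono by linarith
    next
      case False
      have "?P ^ Suc m * norm z ^ DIM('a) = (2 ^ Suc m * norm z) ^ DIM('a)"
        by (simp only: power_mult_distrib power_mult[symmetric] mult.commute)
      also have "\<dots> \<le> 1" using False by (intro power_le_one) auto
      finally have "?P ^ Suc m \<le> 1 / norm z ^ DIM('a)" using assms by (simp add: field_simps)
      moreover have s: "(\<Sum>i=1..Suc m. hat i z) = (\<Sum>i=1..m. hat i z) + hat (Suc m) z" by simp
      moreover have le: "(\<Sum>i=1..Suc m. hat i z) \<le> 2 * ?P ^ Suc m"
        unfolding s using Suc.IH mono hat_le[of "Suc m" z] by linarith
      moreover have "2 * ?P ^ Suc m \<le> 2 / norm z ^ DIM('a)" using calculation(1) by linarith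
      ultimately show ?thesis by linarith
    qed
  qed
  then show ?thesis using True by (simp add: hat_sum_def kernel_k_def)
next
  case False
  have "hat i z = 0" if "i \<in> {1..m}" for i
  proof (rule hat_outside)
    have "1 * 1 \<le> 2 ^ i * norm z" using False by (intro mult_mono) auto
    then show "1 \<le> 2 ^ i * norm z" by simp
  qed
  then show ?thesis by (simp add: hat_sum_def kernel_k_nonneg)
qed

lemma hat_sum_bounded: "hat_sum m (z::'a::euclidean_space) \<le> (\<Sum>i=1..m. (2 ^ DIM('a)) ^ i)"
  using sum_mono[of "{1..m}" "\<lambda>i. hat i z", OF hat_le] sum_nonneg[of "{1..m}" "\<lambda>i. hat i z", OF hat_nonneg]
  by (simp add: hat_sum_def)

lemma hat_sum_lipschitz:
  "\<exists>L\<ge>0. \<forall>z z'. \<bar>hat_sum m z - hat_sum m (z'::'a::euclidean_space)\<bar> \<le> L * norm (z - z')"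
proof -
  have h: "\<bar>hat i z - hat i z'\<bar> \<le> ((2 ^ DIM('a)) ^ i * 2 ^ i) * norm (z - z')" for i and z z' :: 'a
  proof -
    have "\<bar>max 0 (1 - 2 ^ i * norm z) - max 0 (1 - 2 ^ i * norm z')\<bar> \<le> \<bar>2 ^ i * norm z - 2 ^ i * norm z'\<bar>"
      by linarith
    also have "\<dots> = 2 ^ i * \<bar>norm z - norm z'\<bar>" by (simp add: abs_mult right_diff_distrib[symmetric])
    also have "\<dots> \<le> 2 ^ i * norm (z - z')" by (intro mult_left_mono norm_triangle_ineq3) auto
    finally show ?thesis unfolding hat_def
      by (simp add: right_diff_distrib[symmetric] abs_mult mult.assoc)
  qed
  have "\<bar>hat_sum m z - hat_sum m z'\<bar> \<le> (\<Sum>i=1..m. (2 ^ DIM('a)) ^ i * 2 ^ i) * norm (z - z')" for z z' :: 'a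
  proof -
    have "\<bar>(\<Sum>i=1..m. hat i z) - (\<Sum>i=1..m. hat i z')\<bar> \<le> (\<Sum>i=1..m. \<bar>hat i z - hat i z'\<bar>)"
      by (simp add: sum_subtractf[symmetric] sum_abs)
    also have "\<dots> \<le> (\<Sum>i=1..m. (2 ^ DIM('a)) ^ i * 2 ^ i * norm (z - z'))" by (intro sum_mono h)
    also have "\<dots> = (\<Sum>i=1..m. (2 ^ DIM('a)) ^ i * 2 ^ i) * norm (z - z')" by (simp add: sum_distrib_right)
    finally show ?thesis by (simp add: hat_sum_def)
  qed
  then show ?thesis by (intro exI[of _ "\<Sum>i=1..m. (2 ^ DIM('a)) ^ i * 2 ^ i"]) (auto intro: sum_nonneg)
qed

lemma hat_integrable:
  assumes "1 \<le> i"
  shows "integrable lborel (hat i :: 'a::euclidean_space \<Rightarrow> real)"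
proof (rule integrableI_bounded_set[where A = "ball 0 1"])
  show "AE z in lborel. z \<in> ball 0 1 \<longrightarrow> norm (hat i (z::'a)) \<le> (2 ^ DIM('a)) ^ i"
    by (intro AE_I2 impI) (simp only: real_norm_def abs_of_nonneg hat_nonneg hat_le)
  show "AE z in lborel. z \<notin> ball 0 1 \<longrightarrow> hat i (z::'a) = 0"
  proof (intro AE_I2 impI hat_outside)
    fix z :: 'a assume "z \<notin> ball 0 1"
    then have "1 * 1 \<le> 2 ^ i * norm z" by (intro mult_mono) auto
    then show "1 \<le> 2 ^ i * norm z" by simp
  qed
qed (auto simp: emeasure_lborel_ball_finite[simplified])

lemma hat_sum_integrable: "integrable lborel (hat_sum m :: 'a::euclidean_space \<Rightarrow> real)"
  unfolding hat_sum_def[abs_def]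
  by (intro integrable_divide_zero Bochner_Integration.integrable_sum) (simp add: hat_integrable)

text \<open>The argument of type \<open>itself\<close> fixes the space over which the bump is integrated.\<close>
definition hat_mass :: "'a::euclidean_space itself \<Rightarrow> nat \<Rightarrow> real" where
  "hat_mass _ m = (LINT z|lborel. hat_sum m (z::'a))"

text \<open>
  Dilation leaves the mass of a bump unchanged, so the mass of the sum grows linearly. This
  divergence is what makes the logarithmic kernel compactifying. Each bump is at least half its
  height on the ball of half its radius.
\<close>
lemma hat_mass_ge:
  "\<exists>c>0. \<forall>m. real m * c \<le> hat_mass TYPE('a::euclidean_space) m"
proof -
  let ?V = "measure lborel (ball (0::'a) 1)"
  let ?N = "DIM('a)"
  have "?V / (2 * 2 ^ ?N) \<le> (LINT z|lborel. hat i (z::'a))" if "1 \<le> i" for i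
  proof -
    let ?r = "1 / (2 * 2 ^ i) :: real"
    have "measure lborel (ball (0::'a) ?r) = ?r ^ ?N * ?V"
      using content_ball_conv_unit_ball[of ?r "0::'a"] by simp
    also have "?r ^ ?N = 1 / ((2 ^ ?N) * (2 ^ ?N) ^ i)"
      by (simp add: power_divide power_mult_distrib power_mult[symmetric] mult.commute)
    finally have m: "((2 ^ ?N) ^ i / 2) * measure lborel (ball (0::'a) ?r) = ?V / (2 * 2 ^ ?N)"
      by simp
    have "((2 ^ ?N) ^ i / 2) * measure lborel (ball (0::'a) ?r)
        = (LINT z|lborel. (2 ^ ?N) ^ i / 2 * indicat_real (ball (0::'a) ?r) z)"
      by (simp add: emeasure_lborel_ball_finite)
    also have "\<dots> \<le> (LINT z|lborel. hat i (z::'a))"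
    proof (rule integral_mono[OF _ hat_integrable[OF that]])
      show "integrable lborel (\<lambda>z. (2 ^ ?N) ^ i / 2 * indicat_real (ball (0::'a) ?r) z)"
        by (intro integrable_mult_right integrable_real_indicator)
           (auto simp: emeasure_lborel_ball_finite[simplified])
      show "(2 ^ ?N) ^ i / 2 * indicat_real (ball (0::'a) ?r) z \<le> hat i z" for z
      proof (cases "z \<in> ball 0 ?r")
        case True
        then have "2 ^ i * norm z \<le> 1/2" by (simp add: field_simps)
        then have "1/2 \<le> max 0 (1 - 2 ^ i * norm z)" by simp
        from mult_left_mono[OF this, of "(2 ^ ?N) ^ i"]
        have "(2 ^ ?N) ^ i / 2 \<le> hat i z"
          unfolding hat_def by (simp only: times_divide_eq_right mult_1_right zero_le_power zero_le_numeral simp_thms True_implies_equals)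
        then show ?thesis using True by simp
      qed (simp add: hat_nonneg)
    qed
    finally show ?thesis using m by simp
  qed
  then have "(\<Sum>i=1..m. ?V / (2 * 2 ^ ?N)) \<le> (\<Sum>i=1..m. LINT z|lborel. hat i (z::'a))" for m
    by (intro sum_mono) auto
  moreover have "hat_mass TYPE('a) m = (\<Sum>i=1..m. LINT z|lborel. hat i (z::'a)) / 2" for m
    unfolding hat_mass_def hat_sum_def using hat_integrable[where 'a='a] by (simp add: Bochner_Integration.integral_sum)
  ultimately have h: "real m * (?V / (2 * 2 ^ ?N)) \<le> 2 * hat_mass TYPE('a) m" for m
    by (simp add: mult.commute)
  have "x * (C / 2) \<le> y" if "x * C \<le> 2 * y" for x C y :: real using that by simp
  from this[OF h] have "real m * (?V / (2 * 2 ^ ?N) / 2) \<le> hat_mass TYPE('a) m" for m .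
  moreover have "0 < ?V / (2 * 2 ^ ?N) / 2" using content_ball_pos[of 1 "0::'a"] by simp
  ultimately show ?thesis by blast
qed

definition hat_avg :: "nat \<Rightarrow> ('a::euclidean_space \<Rightarrow> real) \<Rightarrow> 'a \<Rightarrow> real" where
  "hat_avg m u x = (LINT y|lborel. hat_sum m (x - y) * u y)"

lemma hat_sum_shift:
  fixes x :: "'a::euclidean_space"
  shows "integrable lborel (\<lambda>y. hat_sum m (x - y))"
    and "(LINT y|lborel. hat_sum m (x - y)) = hat_mass TYPE('a) m"
proof -
  have e: "(\<lambda>y. hat_sum m (x - y)) = (\<lambda>y. hat_sum m (- x + y))"
    unfolding hat_sum_def hat_def by (simp add: norm_minus_commute)
  have i: "integrable (distr lborel borel ((+) (- x))) (hat_sum m :: 'a \<Rightarrow> real)"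
    by (simp add: lborel_distr_plus hat_sum_integrable)
  show "integrable lborel (\<lambda>y. hat_sum m (x - y))" unfolding e
    using i by (subst (asm) integrable_distr_eq) auto
  have "hat_mass TYPE('a) m = (LINT z|distr lborel borel ((+) (- x)). hat_sum m z)"
    by (simp add: hat_mass_def lborel_distr_plus)
  also have "\<dots> = (LINT y|lborel. hat_sum m (- x + y))" by (subst integral_distr) auto
  finally show "(LINT y|lborel. hat_sum m (x - y)) = hat_mass TYPE('a) m" unfolding e by simp
qed

lemma hat_sum_mult_integrable:
  assumes "integrable lborel f"
  shows "integrable lborel (\<lambda>y. hat_sum m (x - y) * f y)"
proof (rule Bochner_Integration.integrable_bound)
  let ?B = "(\<Sum>i=1..m. (2 ^ DIM('a)) ^ i) :: real"
  show "integrable lborel (\<lambda>y. ?B * f y)" using assms by simp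
  have [measurable]: "f \<in> borel_measurable borel" using assms by auto
  show "(\<lambda>y. hat_sum m (x - y) * f y) \<in> borel_measurable lborel" by measurable
  have "0 \<le> ?B" by (auto intro: sum_nonneg)
  then show "AE y in lborel. norm (hat_sum m (x - y) * f y) \<le> norm (?B * f y)"
    by (intro AE_I2) (simp only: real_norm_def abs_mult abs_of_nonneg hat_sum_nonneg mult_right_mono hat_sum_bounded abs_ge_zero)
qed

lemma hat_avg_measurable:
  assumes [measurable]: "u \<in> borel_measurable borel"
  shows "hat_avg m u \<in> borel_measurable borel"
proof -
  have "(\<lambda>x. LINT y|lborel. hat_sum m (x - y) * u y) \<in> borel_measurable lborel"
    by (rule lborel.borel_measurable_lebesgue_integral) measurable
  then show ?thesis by (simp add: hat_avg_def[abs_def])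
qed

text \<open>
  Jensen's inequality for the probability density \<open>hat_sum m / K\<close> bounds the square of
  \<open>u(x)\<close> minus its average at \<open>x\<close> by the average of \<open>(u(x) - u(y))\<^sup>2\<close>; integrating over \<open>x\<close> and
  comparing the density with the kernel leaves the energy divided by the mass \<open>K\<close>.
\<close>
lemma hat_avg_approx:
  fixes u :: "'a::euclidean_space \<Rightarrow> real"
  assumes \<Omega>: "\<Omega> \<in> sets borel" "emeasure lborel \<Omega> < \<infinity>" and u: "u \<in> H_space \<Omega>"
    and K: "0 < hat_mass TYPE('a) m"
  defines "w \<equiv> \<lambda>x. indicat_real \<Omega> x * (hat_avg m u x / hat_mass TYPE('a) m)"
  shows "w \<in> L2 \<Omega>"
    and "sq_dist ip u w \<le> 2 / (c_const DIM('a) * hat_mass TYPE('a) m) * form_E u u"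
proof -
  let ?K = "hat_mass TYPE('a) m"
  note uL = H_L2[OF u]
  note [measurable] = L2_measurable[OF uL] \<Omega>(1) hat_avg_measurable[OF L2_measurable[OF uL]]
  have wm[measurable]: "w \<in> borel_measurable borel" unfolding w_def by measurable
  have i1: "integrable lborel u" by (rule L2_integrable_1[OF \<Omega> uL])
  have pt: "?K * (u x - hat_avg m u x / ?K)\<^sup>2 \<le> (LINT y|lborel. hat_sum m (x - y) * (u x - u y)\<^sup>2)" 
    and ptI: "integrable lborel (\<lambda>y. hat_sum m (x - y) * (u x - u y)\<^sup>2)" for x
  proof -
    define S where "S = (LINT y|lborel. hat_sum m (x - y) * (u y)\<^sup>2)"
    define T where "T = hat_avg m u x"
    note I = hat_sum_shift(1)[of m x] hat_sum_mult_integrable[OF i1, of m x]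
      hat_sum_mult_integrable[OF L2_integrable[OF uL], of m x]
    have e: "(\<lambda>y. hat_sum m (x - y) * (a - u y)\<^sup>2) = (\<lambda>y. a\<^sup>2 * hat_sum m (x - y)
        - 2 * a * (hat_sum m (x - y) * u y) + hat_sum m (x - y) * (u y)\<^sup>2)" for a
      by (auto simp: power2_eq_square algebra_simps)
    have ia: "integrable lborel (\<lambda>y. hat_sum m (x - y) * (a - u y)\<^sup>2)" for a
      unfolding e using I by (intro Bochner_Integration.integrable_add Bochner_Integration.integrable_diff) auto
    have v: "(LINT y|lborel. hat_sum m (x - y) * (a - u y)\<^sup>2) = a\<^sup>2 * ?K - 2 * a * T + S" for a
      unfolding e using I by (simp add: hat_sum_shift(2) hat_avg_def S_def T_def)
    have "0 \<le> (LINT y|lborel. hat_sum m (x - y) * (T / ?K - u y)\<^sup>2)"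
      by (intro Bochner_Integration.integral_nonneg) (simp add: hat_sum_nonneg)
    then have "T\<^sup>2 / ?K \<le> S" unfolding v using K by (simp add: power2_eq_square field_simps)
    then show "?K * (u x - hat_avg m u x / ?K)\<^sup>2 \<le> (LINT y|lborel. hat_sum m (x - y) * (u x - u y)\<^sup>2)"
      unfolding v T_def[symmetric] using K by (simp add: power2_eq_square field_simps)
    show "integrable lborel (\<lambda>y. hat_sum m (x - y) * (u x - u y)\<^sup>2)" by (rule ia)
  qed
  have ptn: "ennreal (?K * (u x - w x)\<^sup>2) \<le> (\<integral>\<^sup>+y. ennreal ((u x - u y)\<^sup>2 * kernel_k (x - y)) \<partial>lborel)" for x
  proof -
    have "?K * (u x - w x)\<^sup>2 \<le> ?K * (u x - hat_avg m u x / ?K)\<^sup>2"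
      using K by (cases "x \<in> \<Omega>") (auto simp: w_def L2_zero[OF uL] indicator_def)
    also note pt
    finally have "ennreal (?K * (u x - w x)\<^sup>2) \<le> ennreal (LINT y|lborel. hat_sum m (x - y) * (u x - u y)\<^sup>2)"
      by (rule ennreal_leI)
    also have "\<dots> = (\<integral>\<^sup>+y. ennreal (hat_sum m (x - y) * (u x - u y)\<^sup>2) \<partial>lborel)"
      by (rule nn_integral_eq_integral[symmetric, OF ptI]) (simp add: hat_sum_nonneg)
    also have "\<dots> \<le> (\<integral>\<^sup>+y. ennreal ((u x - u y)\<^sup>2 * kernel_k (x - y)) \<partial>lborel)"
    proof (intro nn_integral_mono ennreal_leI)
      fix y
      show "hat_sum m (x - y) * (u x - u y)\<^sup>2 \<le> (u x - u y)\<^sup>2 * kernel_k (x - y)"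
        using mult_left_mono[OF hat_sum_le_kernel[of "x - y" m], of "(u x - u y)\<^sup>2"]
        by (cases "x = y") (auto simp: mult.commute)
    qed
    finally show ?thesis .
  qed
  have "(\<integral>\<^sup>+x. ennreal (?K * (u x - w x)\<^sup>2) \<partial>lborel) \<le> ennreal (2 / c_const DIM('a) * form_E u u)"
    using nn_integral_mono[of lborel "\<lambda>x. ennreal (?K * (u x - w x)\<^sup>2)", OF ptn] unfolding energy_nn[OF u] by simp
  moreover have "integrable lborel (\<lambda>x. ?K * (u x - w x)\<^sup>2)"
    by (rule integrableI_bounded) (use K calculation in \<open>auto simp: less_top[symmetric] top_unique\<close>)
  moreover have dL: "(\<lambda>x. u x - w x) \<in> L2 \<Omega>"
    using K calculation(2) L2_zero[OF uL] by (auto simp: L2_def w_def)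
  ultimately have "ennreal (?K * sq_dist ip u w) \<le> ennreal (2 / c_const DIM('a) * form_E u u)"
    using K by (subst (asm) nn_integral_eq_integral) (auto simp: ip_def power2_eq_square)
  then have "?K * sq_dist ip u w \<le> 2 / c_const DIM('a) * form_E u u"
    using E.nonneg[OF u] c_const_pos[where 'a='a] by (subst (asm) ennreal_le_iff) auto
  then show "sq_dist ip u w \<le> 2 / (c_const DIM('a) * ?K) * form_E u u"
    using K c_const_pos[where 'a='a] by (simp add: field_simps)
  show "w \<in> L2 \<Omega>" using ip.diff_mem[OF uL dL] by simp
qed


lemma hat_avg_bounds:
  fixes u :: "'a::euclidean_space \<Rightarrow> real"
  assumes u: "integrable lborel u"
  shows "\<bar>hat_avg m u x\<bar> \<le> (\<Sum>i=1..m. (2 ^ DIM('a)) ^ i) * (LINT y|lborel. \<bar>u y\<bar>)"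
    and "(\<And>z z'::'a. \<bar>hat_sum m z - hat_sum m z'\<bar> \<le> L * norm (z - z')) \<Longrightarrow>
      \<bar>hat_avg m u x - hat_avg m u x'\<bar> \<le> L * norm (x - x') * (LINT y|lborel. \<bar>u y\<bar>)"
proof -
  let ?B = "(\<Sum>i=1..m. (2 ^ DIM('a)) ^ i) :: real"
  note I = hat_sum_mult_integrable[OF u, of m]
  have "\<bar>hat_avg m u x\<bar> \<le> (LINT y|lborel. \<bar>hat_sum m (x - y) * u y\<bar>)"
    unfolding hat_avg_def by (rule integral_abs_bound)
  also have "\<dots> \<le> (LINT y|lborel. ?B * \<bar>u y\<bar>)"
  proof (rule integral_mono)
    show "\<bar>hat_sum m (x - y) * u y\<bar> \<le> ?B * \<bar>u y\<bar>" for y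
      by (simp only: abs_mult abs_of_nonneg hat_sum_nonneg mult_right_mono hat_sum_bounded abs_ge_zero)
  qed (use u I in auto)
  finally show "\<bar>hat_avg m u x\<bar> \<le> ?B * (LINT y|lborel. \<bar>u y\<bar>)" by simp
  assume L: "\<And>z z'::'a. \<bar>hat_sum m z - hat_sum m z'\<bar> \<le> L * norm (z - z')"
  have "\<bar>hat_avg m u x - hat_avg m u x'\<bar> = \<bar>LINT y|lborel. hat_sum m (x - y) * u y - hat_sum m (x' - y) * u y\<bar>"
    unfolding hat_avg_def using I by simp
  also have "\<dots> \<le> (LINT y|lborel. \<bar>hat_sum m (x - y) * u y - hat_sum m (x' - y) * u y\<bar>)"
    by (rule integral_abs_bound)
  also have "\<dots> \<le> (LINT y|lborel. L * norm (x - x') * \<bar>u y\<bar>)"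
  proof (rule integral_mono)
    show "\<bar>hat_sum m (x - y) * u y - hat_sum m (x' - y) * u y\<bar> \<le> L * norm (x - x') * \<bar>u y\<bar>" for y
      using mult_right_mono[OF L[of "x - y" "x' - y"], of "\<bar>u y\<bar>"]
      by (simp add: left_diff_distrib[symmetric] abs_mult)
  qed (use u I in auto)
  finally show "\<bar>hat_avg m u x - hat_avg m u x'\<bar> \<le> L * norm (x - x') * (LINT y|lborel. \<bar>u y\<bar>)" by simp
qed

text \<open>
  The averages are bounded and Lipschitz uniformly along the sequence. A diagonal argument gives
  convergence at the points of a countable dense set for all \<open>m\<close> at once, and equicontinuity extends
  it to all points.
\<close>
lemma hat_avg_subseq:
  fixes u :: "nat \<Rightarrow> 'a::euclidean_space \<Rightarrow> real"
  assumes u: "\<And>n. integrable lborel (u n)" and c: "\<And>n. (LINT y|lborel. \<bar>u n y\<bar>) \<le> c"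
  obtains r :: "nat \<Rightarrow> nat" where "strict_mono r" "\<forall>m x. convergent (\<lambda>n. hat_avg m (u (r n)) x)"
proof -
  define B :: "nat \<Rightarrow> real" where "B m = (\<Sum>i=1..m. (2 ^ DIM('a)) ^ i)" for m
  have B0: "0 \<le> B m" for m unfolding B_def by (intro sum_nonneg) auto
  have "0 \<le> (LINT y|lborel. \<bar>u 0 y\<bar>)" by simp
  then have c0: "0 \<le> c" using c[of 0] by linarith
  have bd: "\<bar>hat_avg m (u n) x\<bar> \<le> B m * c" for m n x
    using hat_avg_bounds(1)[OF u, of m n x] mult_left_mono[OF c[of n] B0[of m]] unfolding B_def by linarith
  obtain D :: "'a set" where D: "countable D" "\<And>X. open X \<Longrightarrow> X \<noteq> {} \<Longrightarrow> \<exists>d\<in>D. d \<in> X"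
    using countable_dense_exists by blast
  have "countable ((UNIV :: nat set) \<times> D)" using D(1) by simp
  moreover have "norm (hat_avg (fst p) (u n) (snd p) / (B (fst p) * c + 1)) \<le> 1" for n p
    using bd[of "fst p" n "snd p"] mult_nonneg_nonneg[OF B0[of "fst p"] c0] by simp
  ultimately obtain r :: "nat \<Rightarrow> nat" where r: "strict_mono r" and
    l: "\<And>p. p \<in> UNIV \<times> D \<Longrightarrow> \<exists>l. (\<lambda>n. hat_avg (fst p) (u (r n)) (snd p) / (B (fst p) * c + 1)) \<longlonglongrightarrow> l"
    using function_convergent_subsequence[of "UNIV \<times> D" "\<lambda>n p. hat_avg (fst p) (u n) (snd p) / (B (fst p) * c + 1)" 1]
    by blast
  have convD: "convergent (\<lambda>n. hat_avg m (u (r n)) x)" if xD: "x \<in> D" for m x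
  proof -
    have "0 < B m * c + 1" using mult_nonneg_nonneg[OF B0[of m] c0] by simp
    moreover obtain l where "(\<lambda>n. hat_avg m (u (r n)) x / (B m * c + 1)) \<longlonglongrightarrow> l"
      using l[of "(m, x)"] xD by auto
    then have "(\<lambda>n. (hat_avg m (u (r n)) x / (B m * c + 1)) * (B m * c + 1)) \<longlonglongrightarrow> l * (B m * c + 1)"
      by (intro tendsto_mult_right)
    ultimately show ?thesis unfolding convergent_def by auto
  qed
  have "convergent (\<lambda>n. hat_avg m (u (r n)) x)" for m x
  proof (rule real_Cauchy_convergent, rule metric_CauchyI)
    fix e :: real assume e: "0 < e"
    obtain L where L: "0 \<le> L" "\<And>z z'::'a. \<bar>hat_sum m z - hat_sum m z'\<bar> \<le> L * norm (z - z')"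
      using hat_sum_lipschitz[of m, where 'a='a] by blast
    define \<delta> where "\<delta> = e / (3 * (L * c + 1))"
    have Lc: "0 \<le> L * c" using L(1) c0 by simp
    have \<delta>: "0 < \<delta>" unfolding \<delta>_def using e Lc by (intro divide_pos_pos) auto
    obtain d where d: "d \<in> D" "d \<in> ball x \<delta>" using D(2)[of "ball x \<delta>"] \<delta> by auto
    have close: "\<bar>hat_avg m (u n) x - hat_avg m (u n) d\<bar> \<le> e / 3" for n
    proof -
      have "\<bar>hat_avg m (u n) x - hat_avg m (u n) d\<bar> \<le> L * norm (x - d) * (LINT y|lborel. \<bar>u n y\<bar>)"
        by (rule hat_avg_bounds(2)[OF u L(2)])
      also have "\<dots> \<le> L * \<delta> * c"
        using d(2) L(1) c[of n] \<delta> by (intro mult_mono mult_nonneg_nonneg) (auto simp: dist_norm)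
      also have "\<dots> \<le> e / 3" unfolding \<delta>_def using e Lc by (simp add: field_simps)
      finally show ?thesis .
    qed
    have "Cauchy (\<lambda>n. hat_avg m (u (r n)) d)" using convD[OF d(1)] by (simp add: Cauchy_convergent_iff)
    then obtain N where N: "\<And>n k. n \<ge> N \<Longrightarrow> k \<ge> N \<Longrightarrow>
        dist (hat_avg m (u (r n)) d) (hat_avg m (u (r k)) d) < e / 3"
      using e metric_CauchyD[of _ "e/3"] by (metis divide_pos_pos zero_less_numeral)
    have "dist (hat_avg m (u (r n)) x) (hat_avg m (u (r k)) x) < e" if "n \<ge> N" "k \<ge> N" for n k
      using N[OF that] close[of "r n"] close[of "r k"] unfolding dist_real_def by linarith
    then show "\<exists>M. \<forall>n\<ge>M. \<forall>k\<ge>M. dist (hat_avg m (u (r n)) x) (hat_avg m (u (r k)) x) < e" by blast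
  qed
  then have "\<forall>m x. convergent (\<lambda>n. hat_avg m (u (r n)) x)" by blast
  with r show ?thesis by (rule that)
qed

text \<open>
  For a large \<open>m\<close> all functions of the sequence are uniformly close to their averages at
  scale \<open>m\<close>, and along the subsequence these averages converge in \<open>L\<^sup>2\<close> by dominated convergence.
  Hence the subsequence is Cauchy.
\<close>
lemma H_compact:
  fixes u :: "nat \<Rightarrow> 'a::euclidean_space \<Rightarrow> real"
  assumes \<Omega>: "\<Omega> \<in> sets borel" "emeasure lborel \<Omega> < \<infinity>" and u: "\<And>n. u n \<in> H_space \<Omega>"
    and A: "\<And>n. ip (u n) (u n) \<le> A" and B: "\<And>n. form_E (u n) (u n) \<le> B"
  obtains r :: "nat \<Rightarrow> nat" and v where "strict_mono r" "v \<in> H_space \<Omega>"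
    "(\<lambda>n. sq_dist ip (u (r n)) v) \<longlonglongrightarrow> 0"
proof -
  note i1 = L2_integrable_1[OF \<Omega> H_L2[OF u]]
  let ?c = "A + measure lborel \<Omega>"
  have c: "(LINT y|lborel. \<bar>u n y\<bar>) \<le> ?c" for n using i1(2)[of n] A[of n] by linarith
  obtain r :: "nat \<Rightarrow> nat" where r: "strict_mono r" and conv: "\<forall>m x. convergent (\<lambda>n. hat_avg m (u (r n)) x)"
    by (rule hat_avg_subseq[where u = u, OF i1(1) c])
  have Cy: "\<exists>N. \<forall>n\<ge>N. \<forall>k\<ge>N. sq_dist ip (u (r n)) (u (r k)) < e"
    if e: "0 < e" for e
  proof -
    obtain c0 where c0: "0 < c0" "\<And>m. real m * c0 \<le> hat_mass TYPE('a) m"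
      using hat_mass_ge[where 'a='a] by blast
    have B0: "0 \<le> B" using B[of 0] E.nonneg[OF u[of 0]] by linarith
    define q where "q = 2 * B / c_const DIM('a)"
    have q0: "0 \<le> q" unfolding q_def using B0 c_const_pos[where 'a='a] by simp
    \<comment> \<open>\<open>q / K\<close> bounds the error of averaging; it enters ten times in the triangle inequalities below\<close>
    obtain m :: nat where m: "(20 * q / e + 1) / c0 < real m" using reals_Archimedean2 by blast
    define K where "K = hat_mass TYPE('a) m"
    have Kq: "20 * q / e + 1 < K"
      using m c0(2)[of m] c0(1) unfolding K_def by (simp add: pos_divide_less_eq)
    moreover have "0 \<le> 20 * q / e" using q0 e by (intro divide_nonneg_pos) auto
    ultimately have K: "0 < K" by linarith
    have Kq': "q / K < e / 20"
    proof -
      have "20 * q / e < K" using Kq by linarith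
      then have "20 * q < K * e" using e by (simp add: pos_divide_less_eq)
      then show ?thesis using K by (simp add: pos_divide_less_eq mult.commute)
    qed
    define w where "w n x = indicat_real \<Omega> x * (hat_avg m (u (r n)) x / K)" for n x
    have w: "w n \<in> L2 \<Omega>" and wu: "sq_dist ip (u (r n)) (w n) \<le> q / K" for n
    proof -
      note h = hat_avg_approx[OF \<Omega> u[of "r n"], of m, folded K_def, OF K]
      show "w n \<in> L2 \<Omega>" unfolding w_def[abs_def] by (rule h(1))
      have "2 / (c_const DIM('a) * K) * form_E (u (r n)) (u (r n)) \<le> 2 / (c_const DIM('a) * K) * B"
        using B K c_const_pos[where 'a='a] by (intro mult_left_mono) auto
      then show "sq_dist ip (u (r n)) (w n) \<le> q / K"
        unfolding w_def[abs_def] q_def using h(2) by (simp add: field_simps)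
    qed
    define a where "a x = lim (\<lambda>n. w n x)" for x
    have wm[measurable]: "w n \<in> borel_measurable borel" for n using w L2_measurable by blast
    have am[measurable]: "a \<in> borel_measurable borel" unfolding a_def[abs_def] by measurable
    have wa: "(\<lambda>n. w n x) \<longlonglongrightarrow> a x" for x
    proof -
      have "convergent (\<lambda>n. (indicat_real \<Omega> x * (1 / K)) * hat_avg m (u (r n)) x)"
        by (intro convergent_mult convergent_const conv[rule_format])
      then have "convergent (\<lambda>n. w n x)" unfolding w_def by simp
      then show ?thesis unfolding a_def by (simp add: convergent_LIMSEQ_iff)
    qed
    define M where "M = (\<Sum>i=1..m. (2 ^ DIM('a)) ^ i) * ?c / K"
    have wM: "\<bar>w n x\<bar> \<le> M * indicat_real \<Omega> x" for n x
    proof -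
      have "\<bar>hat_avg m (u (r n)) x\<bar> \<le> (\<Sum>i=1..m. (2 ^ DIM('a)) ^ i) * (LINT y|lborel. \<bar>u (r n) y\<bar>)"
        by (rule hat_avg_bounds(1)[OF i1(1)])
      also have "\<dots> \<le> (\<Sum>i=1..m. (2 ^ DIM('a)) ^ i) * ?c"
        by (intro mult_left_mono c sum_nonneg) auto
      finally have "\<bar>hat_avg m (u (r n)) x\<bar> / K \<le> M" unfolding M_def using K by (intro divide_right_mono) auto
      then show ?thesis using K by (cases "x \<in> \<Omega>") (auto simp: w_def)
    qed
    have aM: "\<bar>a x\<bar> \<le> M * indicat_real \<Omega> x" for x
      by (rule LIMSEQ_le_const2[OF tendsto_rabs[OF wa]]) (use wM in auto)
    have sqM: "(w n x - a x)\<^sup>2 \<le> (2 * M)\<^sup>2 * indicat_real \<Omega> x" for n x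
    proof (cases "x \<in> \<Omega>")
      case True
      have "\<bar>w n x - a x\<bar> \<le> 2 * M" using wM[of n x] aM[of x] True by simp
      then have "\<bar>w n x - a x\<bar>\<^sup>2 \<le> (2 * M)\<^sup>2" by (intro power_mono) auto
      then show ?thesis using True by simp
    next
      case False
      then show ?thesis using wM[of n x] aM[of x] by simp
    qed
    have aL: "a \<in> L2 \<Omega>"
    proof -
      have "integrable lborel (\<lambda>x. (a x)\<^sup>2)"
      proof (rule Bochner_Integration.integrable_bound)
        show "integrable lborel (\<lambda>x. M\<^sup>2 * indicat_real \<Omega> x)" using \<Omega> by simp
        have "(a x)\<^sup>2 \<le> M\<^sup>2 * indicat_real \<Omega> x" for x
          using power_mono[OF aM[of x], of 2] by (auto simp: power_mult_distrib indicator_def split: if_splits)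
        then show "AE x in lborel. norm ((a x)\<^sup>2) \<le> norm (M\<^sup>2 * indicat_real \<Omega> x)" by (intro AE_I2) simp
      qed measurable
      moreover have "a x = 0" if "x \<notin> \<Omega>" for x using aM[of x] that by simp
      ultimately show ?thesis by (auto simp: L2_def)
    qed
    have "(\<lambda>n. LINT x|lborel. (w n x - a x)\<^sup>2) \<longlonglongrightarrow> (LINT x|(lborel::'a measure). 0)"
    proof (rule integral_dominated_convergence[where w = "\<lambda>x. (2 * M)\<^sup>2 * indicat_real \<Omega> x"])
      show "integrable lborel (\<lambda>x. (2 * M)\<^sup>2 * indicat_real \<Omega> x)" using \<Omega> by simp
      show "AE x in lborel. (\<lambda>n. (w n x - a x)\<^sup>2) \<longlonglongrightarrow> 0"
      proof (rule AE_I2)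
        fix x
        have "(\<lambda>n. (w n x - a x)\<^sup>2) \<longlonglongrightarrow> (a x - a x)\<^sup>2" by (intro tendsto_intros wa)
        then show "(\<lambda>n. (w n x - a x)\<^sup>2) \<longlonglongrightarrow> 0" by simp
      qed
      show "AE x in lborel. norm ((w n x - a x)\<^sup>2) \<le> (2 * M)\<^sup>2 * indicat_real \<Omega> x" for n
        using sqM by (intro AE_I2) simp
    qed measurable
    then have "(\<lambda>n. sq_dist ip (w n) a) \<longlonglongrightarrow> 0"
      by (simp add: ip_def power2_eq_square)
    then obtain N where N: "\<And>n. n \<ge> N \<Longrightarrow> sq_dist ip (w n) a < e / 40"
      using LIMSEQ_D[of _ 0 "e/40"] e by fastforce
    have "sq_dist ip (u (r n)) (u (r k)) < e" if "n \<ge> N" "k \<ge> N" for n k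
    proof -
      note U = H_L2[OF u]
      have "sq_dist ip (u (r n)) (u (r k))
        \<le> 2 * sq_dist ip (u (r n)) (w n)
          + 2 * sq_dist ip (w n) (u (r k))"
        by (rule ip.diff_sq_le[OF U w U])
      moreover have "sq_dist ip (w n) (u (r k))
        \<le> 2 * sq_dist ip (w n) a + 2 * sq_dist ip a (u (r k))"
        by (rule ip.diff_sq_le[OF w aL U])
      moreover have "sq_dist ip a (u (r k))
        \<le> 2 * sq_dist ip a (w k) + 2 * sq_dist ip (w k) (u (r k))"
        by (rule ip.diff_sq_le[OF aL w U])
      ultimately show ?thesis
        using e N[OF that(1)] N[OF that(2)] wu[of n] wu[of k] Kq' ip.diff_comm[OF aL w[of k]]
          ip.diff_comm[OF w[of k] U[of "r k"]] by linarith
    qed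
    then show ?thesis by blast
  qed
  obtain v where v: "v \<in> L2 \<Omega>" "(\<lambda>n. sq_dist ip (u (r n)) v) \<longlonglongrightarrow> 0"
    by (rule L2_complete[where u = "\<lambda>n. u (r n)", OF \<Omega> H_L2[OF u] Cy])
  have "v \<in> H_space \<Omega>" by (rule form_E_lsc(1)[OF u v B tendsto_const])
  from that[OF r this v(2)] show ?thesis .
qed

section \<open>Poincare inequality and Lipschitz functions\<close>

text \<open>
  Let \<open>g(h)\<close> be the squared \<open>L\<^sup>2\<close> distance of \<open>u\<close> to its translate by \<open>h\<close>. A translation by \<open>n h\<close> with
  \<open>n |h|\<close> larger than the diameter moves the support off itself, so telescoping over \<open>n\<close> steps gives
  \<open>\<langle>u, u\<rangle> \<le> n\<^sup>2 g(h)\<close>. Integrating over the shell \<open>1/2 \<le> |h| < 1\<close>, on which the kernel is at least 1 and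
  one \<open>n\<close> serves all \<open>h\<close>, bounds \<open>\<langle>u, u\<rangle>\<close> by the energy. Since the topology of the paths
  is that of the energy alone, this is what makes paths continuous in \<open>L\<^sup>2\<close>.
\<close>
lemma H_Poincare:
  fixes \<Omega> :: "'a::euclidean_space set"
  assumes \<Omega>: "bounded \<Omega>"
  shows "\<exists>C>0. \<forall>u\<in>H_space \<Omega>. ip u u \<le> C * form_E u u"
proof -
  obtain R where R: "\<And>x. x \<in> \<Omega> \<Longrightarrow> norm x \<le> R" using \<Omega> by (auto simp: bounded_iff)
  \<comment> \<open>\<open>n |h| \<ge> n / 2\<close> then exceeds the diameter of a ball of radius \<open>R\<close>\<close>
  obtain n :: nat where n: "4 * \<bar>R\<bar> + 1 < real n" using reals_Archimedean2 by blast
  \<comment> \<open>a shell, so that \<open>|h|\<close> is bounded below and \<open>n\<close> does not depend on \<open>h\<close>\<close>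
  define S where "S = ball (0::'a) 1 - ball 0 (1/2)"
  have Sm[measurable]: "S \<in> sets borel" unfolding S_def by measurable
  let ?V = "measure lborel (ball (0::'a) 1)"
  have V: "0 < ?V" using content_ball_pos[of 1 "0::'a"] by simp
  have h: "measure lborel (ball (0::'a) (1/2)) = (1/2) ^ DIM('a) * ?V"
    using content_ball_conv_unit_ball[of "1/2" "0::'a"] by simp
  have p: "(1/2::real) ^ DIM('a) \<le> (1/2) ^ 1" by (rule power_decreasing) auto
  have "measure lborel S = ?V - measure lborel (ball (0::'a) (1/2))" unfolding S_def
    using emeasure_lborel_ball_finite[of "0::'a" 1] by (intro measure_Diff) auto
  moreover have "(1/2) ^ DIM('a) * ?V \<le> (1/2) * ?V" using p V by (intro mult_right_mono) auto
  ultimately have S0: "0 < measure lborel S" using h V by linarith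
  have "emeasure lborel S \<le> emeasure lborel (ball (0::'a) 1)" unfolding S_def by (rule emeasure_mono) auto
  also have "\<dots> < \<infinity>" by (rule emeasure_lborel_ball_finite)
  finally have Se: "emeasure lborel S = ennreal (measure lborel S)"
    by (intro emeasure_eq_ennreal_measure) auto
  let ?C = "(real n)\<^sup>2 * 2 / (c_const DIM('a) * measure lborel S)"
  have n0: "0 < real n" using n by linarith
  have "ip u u \<le> ?C * form_E u u" if u: "u \<in> H_space \<Omega>" for u
  proof -
    note uL = H_L2[OF u]
    note [measurable] = L2_measurable[OF uL]
    have step: "ennreal (ip u u) \<le> ennreal ((real n)\<^sup>2) * (\<integral>\<^sup>+x. ennreal ((u x - u (h + x))\<^sup>2) \<partial>lborel)"
      if h: "h \<in> S" for h
    proof -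
      let ?f = "\<lambda>i x. u (real i *\<^sub>R h + x)"
      have h2: "1/2 \<le> norm h" using h by (auto simp: S_def)
      have pt: "(u x)\<^sup>2 \<le> real n * (\<Sum>i<n. (?f i x - ?f (Suc i) x)\<^sup>2)" for x
      proof (cases "x \<in> \<Omega>")
        case True
        have "real n *\<^sub>R h + x \<notin> \<Omega>"
        proof
          assume a: "real n *\<^sub>R h + x \<in> \<Omega>"
          have "real n * (1/2) \<le> norm (real n *\<^sub>R h)" using h2 n0 by simp
          also have "\<dots> \<le> norm (real n *\<^sub>R h + x) + norm x" using norm_triangle_ineq4[of "real n *\<^sub>R h + x" x] by simp
          also have "\<dots> \<le> 2 * \<bar>R\<bar>" using R[OF a] R[OF True] by linarith
          finally show False using n by linarith
        qed
        then have "u (real n *\<^sub>R h + x) = 0" by (rule L2_zero[OF uL])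
        then have "u x = (\<Sum>i<n. ?f i x - ?f (Suc i) x)"
          using sum_lessThan_telescope'[of "\<lambda>i. ?f i x" n] by simp
        then show ?thesis using sum_squared_le_sum_of_squares[of "\<lambda>i. ?f i x - ?f (Suc i) x" "{..<n}"]
          by (simp add: mult.commute)
      next
        case False
        then show ?thesis by (simp add: L2_zero[OF uL] sum_nonneg)
      qed
      have "ennreal (ip u u) = (\<integral>\<^sup>+x. ennreal ((u x)\<^sup>2) \<partial>lborel)" by (simp add: ip_nn[OF uL])
      also have "\<dots> \<le> (\<integral>\<^sup>+x. ennreal (real n) * (\<Sum>i<n. ennreal ((?f i x - ?f (Suc i) x)\<^sup>2)) \<partial>lborel)"
      proof (rule nn_integral_mono)
        fix x
        have "ennreal ((u x)\<^sup>2) \<le> ennreal (real n * (\<Sum>i<n. (?f i x - ?f (Suc i) x)\<^sup>2))"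
          by (rule ennreal_leI[OF pt])
        also have "\<dots> = ennreal (real n) * (\<Sum>i<n. ennreal ((?f i x - ?f (Suc i) x)\<^sup>2))"
          by (subst ennreal_mult) (auto simp: sum_nonneg sum_ennreal)
        finally show "ennreal ((u x)\<^sup>2) \<le> ennreal (real n) * (\<Sum>i<n. ennreal ((?f i x - ?f (Suc i) x)\<^sup>2))" .
      qed
      also have "\<dots> = ennreal (real n) * (\<Sum>i<n. \<integral>\<^sup>+x. ennreal ((?f i x - ?f (Suc i) x)\<^sup>2) \<partial>lborel)"
        by (subst nn_integral_cmult, measurable, subst nn_integral_sum) auto
      also have "(\<Sum>i<n. \<integral>\<^sup>+x. ennreal ((?f i x - ?f (Suc i) x)\<^sup>2) \<partial>lborel)
          = (\<Sum>i<n. \<integral>\<^sup>+x. ennreal ((u x - u (h + x))\<^sup>2) \<partial>lborel)"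
      proof (rule sum.cong[OF refl])
        fix i
        have "(\<integral>\<^sup>+x. ennreal ((?f i x - ?f (Suc i) x)\<^sup>2) \<partial>lborel)
           = (\<integral>\<^sup>+x. (\<lambda>x. ennreal ((u x - u (h + x))\<^sup>2)) (real i *\<^sub>R h + x) \<partial>lborel)"
          by (intro nn_integral_cong) (simp add: algebra_simps)
        also have "\<dots> = (\<integral>\<^sup>+x. ennreal ((u x - u (h + x))\<^sup>2) \<partial>lborel)"
          by (rule nn_integral_translate) measurable
        finally show "(\<integral>\<^sup>+x. ennreal ((?f i x - ?f (Suc i) x)\<^sup>2) \<partial>lborel) = \<dots>" .
      qed
      also have "ennreal (real n) * \<dots> = ennreal ((real n)\<^sup>2) * (\<integral>\<^sup>+x. ennreal ((u x - u (h + x))\<^sup>2) \<partial>lborel)"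
        by (simp add: power2_eq_square ennreal_mult mult.assoc ennreal_of_nat_eq_real_of_nat)
      finally show ?thesis .
    qed
    have "ennreal (ip u u * measure lborel S) = (\<integral>\<^sup>+h. ennreal (ip u u) * indicator S h \<partial>lborel)"
      using ip.nonneg[OF uL] by (simp add: nn_integral_cmult_indicator Se ennreal_mult)
    also have "\<dots> \<le> (\<integral>\<^sup>+h. ennreal ((real n)\<^sup>2) * (\<integral>\<^sup>+x. ennreal ((u x - u (h + x))\<^sup>2 * kernel_k h) \<partial>lborel) \<partial>lborel)"
    proof (rule nn_integral_mono)
      fix h
      show "ennreal (ip u u) * indicator S h \<le> ennreal ((real n)\<^sup>2) * (\<integral>\<^sup>+x. ennreal ((u x - u (h + x))\<^sup>2 * kernel_k h) \<partial>lborel)"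
      proof (cases "h \<in> S")
        case True
        then have "norm h < 1" "0 < norm h" by (auto simp: S_def)
        then have k1: "1 \<le> kernel_k h" by (simp add: kernel_k_def power_le_one)
        have "(\<integral>\<^sup>+x. ennreal ((u x - u (h + x))\<^sup>2) \<partial>lborel) \<le> (\<integral>\<^sup>+x. ennreal ((u x - u (h + x))\<^sup>2 * kernel_k h) \<partial>lborel)"
        proof (intro nn_integral_mono ennreal_leI)
          show "(u x - u (h + x))\<^sup>2 \<le> (u x - u (h + x))\<^sup>2 * kernel_k h" for x
            using mult_left_mono[OF k1, of "(u x - u (h + x))\<^sup>2"] by simp
        qed
        then have "ennreal ((real n)\<^sup>2) * (\<integral>\<^sup>+x. ennreal ((u x - u (h + x))\<^sup>2) \<partial>lborel)
          \<le> ennreal ((real n)\<^sup>2) * (\<integral>\<^sup>+x. ennreal ((u x - u (h + x))\<^sup>2 * kernel_k h) \<partial>lborel)"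
          by (rule mult_left_mono) simp
        with step[OF True] True show ?thesis by (simp add: order_trans)
      qed simp
    qed
    also have "\<dots> = ennreal ((real n)\<^sup>2) * (\<integral>\<^sup>+h. \<integral>\<^sup>+x. ennreal ((u x - u (h + x))\<^sup>2 * kernel_k h) \<partial>lborel \<partial>lborel)"
      by (rule nn_integral_cmult) measurable
    also have "(\<integral>\<^sup>+h. \<integral>\<^sup>+x. ennreal ((u x - u (h + x))\<^sup>2 * kernel_k h) \<partial>lborel \<partial>lborel)
       = (\<integral>\<^sup>+x. \<integral>\<^sup>+h. ennreal ((u x - u (h + x))\<^sup>2 * kernel_k h) \<partial>lborel \<partial>lborel)"
      by (rule lborel_pair.Fubini') measurable
    also have "\<dots> = (\<integral>\<^sup>+x. \<integral>\<^sup>+y. ennreal ((u x - u y)\<^sup>2 * kernel_k (x - y)) \<partial>lborel \<partial>lborel)"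
    proof (rule nn_integral_cong)
      fix x
      have "(\<integral>\<^sup>+y. ennreal ((u x - u y)\<^sup>2 * kernel_k (x - y)) \<partial>lborel)
          = (\<integral>\<^sup>+h. (\<lambda>y. ennreal ((u x - u y)\<^sup>2 * kernel_k (x - y))) (x + h) \<partial>lborel)"
        by (rule nn_integral_translate[symmetric]) measurable
      also have "\<dots> = (\<integral>\<^sup>+h. ennreal ((u x - u (h + x))\<^sup>2 * kernel_k h) \<partial>lborel)"
        using kernel_k_commute[of "0::'a"] by (intro nn_integral_cong) (simp add: add.commute)
      finally show "(\<integral>\<^sup>+h. ennreal ((u x - u (h + x))\<^sup>2 * kernel_k h) \<partial>lborel)
         = (\<integral>\<^sup>+y. ennreal ((u x - u y)\<^sup>2 * kernel_k (x - y)) \<partial>lborel)" by simp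
    qed
    also have "\<dots> = ennreal (2 / c_const DIM('a) * form_E u u)" by (rule energy_nn[OF u])
    also have "ennreal ((real n)\<^sup>2) * \<dots> = ennreal ((real n)\<^sup>2 * (2 / c_const DIM('a) * form_E u u))"
      using c_const_pos[where 'a='a] E.nonneg[OF u] by (intro ennreal_mult[symmetric]) auto
    finally have "ip u u * measure lborel S \<le> (real n)\<^sup>2 * (2 / c_const DIM('a) * form_E u u)"
      using c_const_pos[where 'a='a] E.nonneg[OF u] by (subst (asm) ennreal_le_iff) auto
    then show ?thesis using S0 c_const_pos[where 'a='a] by (simp add: field_simps)
  qed
  moreover have "0 < ?C" using n0 S0 c_const_pos[where 'a='a] by simp
  ultimately show ?thesis by blast
qed

text \<open>
  A source of further elements of the space that needs no cut-off functions: translation preserves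
  the energy, the minimum is 1-Lipschitz in each argument, and the result vanishes wherever \<open>u\<close> does.
\<close>
lemma H_min_translate:
  fixes u :: "'a::euclidean_space \<Rightarrow> real"
  assumes u: "u \<in> H_space \<Omega>"
  shows "(\<lambda>x. min \<bar>u x\<bar> \<bar>u (h + x)\<bar>) \<in> H_space \<Omega>" (is "?w \<in> _")
proof -
  let ?g = "\<lambda>z. grad_k u ((h, h) + z)"
  note [measurable] = L2_measurable[OF H_L2[OF u]]
  have gm[measurable]: "grad_k u \<in> borel_measurable borel"
    using grad_k_measurable[of u] by (simp add: lborel_prod)
  have i: "integrable lborel (\<lambda>z. (grad_k u z)\<^sup>2)" using u by (simp add: H_space_iff_grad lborel_prod)
  then have "integrable (distr lborel borel ((+) (h, h))) (\<lambda>z. (grad_k u z)\<^sup>2)" by (simp add: lborel_distr_plus)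
  then have j: "integrable lborel (\<lambda>z. (?g z)\<^sup>2)" by (subst (asm) integrable_distr_eq) auto
  have le: "(grad_k ?w z)\<^sup>2 \<le> 2 * (grad_k u z)\<^sup>2 + 2 * (?g z)\<^sup>2" for z
  proof -
    obtain x y where z: "z = (x, y)" by (cases z)
    let ?k = "sqrt (c_const DIM('a) / 2 * kernel_k (x - y))"
    have "\<bar>?w x - ?w y\<bar> \<le> \<bar>u x - u y\<bar> + \<bar>u (h + x) - u (h + y)\<bar>"
    proof -
      have "\<bar>min a b - min c d\<bar> \<le> \<bar>a - c\<bar> + \<bar>b - d\<bar>" for a b c d :: real by linarith
      then show ?thesis by (rule order_trans) (intro add_mono abs_triangle_ineq3)
    qed
    then have "\<bar>?k\<bar> * \<bar>?w x - ?w y\<bar> \<le> \<bar>?k\<bar> * (\<bar>u x - u y\<bar> + \<bar>u (h + x) - u (h + y)\<bar>)" by (rule mult_left_mono) simp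
    then have "\<bar>grad_k ?w z\<bar> \<le> \<bar>grad_k u z\<bar> + \<bar>?g z\<bar>"
      by (simp only: z grad_k_def abs_mult fst_conv snd_conv fst_add snd_add add_diff_cancel_left distrib_left)
    then have "(grad_k ?w z)\<^sup>2 \<le> (\<bar>grad_k u z\<bar> + \<bar>?g z\<bar>)\<^sup>2" using power_mono[of "\<bar>grad_k ?w z\<bar>" _ 2] by simp
    then show ?thesis using sum_squares_bound[of "\<bar>grad_k u z\<bar>" "\<bar>?g z\<bar>"] by (simp add: power2_sum)
  qed
  have wm: "?w \<in> borel_measurable borel" by measurable
  have "integrable lborel (\<lambda>z. (grad_k ?w z)\<^sup>2)"
  proof (rule Bochner_Integration.integrable_bound)
    show "integrable lborel (\<lambda>z. 2 * (grad_k u z)\<^sup>2 + 2 * (?g z)\<^sup>2)" using i j by simp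
    show "(\<lambda>z. (grad_k ?w z)\<^sup>2) \<in> borel_measurable lborel"
      using grad_k_measurable[OF wm] by (intro borel_measurable_power) (simp add: lborel_prod)
  qed (use le in simp)
  then show ?thesis
    using L2_contraction[OF H_L2[OF u] wm] by (simp add: H_space_iff_grad lborel_prod)
qed

section \<open>The shifted form and its resolvent\<close>

text \<open>
  The coefficient may be negative; this covers \<open>E_L - \<mu> \<langle>\<sqdot>, \<sqdot>\<rangle>\<close>, which is semidefinite by the choice
  of the first eigenvalue \<open>\<mu>\<close>.
\<close>
lemma psd_form_comb:
  assumes "psd_form V b1" "psd_form V b2" "\<And>u. u \<in> V \<Longrightarrow> 0 \<le> b1 u u + c * b2 u u"
  shows "psd_form V (\<lambda>u v. b1 u v + c * b2 u v)"
proof -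
  interpret b1: psd_form V b1 by fact
  interpret b2: psd_form V b2 by fact
  show ?thesis
  proof
    fix u v w and a :: real
    assume u: "u \<in> V"
    show "(\<lambda>x. a * u x) \<in> V" by (rule b1.scale_mem[OF u])
    show "0 \<le> b1 u u + c * b2 u u" by (rule assms(3)[OF u])
    assume v: "v \<in> V"
    show "(\<lambda>x. u x + v x) \<in> V" by (rule b1.add_mem[OF u v])
    show "b1 u v + c * b2 u v = b1 v u + c * b2 v u" by (simp only: b1.sym[OF u v] b2.sym[OF u v])
    show "b1 (\<lambda>x. a * u x) v + c * b2 (\<lambda>x. a * u x) v = a * (b1 u v + c * b2 u v)"
      by (simp only: b1.scale_left[OF u v] b2.scale_left[OF u v]) (simp add: algebra_simps)
    assume w: "w \<in> V"
    show "b1 (\<lambda>x. u x + v x) w + c * b2 (\<lambda>x. u x + v x) w = b1 u w + c * b2 u w + (b1 v w + c * b2 v w)"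
      by (simp only: b1.add_left[OF u v w] b2.add_left[OF u v w]) (simp add: algebra_simps)
  qed
qed

lemma linear_term_zero:
  assumes "\<And>t::real. 0 \<le> 2 * t * a + t\<^sup>2 * b" and "0 \<le> b"
  shows "a = 0"
proof (rule ccontr)
  assume a: "a \<noteq> 0"
  have b: "0 < b + 1" using assms(2) by simp
  define s where "s = a / (b + 1)"
  have s: "a = s * (b + 1)" "s \<noteq> 0" using a b by (auto simp: s_def)
  have "2 * (- s) * a + (- s)\<^sup>2 * b = - (s\<^sup>2 * (b + 2))"
    unfolding s(1) by (simp add: power2_eq_square algebra_simps)
  moreover have "0 < s\<^sup>2 * (b + 2)" using s(2) assms(2) by (intro mult_pos_pos) auto
  ultimately show False using assms(1)[of "- s"] by linarith
qed

lemma set_integral_vanishing: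
  fixes f :: "'a::euclidean_space \<Rightarrow> real"
  assumes "\<And>x. x \<notin> \<Omega> \<Longrightarrow> f x = 0"
  shows "(LINT x:\<Omega>|lborel. f x) = (LINT x|lborel. f x)"
  unfolding set_lebesgue_integral_def
  by (rule Bochner_Integration.integral_cong) (use assms in \<open>auto simp: indicator_def\<close>)

locale bounded_open_set =
  fixes \<Omega> :: "'a::euclidean_space set"
  assumes open_set: "open \<Omega>" and bounded_set: "bounded \<Omega>"
begin

abbreviation "H \<equiv> H_space \<Omega>"

lemma set_measurable: "\<Omega> \<in> sets borel" and set_finite: "emeasure lborel \<Omega> < \<infinity>"
  using open_set emeasure_bounded_finite[OF bounded_set] by auto

lemmas J_int = form_J_le(1)[OF set_measurable set_finite]
lemmas J_le = form_J_le(2)[OF set_measurable set_finite]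

lemma form_J_add:
  assumes "u \<in> L2 \<Omega>" "v \<in> L2 \<Omega>" "w \<in> L2 \<Omega>"
  shows "form_J (\<lambda>x. u x + v x) w = form_J u w + form_J v w"
proof -
  have "form_J (\<lambda>x. u x + v x) w = (LINT z|lborel2.
     (case z of (x, y) \<Rightarrow> u x * w y * kernel_j (x - y)) + (case z of (x, y) \<Rightarrow> v x * w y * kernel_j (x - y)))"
    unfolding form_J_def by (rule Bochner_Integration.integral_cong) (auto simp: algebra_simps)
  also have "\<dots> = form_J u w + form_J v w"
    unfolding form_J_def by (rule Bochner_Integration.integral_add[OF J_int J_int]) (use assms in auto)
  finally show ?thesis .
qed

lemma form_J_scale: "form_J (\<lambda>x. c * u x) w = c * form_J u w"
proof -
  have "form_J (\<lambda>x. c * u x) w = (LINT z|lborel2. c * (case z of (x, y) \<Rightarrow> u x * w y * kernel_j (x - y)))"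
    unfolding form_J_def by (rule Bochner_Integration.integral_cong) (auto simp: algebra_simps)
  then show ?thesis unfolding form_J_def by simp
qed

lemma form_J_sym:
  assumes "u \<in> L2 \<Omega>" "v \<in> L2 \<Omega>"
  shows "form_J u v = form_J v u"
proof -
  have m: "(\<lambda>(x, y). u x * v y * kernel_j (x - y)) \<in> borel_measurable lborel2"
    using J_int[OF assms] by auto
  have "form_J u v = (LINT (x, y)|lborel2. (case (y, x) of (x, y) \<Rightarrow> u x * v y * kernel_j (x - y)))"
    unfolding form_J_def by (rule lborel_pair.integral_product_swap[OF m, symmetric])
  also have "\<dots> = form_J v u"
    unfolding form_J_def
    by (rule Bochner_Integration.integral_cong) (auto simp: kernel_j_commute mult.commute)
  finally show ?thesis .
qed

text \<open>
  The multiple of \<open>\<langle>u, u\<rangle>\<close> that outweighs the two terms of lower order in \<open>E_L\<close>, whatever the sign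
  of \<open>\<rho>_N\<close>; the summand 1 makes the lower order part dominate \<open>\<langle>u, u\<rangle>\<close>.
\<close>
definition shift :: real where
  "shift = c_const DIM('a) * measure lborel \<Omega> + \<bar>rho_const DIM('a)\<bar> + 1"

definition form_G :: "('a \<Rightarrow> real) \<Rightarrow> ('a \<Rightarrow> real) \<Rightarrow> real" where
  "form_G u v = (shift + rho_const DIM('a)) * ip u v - c_const DIM('a) * form_J u v"

definition form_Q :: "('a \<Rightarrow> real) \<Rightarrow> ('a \<Rightarrow> real) \<Rightarrow> real" where
  "form_Q u v = form_E u v + form_G u v"

lemma shift_ge_1: "1 \<le> shift"
  using c_const_pos[where 'a='a] by (simp add: shift_def)

lemma form_EL_eq: "form_EL u v = form_Q u v - shift * ip u v"
  unfolding form_EL_def form_Q_def form_G_def form_J_def[symmetric] ip_def[symmetric]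
  by (simp add: distrib_right)

lemma form_G_bounds:
  assumes u: "u \<in> L2 \<Omega>"
  shows "ip u u \<le> form_G u u" "form_G u u \<le> 2 * shift * ip u u"
proof -
  let ?c = "c_const DIM('a)" and ?V = "measure lborel \<Omega>" and ?\<rho> = "rho_const DIM('a)"
  have "\<bar>form_J u u\<bar> \<le> ?V * ip u u" using J_le[OF u u] by simp
  then have "?c * \<bar>form_J u u\<bar> \<le> ?c * (?V * ip u u)"
    using c_const_pos[where 'a='a] by (intro mult_left_mono) auto
  then have "\<bar>?c * form_J u u\<bar> \<le> ?c * ?V * ip u u"
    using c_const_pos[where 'a='a] by (simp add: abs_mult mult.assoc)
  moreover have "\<bar>?\<rho> * ip u u\<bar> \<le> \<bar>?\<rho>\<bar> * ip u u" using ip.nonneg[OF u] by (simp add: abs_mult)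
  moreover have "shift * ip u u = ?c * ?V * ip u u + \<bar>?\<rho>\<bar> * ip u u + ip u u"
    by (simp add: shift_def algebra_simps)
  moreover have "form_G u u = shift * ip u u + ?\<rho> * ip u u - ?c * form_J u u"
    by (simp add: form_G_def algebra_simps)
  ultimately show "ip u u \<le> form_G u u" "form_G u u \<le> 2 * shift * ip u u"
    using ip.nonneg[OF u] by linarith+
qed

lemma psd_form_G: "psd_form (L2 \<Omega>) form_G"
proof
  fix u v w :: "'a \<Rightarrow> real" and a :: real
  assume u: "u \<in> L2 \<Omega>"
  show "(\<lambda>x. a * u x) \<in> L2 \<Omega>" by (rule ip.scale_mem[OF u])
  show "0 \<le> form_G u u" using form_G_bounds(1)[OF u] ip.nonneg[OF u] by linarith
  assume v: "v \<in> L2 \<Omega>"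
  show "(\<lambda>x. u x + v x) \<in> L2 \<Omega>" by (rule ip.add_mem[OF u v])
  show "form_G u v = form_G v u" unfolding form_G_def by (simp only: ip.sym[OF u v] form_J_sym[OF u v])
  show "form_G (\<lambda>x. a * u x) v = a * form_G u v" unfolding form_G_def
    by (simp only: ip.scale_left[OF u v] form_J_scale) (simp add: algebra_simps)
  assume w: "w \<in> L2 \<Omega>"
  show "form_G (\<lambda>x. u x + v x) w = form_G u w + form_G v w" unfolding form_G_def
    by (simp only: ip.add_left[OF u v w] form_J_add[OF u v w]) (simp add: algebra_simps)
qed

lemma psd_form_subspace:
  assumes "psd_form V b" "H \<subseteq> V"
  shows "psd_form H b"
proof -
  interpret b: psd_form V b by fact
  show ?thesis
  proof
    note V = subsetD[OF assms(2)]
    fix u v w and c :: real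
    assume u: "u \<in> H"
    show "(\<lambda>x. c * u x) \<in> H" by (rule E.scale_mem[OF u])
    show "0 \<le> b u u" by (rule b.nonneg[OF V[OF u]])
    assume v: "v \<in> H"
    show "(\<lambda>x. u x + v x) \<in> H" by (rule E.add_mem[OF u v])
    show "b u v = b v u" by (rule b.sym[OF V[OF u] V[OF v]])
    show "b (\<lambda>x. c * u x) v = c * b u v" by (rule b.scale_left[OF V[OF u] V[OF v]])
    assume w: "w \<in> H"
    show "b (\<lambda>x. u x + v x) w = b u w + b v w" by (rule b.add_left[OF V[OF u] V[OF v] V[OF w]])
  qed
qed

sublocale G: psd_form "L2 \<Omega>" form_G by (rule psd_form_G)

sublocale N: psd_form H ip
  by (rule psd_form_subspace[OF psd_form_ip]) (auto intro: H_L2)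

lemma psd_form_Q: "psd_form H form_Q"
proof -
  have "psd_form H (\<lambda>u v. form_E u v + 1 * form_G u v)"
  proof (rule psd_form_comb[OF psd_form_E])
    show "psd_form H form_G" by (rule psd_form_subspace[OF psd_form_G]) (auto intro: H_L2)
    show "0 \<le> form_E u u + 1 * form_G u u" if "u \<in> H" for u
      using E.nonneg[OF that] G.nonneg[OF H_L2[OF that]] by simp
  qed
  then show ?thesis by (simp add: form_Q_def[abs_def])
qed

sublocale Q: psd_form H form_Q by (rule psd_form_Q)

lemma form_Q_ge: "u \<in> H \<Longrightarrow> form_E u u + ip u u \<le> form_Q u u"
  using form_G_bounds(1)[OF H_L2] by (simp add: form_Q_def)

lemma L2_sphere_iff: "u \<in> L2_sphere \<Omega> \<longleftrightarrow> u \<in> H \<and> ip u u = 1"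
proof (cases "u \<in> H")
  case True
  have "(LINT x:\<Omega>|lborel. (u x)\<^sup>2) = ip u u"
    unfolding ip_def by (subst set_integral_vanishing) (auto simp: L2_zero[OF H_L2[OF True]] power2_eq_square)
  then show ?thesis by (simp add: L2_sphere_def)
qed (simp add: L2_sphere_def)

lemma E_r_eq: "u \<in> H \<Longrightarrow> E_r \<Omega> r u = form_EL u u - r * ip (pos_part u) (pos_part u)"
  unfolding E_r_def ip_def
  by (subst set_integral_vanishing) (auto simp: L2_zero[OF H_L2] pos_part_def power2_eq_square)

text \<open>\<open>(r + t) u\<^sup>+ - t u\<^sup>- = r u\<^sup>+ + t u\<close>.\<close>
lemma fucik_iff:
  "(r + t, t) \<in> fucik_spectrum \<Omega> \<longleftrightarrow> (\<exists>u\<in>H. \<not> (AE x in lborel. u x = 0) \<and>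
     (\<forall>v\<in>H. form_EL u v = r * ip (pos_part u) v + t * ip u v))"
proof -
  have "(LINT x:\<Omega>|lborel. ((r + t) * pos_part u x - t * neg_part u x) * v x) = r * ip (pos_part u) v + t * ip u v"
    if u: "u \<in> H" and v: "v \<in> H" for u v
  proof -
    have "(LINT x:\<Omega>|lborel. ((r + t) * pos_part u x - t * neg_part u x) * v x)
       = (LINT x|lborel. ((r + t) * pos_part u x - t * neg_part u x) * v x)"
      by (rule set_integral_vanishing) (simp add: L2_zero[OF H_L2[OF v]])
    also have "\<dots> = (LINT x|lborel. r * (pos_part u x * v x) + t * (u x * v x))"
    proof (rule Bochner_Integration.integral_cong[OF refl])
      fix x
      show "((r + t) * pos_part u x - t * neg_part u x) * v x = r * (pos_part u x * v x) + t * (u x * v x)"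
        unfolding parts_diff[of u x, symmetric] by (simp add: algebra_simps)
    qed
    also have "\<dots> = r * ip (pos_part u) v + t * ip u v"
      unfolding ip_def using L2_mult_integrable[OF H_L2[OF u] H_L2[OF v]]
        L2_mult_integrable[OF H_L2[OF H_pos[OF u]] H_L2[OF v]] by simp
    finally show ?thesis .
  qed
  then show ?thesis unfolding fucik_spectrum_def by auto
qed

lemma ip_parts: "u \<in> H \<Longrightarrow> ip (pos_part u) (neg_part u) = 0"
  by (simp add: ip_def parts_mult)

lemma parts_eta: "(\<lambda>x. pos_part u x - neg_part u x) = u"
  by (simp add: parts_diff)

lemma form_EL_lin_sq:
  assumes "u \<in> H" "v \<in> H"
  shows "form_EL (\<lambda>x. c * u x + d * v x) (\<lambda>x. c * u x + d * v x)
     = c\<^sup>2 * form_EL u u + 2 * c * d * form_EL u v + d\<^sup>2 * form_EL v v"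
  unfolding form_EL_eq Q.lin_sq[OF assms] N.lin_sq[OF assms] by (simp add: algebra_simps)

lemma form_EL_scale_sq: "u \<in> H \<Longrightarrow> form_EL (\<lambda>x. c * u x) (\<lambda>x. c * u x) = c\<^sup>2 * form_EL u u"
  by (simp add: form_EL_eq Q.scale_sq N.scale_sq algebra_simps)

lemma form_EL_sym: "u \<in> H \<Longrightarrow> v \<in> H \<Longrightarrow> form_EL u v = form_EL v u"
  unfolding form_EL_eq by (simp only: Q.sym[of u v] N.sym[of u v])

text \<open>
  Since \<open>u\<^sup>+ u\<^sup>- = 0\<close>, the form at \<open>(u\<^sup>+, u\<^sup>-)\<close> is minus the double integral of
  \<open>(u\<^sup>+(x) u\<^sup>-(y) + u\<^sup>+(y) u\<^sup>-(x)) / 2\<close> against \<open>c_N k\<close>, minus that of \<open>u\<^sup>+(x) u\<^sup>-(y)\<close> against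
  \<open>c_N j\<close>. The sum \<open>k + j\<close> is positive off the diagonal, so the interaction reaches all pairs of
  points: it vanishes only if \<open>u\<^sup>+(x) u\<^sup>-(y) = 0\<close> for almost all \<open>(x, y)\<close>. This nonlocal form of the
  strong maximum principle makes \<open>u\<close> one-signed.
\<close>
lemma form_EL_parts:
  assumes u: "u \<in> H"
  shows "form_EL (pos_part u) (neg_part u) \<le> 0"
    and "form_EL (pos_part u) (neg_part u) = 0 \<Longrightarrow>
      (AE x in lborel. pos_part u x = 0) \<or> (AE x in lborel. neg_part u x = 0)"
proof -
  let ?p = "pos_part u" and ?n = "neg_part u"
  let ?M = "lborel2 :: ('a \<times> 'a) measure"
  let ?c = "c_const DIM('a)"
  note c = c_const_pos[where 'a='a]
  note p = H_pos[OF u] and n = H_neg[OF u]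
  note [measurable] = L2_measurable[OF H_L2[OF p]] L2_measurable[OF H_L2[OF n]]
  let ?g = "\<lambda>z. - (grad_k ?p z * grad_k ?n z)"
  let ?j = "\<lambda>(x, y). ?p x * ?n y * kernel_j (x - y)"
  have g: "?g (x, y) = ?c / 2 * ((?p x * ?n y + ?p y * ?n x) * kernel_k (x - y))" for x y
  proof -
    have "(?p x - ?p y) * (?n x - ?n y) = ?p x * ?n x + ?p y * ?n y - (?p x * ?n y + ?p y * ?n x)"
      by (simp add: algebra_simps)
    then have e: "(?p x - ?p y) * (?n x - ?n y) = - (?p x * ?n y + ?p y * ?n x)"
      by (simp add: parts_mult)
    show ?thesis unfolding grad_k_mult e by (simp add: algebra_simps)
  qed
  have g0: "0 \<le> ?g z" for z
  proof -
    obtain x y where z: "z = (x, y)" by (cases z)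
    show ?thesis unfolding z g using c
      by (intro mult_nonneg_nonneg add_nonneg_nonneg pos_part_nonneg neg_part_nonneg kernel_k_nonneg) auto
  qed
  have j0: "0 \<le> ?j z" for z
    by (auto split: prod.split intro!: mult_nonneg_nonneg pos_part_nonneg neg_part_nonneg kernel_j_nonneg)
  have gi: "integrable ?M ?g" using grad_k_mult_integrable[OF p n] by simp
  have ji: "integrable ?M ?j" by (rule J_int[OF H_L2[OF p] H_L2[OF n]])
  have E: "form_E ?p ?n = - (LINT z|?M. ?g z)" by (simp add: form_E_grad)
  have J: "form_J ?p ?n = (LINT z|?M. ?j z)" by (simp add: form_J_def)
  have E0: "0 \<le> (LINT z|?M. ?g z)" by (rule Bochner_Integration.integral_nonneg) (rule g0)
  have J0: "0 \<le> (LINT z|?M. ?j z)" by (rule Bochner_Integration.integral_nonneg) (rule j0)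
  have L: "form_EL ?p ?n = - (LINT z|?M. ?g z) - ?c * (LINT z|?M. ?j z)"
    unfolding form_EL_eq form_Q_def form_G_def ip_parts[OF u] E J by simp
  have cJ0: "0 \<le> ?c * (LINT z|?M. ?j z)" using J0 c by simp
  show "form_EL ?p ?n \<le> 0" unfolding L using E0 cJ0 by linarith
  assume "form_EL ?p ?n = 0"
  then have "(LINT z|?M. ?g z) = 0" "?c * (LINT z|?M. ?j z) = 0" unfolding L using E0 cJ0 by linarith+
  then have "(LINT z|?M. ?g z) = 0" "(LINT z|?M. ?j z) = 0" using c by auto
  then have "AE z in ?M. ?g z = 0" "AE z in ?M. ?j z = 0"
    using integral_nonneg_eq_0_iff_AE[OF gi] integral_nonneg_eq_0_iff_AE[OF ji] g0 j0 by auto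
  then have ae: "AE z in ?M. ennreal (?p (fst z)) * ennreal (?n (snd z)) = 0"
  proof eventually_elim
    case (elim z)
    obtain x y where z: "z = (x, y)" by (cases z)
    have "(?p x * ?n y + ?p y * ?n x) * kernel_k (x - y) = 0" using elim(1) c unfolding z g by simp
    moreover have "0 \<le> ?p x * ?n y * kernel_k (x - y)" "0 \<le> ?p y * ?n x * kernel_k (x - y)"
      by (intro mult_nonneg_nonneg pos_part_nonneg neg_part_nonneg kernel_k_nonneg)+
    ultimately have "?p x * ?n y * kernel_k (x - y) = 0" by (simp only: distrib_right)
    moreover have "?p x * ?n y * kernel_j (x - y) = 0" using elim(2) z by simp
    ultimately have s: "(?p x * ?n y) * (kernel_k (x - y) + kernel_j (x - y)) = 0" by (simp only: distrib_left)
    have "?p x * ?n y = 0"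
    proof (cases "x = y")
      case True
      then show ?thesis by (simp add: parts_mult)
    next
      case False
      then show ?thesis using s kernel_sum_pos[of "x - y"] by simp
    qed
    then show ?case unfolding z by auto
  qed
  have "(\<integral>\<^sup>+x. ennreal (?p x) \<partial>lborel) * (\<integral>\<^sup>+x. ennreal (?n x) \<partial>lborel)
      = (\<integral>\<^sup>+x. \<integral>\<^sup>+y. (\<lambda>z. ennreal (?p (fst z)) * ennreal (?n (snd z))) (x, y) \<partial>lborel \<partial>lborel)"
    by (simp add: nn_integral_cmult nn_integral_multc)
  also have "\<dots> = (\<integral>\<^sup>+z. ennreal (?p (fst z)) * ennreal (?n (snd z)) \<partial>?M)"
    by (rule lborel.nn_integral_fst) measurable
  also have "\<dots> = (\<integral>\<^sup>+z. 0 \<partial>?M)" by (rule nn_integral_cong_AE[OF ae])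
  finally have "(\<integral>\<^sup>+x. ennreal (?p x) \<partial>lborel) = 0 \<or> (\<integral>\<^sup>+x. ennreal (?n x) \<partial>lborel) = 0" by simp
  then have "(AE x in lborel. ennreal (?p x) = 0) \<or> (AE x in lborel. ennreal (?n x) = 0)"
    by (simp add: nn_integral_0_iff_AE)
  then show "(AE x in lborel. ?p x = 0) \<or> (AE x in lborel. ?n x = 0)"
    using pos_part_nonneg[of u] neg_part_nonneg[of u] by (simp add: ennreal_eq_0_iff antisym_conv)
qed

lemma H_bounded_subseq:
  assumes "\<And>n. u n \<in> H" "\<And>n. form_E (u n) (u n) + ip (u n) (u n) \<le> B"
  obtains r :: "nat \<Rightarrow> nat" and v where "strict_mono r" "v \<in> H"
    "(\<lambda>n. sq_dist ip (u (r n)) v) \<longlonglongrightarrow> 0"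
proof (rule H_compact[OF set_measurable set_finite assms(1)])
  show "ip (u n) (u n) \<le> B" for n using assms(2)[of n] E.nonneg[OF assms(1)[of n]] by linarith
  show "form_E (u n) (u n) \<le> B" for n using assms(2)[of n] N.nonneg[OF assms(1)[of n]] by linarith
qed (rule that)

text \<open>The lower order part is continuous in \<open>L\<^sup>2\<close>, so only the energy is merely semicontinuous.\<close>
lemma form_G_tendsto:
  assumes u: "\<And>n. u n \<in> H" and v: "v \<in> H"
    and lim: "(\<lambda>n. sq_dist ip (u n) v) \<longlonglongrightarrow> 0"
  shows "(\<lambda>n. form_G (u n) (u n)) \<longlonglongrightarrow> form_G v v"
proof (rule G.tendsto_sq[where T = UNIV])
  show "(\<lambda>n. sq_dist form_G (u n) v) \<longlonglongrightarrow> 0"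
  proof (rule tendsto_sandwich[OF _ _ tendsto_const])
    have "(\<lambda>n. 2 * shift * sq_dist ip (u n) v) \<longlonglongrightarrow> 2 * shift * 0"
      by (intro tendsto_intros lim)
    then show "(\<lambda>n. 2 * shift * sq_dist ip (u n) v) \<longlonglongrightarrow> 0" by simp
    have d: "(\<lambda>x. u n x - v x) \<in> L2 \<Omega>" for n by (rule H_L2[OF N.diff_mem[OF u v]])
    show "\<forall>\<^sub>F n in sequentially. 0 \<le> sq_dist form_G (u n) v"
      by (intro always_eventually allI G.nonneg d)
    show "\<forall>\<^sub>F n in sequentially. sq_dist form_G (u n) v \<le> 2 * shift * sq_dist ip (u n) v"
      by (intro always_eventually allI form_G_bounds(2) d)
  qed
qed (use u v H_L2 in auto)

text \<open>
  The solution minimizes \<open>Q(v, v) - 2 \<langle>f, v\<rangle>\<close>; a minimizing sequence is bounded in energy, so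
  compactness and semicontinuity provide the minimizer.
\<close>
lemma resolvent_exists:
  assumes f: "f \<in> H"
  shows "\<exists>v\<in>H. \<forall>w\<in>H. form_Q v w = ip f w"
proof -
  define I where "I v = form_Q v v - 2 * ip f v" for v
  have low: "form_E v v + ip v v / 2 - 2 * ip f f \<le> I v" if v: "v \<in> H" for v
  proof -
    have "0 \<le> ip (\<lambda>x. 2 * f x + (- 1) * v x) (\<lambda>x. 2 * f x + (- 1) * v x)"
      by (rule N.nonneg[OF N.lin_mem[OF f v]])
    then have "0 \<le> 4 * ip f f - 4 * ip f v + ip v v" unfolding N.lin_sq[OF f v] by simp
    then show ?thesis unfolding I_def using form_Q_ge[OF v] by linarith
  qed
  have lb: "- 2 * ip f f \<le> I v" if v: "v \<in> H" for v
    using low[OF v] E.nonneg[OF v] N.nonneg[OF v] by linarith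
  define d where "d = (INF v\<in>H. I v)"
  have bdd: "bdd_below (I ` H)" by (rule bdd_belowI2[OF lb])
  have d: "d \<le> I v" if "v \<in> H" for v unfolding d_def by (rule cINF_lower[OF bdd that])
  define \<epsilon> where "\<epsilon> n = inverse (real (Suc n))" for n
  have \<epsilon>: "0 < \<epsilon> n" "\<epsilon> n \<le> 1" for n by (auto simp: \<epsilon>_def inverse_le_1_iff)
  have "\<exists>v. v \<in> H \<and> I v < d + \<epsilon> n" for n
    using cInf_lessD[of "I ` H" "d + \<epsilon> n"] f \<epsilon>(1)[of n] unfolding d_def by auto
  then obtain v where v: "\<And>n. v n \<in> H" and Iv: "\<And>n. I (v n) < d + \<epsilon> n" by metis
  have bd: "form_E (v n) (v n) + ip (v n) (v n) \<le> 2 * (d + 1 + 2 * ip f f)" for n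
  proof -
    have "form_E (v n) (v n) + ip (v n) (v n) / 2 \<le> d + 1 + 2 * ip f f"
      using low[OF v[of n]] Iv[of n] \<epsilon>(2)[of n] by linarith
    moreover have "e + x \<le> 2 * k" if "e + x / 2 \<le> k" "0 \<le> e" for e x k :: real
      using that by (simp add: field_simps)
    ultimately show ?thesis using E.nonneg[OF v[of n]] by blast
  qed
  obtain r :: "nat \<Rightarrow> nat" and w where r: "strict_mono r" and w: "w \<in> H"
    and lim: "(\<lambda>n. sq_dist ip (v (r n)) w) \<longlonglongrightarrow> 0"
    by (rule H_bounded_subseq[OF v bd])
  have "(\<lambda>n. (d + \<epsilon> (r n)) - form_G (v (r n)) (v (r n)) + 2 * ip (v (r n)) f)
      \<longlonglongrightarrow> (d + 0) - form_G w w + 2 * ip w f"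
  proof (intro tendsto_add tendsto_diff tendsto_mult tendsto_const)
    show "(\<lambda>n. \<epsilon> (r n)) \<longlonglongrightarrow> 0"
      using LIMSEQ_subseq_LIMSEQ[OF LIMSEQ_inverse_real_of_nat r] by (simp add: o_def \<epsilon>_def)
    show "(\<lambda>n. form_G (v (r n)) (v (r n))) \<longlonglongrightarrow> form_G w w" by (rule form_G_tendsto[OF v w lim])
    show "(\<lambda>n. ip (v (r n)) f) \<longlonglongrightarrow> ip w f"
      by (rule N.tendsto_left[where T = UNIV, OF v w f _ lim]) simp
  qed
  moreover have "form_E (v (r n)) (v (r n)) \<le> (d + \<epsilon> (r n)) - form_G (v (r n)) (v (r n)) + 2 * ip (v (r n)) f" for n
    using Iv[of "r n"] N.sym[OF f v[of "r n"]] unfolding I_def form_Q_def by linarith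
  ultimately have "form_E w w \<le> (d + 0) - form_G w w + 2 * ip w f"
    by (intro form_E_lsc(2)[OF v H_L2[OF w] lim])
  then have Iw: "I w \<le> d" unfolding I_def form_Q_def using N.sym[OF f w] by simp
  have "form_Q w z = ip f z" if z: "z \<in> H" for z
  proof -
    have "0 \<le> 2 * t * (form_Q w z - ip f z) + t\<^sup>2 * form_Q z z" for t
    proof -
      have m: "(\<lambda>x. 1 * w x + t * z x) \<in> H" by (rule N.lin_mem[OF w z])
      have "I w \<le> I (\<lambda>x. 1 * w x + t * z x)" using Iw d[OF m] by linarith
      also have "\<dots> = I w + (2 * t * (form_Q w z - ip f z) + t\<^sup>2 * form_Q z z)"
        unfolding I_def Q.lin_sq[OF w z] N.add_right[OF N.scale_mem[OF w] N.scale_mem[OF z] f]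
          N.scale_right[OF w f] N.scale_right[OF z f] by (simp add: algebra_simps)
      finally show ?thesis by simp
    qed
    then have "form_Q w z - ip f z = 0" by (rule linear_term_zero) (rule Q.nonneg[OF z])
    then show ?thesis by simp
  qed
  with w show ?thesis by blast
qed

end

section \<open>The first eigenvalue and paths on the sphere\<close>

lemma AE_lborel_open_ex:
  fixes A :: "'a::euclidean_space set"
  assumes "AE x in lborel. P x" "open A" "A \<noteq> {}"
  shows "\<exists>x\<in>A. P x"
proof (rule ccontr)
  assume n: "\<not> ?thesis"
  obtain N where N: "N \<in> null_sets lborel" "{x. \<not> P x} \<subseteq> N"
    using assms(1) by (auto simp: eventually_ae_filter)
  obtain y e where b: "0 < e" "ball y e \<subseteq> A" using assms(2,3) open_contains_ball by blast
  have "ball y e \<subseteq> N" using b(2) N(2) n by blast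
  then have "emeasure lborel (ball y e) \<le> emeasure lborel N" using N(1) by (intro emeasure_mono) auto
  then have "emeasure lborel (ball y e) = 0" using N(1) by auto
  then have "measure lborel (ball y e) = 0" by (simp add: measure_def)
  then show False using content_ball_pos[OF b(1), of y] by simp
qed

definition L2_normalize :: "('a::euclidean_space \<Rightarrow> real) \<Rightarrow> 'a \<Rightarrow> real" where
  "L2_normalize u = (\<lambda>x. (1 / sqrt (ip u u)) * u x)"

lemma pos_part_scale: "0 \<le> c \<Longrightarrow> pos_part (\<lambda>x. c * u x) = (\<lambda>x. c * pos_part u x)"
  by (auto simp: pos_part_def max_def fun_eq_iff mult_le_0_iff zero_le_mult_iff)

context bounded_open_set
begin

lemma E_r_scale:
  assumes u: "u \<in> H" and c: "0 \<le> c"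
  shows "E_r \<Omega> r (\<lambda>x. c * u x) = c\<^sup>2 * E_r \<Omega> r u"
  unfolding E_r_eq[OF N.scale_mem[OF u]] E_r_eq[OF u] pos_part_scale[OF c] form_EL_scale_sq[OF u]
    N.scale_sq[OF H_pos[OF u]] by (simp add: algebra_simps)

lemma L2_normalize_sphere:
  assumes u: "u \<in> H" and p: "0 < ip u u"
  shows "L2_normalize u \<in> L2_sphere \<Omega>" and "E_r \<Omega> r (L2_normalize u) = E_r \<Omega> r u / ip u u"
proof -
  have s: "(1 / sqrt (ip u u))\<^sup>2 = 1 / ip u u" using p by (simp add: power_divide)
  show "L2_normalize u \<in> L2_sphere \<Omega>"
    unfolding L2_sphere_iff L2_normalize_def N.scale_sq[OF u] s
    using N.scale_mem[OF u, of "1 / sqrt (ip u u)"] p by simp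
  show "E_r \<Omega> r (L2_normalize u) = E_r \<Omega> r u / ip u u"
    unfolding L2_normalize_def using E_r_scale[OF u, of "1 / sqrt (ip u u)" r] p s by simp
qed

lemma bdd_below_form_EL: "bdd_below ((\<lambda>u. form_EL u u) ` L2_sphere \<Omega>)"
proof (rule bdd_belowI2[of _ "- shift"])
  fix u assume "u \<in> L2_sphere \<Omega>"
  then show "- shift \<le> form_EL u u" using Q.nonneg[of u] by (simp add: form_EL_eq L2_sphere_iff)
qed

lemma lambda1_le:
  assumes u: "u \<in> H"
  shows "lambda1 \<Omega> * ip u u \<le> form_EL u u"
proof (cases "ip u u = 0")
  case True
  then show ?thesis using Q.nonneg[OF u] by (simp add: form_EL_eq)
next
  case False
  then have p: "0 < ip u u" using N.nonneg[OF u] by simp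
  have "lambda1 \<Omega> \<le> form_EL (L2_normalize u) (L2_normalize u)"
    unfolding lambda1_def by (rule cINF_lower[OF bdd_below_form_EL L2_normalize_sphere(1)[OF u p]])
  also have "\<dots> = form_EL u u / ip u u"
    unfolding L2_normalize_def form_EL_scale_sq[OF u] using p by (simp add: power_divide)
  finally show ?thesis using p by (simp add: pos_le_divide_eq)
qed

lemma ip_cong: "u \<in> H \<Longrightarrow> u' \<in> H \<Longrightarrow> v \<in> H \<Longrightarrow> AE x in lborel. u x = u' x \<Longrightarrow> ip u v = ip u' v"
  by (rule ip_cong_AE) (auto dest: H_L2 L2_measurable)

lemma ip_cong_sq: "u \<in> H \<Longrightarrow> u' \<in> H \<Longrightarrow> AE x in lborel. u x = u' x \<Longrightarrow> ip u u = ip u' u'"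
  by (rule ip_cong_AE) (auto dest: H_L2 L2_measurable)

lemma ip_zero_iff: "u \<in> H \<Longrightarrow> ip u u = 0 \<longleftrightarrow> (AE x in lborel. u x = 0)"
  by (rule ip_eq_0_iff[OF H_L2])

lemma ip_pos_iff: "u \<in> H \<Longrightarrow> 0 < ip u u \<longleftrightarrow> \<not> (AE x in lborel. u x = 0)"
  using ip_zero_iff N.nonneg by fastforce

lemma ip_nonneg: "(\<And>x. 0 \<le> u x) \<Longrightarrow> (AE x in lborel. 0 \<le> v x) \<Longrightarrow> 0 \<le> ip u v"
  unfolding ip_def by (rule integral_nonneg_AE) auto

lemma form_EL_decomp:
  assumes u: "u \<in> H"
  shows "form_EL u u = form_EL (pos_part u) (pos_part u) - 2 * form_EL (pos_part u) (neg_part u)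
      + form_EL (neg_part u) (neg_part u)"
    and "ip u u = ip (pos_part u) (pos_part u) + ip (neg_part u) (neg_part u)"
    and "ip (pos_part u) u = ip (pos_part u) (pos_part u)"
proof -
  note p = H_pos[OF u] and n = H_neg[OF u]
  have e: "(\<lambda>x. 1 * pos_part u x + (- 1) * neg_part u x) = u" by (simp add: parts_diff)
  show "form_EL u u = form_EL (pos_part u) (pos_part u) - 2 * form_EL (pos_part u) (neg_part u)
      + form_EL (neg_part u) (neg_part u)"
    using form_EL_lin_sq[OF p n, of 1 "-1"] unfolding e by simp
  show "ip u u = ip (pos_part u) (pos_part u) + ip (neg_part u) (neg_part u)"
    using N.lin_sq[OF p n, of 1 "-1"] ip_parts[OF u] unfolding e by simp
  show "ip (pos_part u) u = ip (pos_part u) (pos_part u)"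
    using N.diff_right[OF p n p] ip_parts[OF u] unfolding parts_eta by simp
qed

lemma H_Poincare_tendsto:
  assumes T: "\<And>s. s \<in> T \<Longrightarrow> p s \<in> H" "\<forall>\<^sub>F s in F. s \<in> T"
    and lim: "((\<lambda>s. form_E (p s) (p s)) \<longlongrightarrow> 0) F"
  shows "((\<lambda>s. ip (p s) (p s)) \<longlongrightarrow> 0) F"
proof -
  obtain C where C: "0 < C" "\<And>u. u \<in> H \<Longrightarrow> ip u u \<le> C * form_E u u"
    using H_Poincare[OF bounded_set] by blast
  show ?thesis
  proof (rule tendsto_sandwich[OF _ _ tendsto_const])
    show "((\<lambda>s. C * form_E (p s) (p s)) \<longlongrightarrow> 0) F"
      using tendsto_mult_left[OF lim, of C] by simp
    show "\<forall>\<^sub>F s in F. 0 \<le> ip (p s) (p s)" using T(2) by eventually_elim (rule N.nonneg[OF T(1)])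
    show "\<forall>\<^sub>F s in F. ip (p s) (p s) \<le> C * form_E (p s) (p s)"
      using T(2) by eventually_elim (rule C(2)[OF T(1)])
  qed
qed

end

abbreviation (input) I :: "real set" where "I \<equiv> {-1..1}"

lemma eventually_in_within: "\<forall>\<^sub>F s in at t within I. s \<in> I"
  by (simp add: eventually_at_filter)

locale first_eigenpair = bounded_open_set +
  fixes \<phi> :: "'a \<Rightarrow> real"
  assumes eig: "is_first_eigenfunction \<Omega> \<phi>"
begin

abbreviation "\<mu> \<equiv> lambda1 \<Omega>"

lemma phi_H: "\<phi> \<in> H" and phi_norm: "ip \<phi> \<phi> = 1"
  and phi_pos: "AE x in lborel. x \<in> \<Omega> \<longrightarrow> \<phi> x > 0"
  using eig by (auto simp: is_first_eigenfunction_def L2_sphere_iff)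

lemma phi_eq: "v \<in> H \<Longrightarrow> form_EL \<phi> v = \<mu> * ip \<phi> v"
proof -
  assume v: "v \<in> H"
  have "(LINT x:\<Omega>|lborel. \<phi> x * v x) = ip \<phi> v"
    unfolding ip_def by (rule set_integral_vanishing) (simp add: L2_zero[OF H_L2[OF v]])
  then show ?thesis using eig v by (simp add: is_first_eigenfunction_def)
qed

lemma phi_nonneg: "AE x in lborel. 0 \<le> \<phi> x"
  using phi_pos by eventually_elim (use L2_zero[OF H_L2[OF phi_H]] in force)

lemma orthogonal_phi_zero:
  assumes u: "u \<in> H" and n: "AE x in lborel. 0 \<le> u x" and z: "ip u \<phi> = 0"
  shows "AE x in lborel. u x = 0"
proof -
  have "AE x in lborel. 0 \<le> u x * \<phi> x" using n phi_nonneg by eventually_elim simp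
  then have "AE x in lborel. u x * \<phi> x = 0"
    using z integral_nonneg_eq_0_iff_AE[OF L2_mult_integrable[OF H_L2[OF u] H_L2[OF phi_H]]]
    by (simp add: ip_def)
  then show ?thesis using phi_pos
  proof eventually_elim
    case (elim x)
    then show ?case using L2_zero[OF H_L2[OF u], of x] by (cases "x \<in> \<Omega>") auto
  qed
qed

lemma psd_form_gap: "psd_form H (\<lambda>u v. form_Q u v + (- (shift + \<mu>)) * ip u v)"
proof (rule psd_form_comb[OF psd_form_Q N.psd_form_axioms])
  fix u assume u: "u \<in> H"
  show "0 \<le> form_Q u u + (- (shift + \<mu>)) * ip u u"
    using lambda1_le[OF u] by (simp add: form_EL_eq algebra_simps)
qed

text \<open>
  Let \<open>w\<close> be \<open>u\<close> minus its projection to \<open>\<phi>\<close>. Both \<open>u\<close> and \<open>\<phi>\<close> lie in the kernel of the semidefinite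
  form \<open>E_L - \<mu> \<langle>\<sqdot>, \<sqdot>\<rangle>\<close>, hence so does \<open>w\<close>. Decomposing \<open>w\<close> into its parts, no term of the sum can be
  negative, so the interaction of the parts vanishes and \<open>w\<close> has one sign; being orthogonal to
  \<open>\<phi> > 0\<close> it is zero.
\<close>
lemma first_eigenvalue_simple:
  assumes u: "u \<in> H" and eq: "form_EL u u = \<mu> * ip u u"
  shows "AE x in lborel. u x = ip u \<phi> * \<phi> x"
proof -
  define D where "D u v = form_Q u v + (- (shift + \<mu>)) * ip u v" for u v :: "'a \<Rightarrow> real"
  interpret D: psd_form H D unfolding D_def[abs_def] by (rule psd_form_gap)
  have D_eq: "D u v = form_EL u v - \<mu> * ip u v" for u v
    unfolding D_def form_EL_eq by (simp add: algebra_simps)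
  define t where "t = ip u \<phi>"
  define w where "w x = u x - t * \<phi> x" for x
  have tphi: "(\<lambda>x. t * \<phi> x) \<in> H" by (rule N.scale_mem[OF phi_H])
  have w: "w \<in> H" unfolding w_def[abs_def] by (rule N.diff_mem[OF u tphi])
  have Du: "D u v = 0" if "v \<in> H" for v by (rule D.null_right[OF u that]) (simp add: D_eq eq)
  have Dp: "D \<phi> v = 0" if "v \<in> H" for v by (simp add: D_eq phi_eq[OF that])
  have Dw: "D w w = 0" unfolding w_def[abs_def]
    using D.diff_left[OF u tphi w] D.scale_left[OF phi_H w] Du[OF w] Dp[OF w]
    unfolding w_def[abs_def] by simp
  note p = H_pos[OF w] and n = H_neg[OF w]
  have "D w w = D (pos_part w) (pos_part w) - 2 * form_EL (pos_part w) (neg_part w) + D (neg_part w) (neg_part w)"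
    unfolding D_eq form_EL_decomp(1)[OF w] form_EL_decomp(2)[OF w] by (simp add: algebra_simps)
  then have "form_EL (pos_part w) (neg_part w) = 0"
    using Dw D.nonneg[OF p] D.nonneg[OF n] form_EL_parts(1)[OF w] by linarith
  from form_EL_parts(2)[OF w this]
  have s: "(AE x in lborel. pos_part w x = 0) \<or> (AE x in lborel. neg_part w x = 0)" .
  have wz: "ip w \<phi> = 0"
    using N.diff_left[OF u tphi phi_H] N.scale_left[OF phi_H phi_H, of t] phi_norm
    unfolding w_def[abs_def] t_def by simp
  have "AE x in lborel. w x = 0"
    using s
  proof
    assume "AE x in lborel. pos_part w x = 0"
    then have a: "AE x in lborel. 0 \<le> - w x" by eventually_elim (auto simp: pos_part_def max_def split: if_splits)
    have "ip (\<lambda>x. - w x) \<phi> = 0" using N.minus_left[OF w phi_H] wz by simp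
    from orthogonal_phi_zero[OF N.minus_mem[OF w] a this] show ?thesis by simp
  next
    assume "AE x in lborel. neg_part w x = 0"
    then have a: "AE x in lborel. 0 \<le> w x" by eventually_elim (auto simp: neg_part_def max_def split: if_splits)
    from orthogonal_phi_zero[OF w a wz] show ?thesis .
  qed
  then show ?thesis by eventually_elim (simp add: w_def t_def)
qed

lemma pathD:
  assumes "\<gamma> \<in> paths \<Omega> \<phi>"
  shows "t \<in> I \<Longrightarrow> \<gamma> t \<in> H" "t \<in> I \<Longrightarrow> ip (\<gamma> t) (\<gamma> t) = 1" "t \<in> I \<Longrightarrow> \<gamma> t \<in> L2_sphere \<Omega>"
    and "t \<in> I \<Longrightarrow> ((\<lambda>s. sq_dist form_E (\<gamma> s) (\<gamma> t)) \<longlongrightarrow> 0) (at t within I)"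
    and "t \<in> I \<Longrightarrow> ((\<lambda>s. sq_dist ip (\<gamma> s) (\<gamma> t)) \<longlongrightarrow> 0) (at t within I)"
    and "AE x in lborel. \<gamma> (-1) x = - \<phi> x" "AE x in lborel. \<gamma> 1 x = \<phi> x"
proof -
  have S: "\<gamma> t \<in> L2_sphere \<Omega>" if "t \<in> I" for t using assms that unfolding paths_def by blast
  then show "t \<in> I \<Longrightarrow> \<gamma> t \<in> L2_sphere \<Omega>" .
  have h: "\<gamma> t \<in> H" if "t \<in> I" for t using S[OF that] by (simp add: L2_sphere_iff)
  then show "t \<in> I \<Longrightarrow> \<gamma> t \<in> H" .
  show "t \<in> I \<Longrightarrow> ip (\<gamma> t) (\<gamma> t) = 1" using S[of t] by (simp add: L2_sphere_iff)
  show "AE x in lborel. \<gamma> (-1) x = - \<phi> x" "AE x in lborel. \<gamma> 1 x = \<phi> x"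
    using assms unfolding paths_def by blast+
  assume t: "t \<in> I"
  have d: "(\<lambda>x. \<gamma> s x - \<gamma> t x) \<in> H" if "s \<in> I" for s by (rule N.diff_mem[OF h[OF that] h[OF t]])
  have "((\<lambda>s. H_norm (\<lambda>x. \<gamma> s x - \<gamma> t x)) \<longlongrightarrow> 0) (at t within I)"
    using assms t unfolding paths_def by blast
  then have "((\<lambda>s. (H_norm (\<lambda>x. \<gamma> s x - \<gamma> t x))\<^sup>2) \<longlongrightarrow> 0\<^sup>2) (at t within I)"
    by (intro tendsto_power)
  moreover have "\<forall>\<^sub>F s in at t within I. (H_norm (\<lambda>x. \<gamma> s x - \<gamma> t x))\<^sup>2 = sq_dist form_E (\<gamma> s) (\<gamma> t)"
    using eventually_in_within by eventually_elim (simp add: H_norm_def E.nonneg[OF d])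
  ultimately have "((\<lambda>s. sq_dist form_E (\<gamma> s) (\<gamma> t)) \<longlongrightarrow> 0\<^sup>2) (at t within I)"
    by (simp cong: tendsto_cong)
  then show l: "((\<lambda>s. sq_dist form_E (\<gamma> s) (\<gamma> t)) \<longlongrightarrow> 0) (at t within I)"
    by simp
  show "((\<lambda>s. sq_dist ip (\<gamma> s) (\<gamma> t)) \<longlongrightarrow> 0) (at t within I)"
    by (rule H_Poincare_tendsto[where T = I, OF d eventually_in_within l])
qed

text \<open>
  Paths are constructed without regard to the norm constraint; it suffices that they avoid zero and
  end at a negative and at a positive multiple of \<open>\<phi>\<close>.
\<close>
lemma L2_normalize_path:
  assumes p: "\<And>t. t \<in> I \<Longrightarrow> p t \<in> H" "\<And>t. t \<in> I \<Longrightarrow> 0 < ip (p t) (p t)"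
    and c: "\<And>t. t \<in> I \<Longrightarrow> ((\<lambda>s. sq_dist form_E (p s) (p t)) \<longlongrightarrow> 0) (at t within I)"
    and e: "AE x in lborel. p (-1) x = - a * \<phi> x" "0 < a" "AE x in lborel. p 1 x = b * \<phi> x" "0 < b"
  shows "(\<lambda>t. L2_normalize (p t)) \<in> paths \<Omega> \<phi>"
proof -
  have "((\<lambda>s. H_norm (\<lambda>x. L2_normalize (p s) x - L2_normalize (p t) x)) \<longlongrightarrow> 0) (at t within I)" if t: "t \<in> I" for t
  proof -
    define n where "n s = 1 / sqrt (ip (p s) (p s))" for s
    have d: "(\<lambda>x. p s x - p t x) \<in> H" if "s \<in> I" for s by (rule N.diff_mem[OF p(1)[OF that] p(1)[OF t]])
    have "((\<lambda>s. sq_dist ip (p s) (p t)) \<longlongrightarrow> 0) (at t within I)"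
      by (rule H_Poincare_tendsto[where T = I, OF d eventually_in_within c[OF t]])
    from N.tendsto_sq[where T = I, OF p(1) p(1)[OF t] eventually_in_within this]
    have "((\<lambda>s. ip (p s) (p s)) \<longlongrightarrow> ip (p t) (p t)) (at t within I)" .
    then have nl: "(n \<longlongrightarrow> n t) (at t within I)"
      unfolding n_def[abs_def] using p(2)[OF t] by (intro tendsto_intros) auto
    let ?B = "\<lambda>s. 2 * (n s)\<^sup>2 * sq_dist form_E (p s) (p t) + 2 * (n s - n t)\<^sup>2 * form_E (p t) (p t)"
    have "(?B \<longlongrightarrow> 2 * (n t)\<^sup>2 * 0 + 2 * (n t - n t)\<^sup>2 * form_E (p t) (p t)) (at t within I)"
      by (intro tendsto_intros nl c[OF t])
    then have "((\<lambda>s. sqrt (?B s)) \<longlongrightarrow> sqrt 0) (at t within I)" by (intro tendsto_real_sqrt) simp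
    then have bl: "((\<lambda>s. sqrt (?B s)) \<longlongrightarrow> 0) (at t within I)" by simp
    have m: "(\<lambda>x. L2_normalize (p s) x - L2_normalize (p t) x) \<in> H" if "s \<in> I" for s
      unfolding L2_normalize_def by (intro N.diff_mem N.scale_mem p that t)
    have le: "sq_dist form_E (L2_normalize (p s)) (L2_normalize (p t)) \<le> ?B s"
      if "s \<in> I" for s
    proof -
      have "(\<lambda>x. L2_normalize (p s) x - L2_normalize (p t) x) = (\<lambda>x. n s * (p s x - p t x) + (n s - n t) * p t x)"
        unfolding L2_normalize_def n_def[symmetric] by (simp add: fun_eq_iff algebra_simps)
      then show ?thesis using E.lin_sq_le[OF d[OF that] p(1)[OF t], of "n s" "n s - n t"] by (simp only:)
    qed
    show ?thesis
    proof (rule tendsto_sandwich[OF _ _ tendsto_const bl])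
      show "\<forall>\<^sub>F s in at t within I. 0 \<le> H_norm (\<lambda>x. L2_normalize (p s) x - L2_normalize (p t) x)"
        using eventually_in_within by eventually_elim (simp add: H_norm_def E.nonneg[OF m])
      show "\<forall>\<^sub>F s in at t within I. H_norm (\<lambda>x. L2_normalize (p s) x - L2_normalize (p t) x) \<le> sqrt (?B s)"
        using eventually_in_within by eventually_elim (simp only: H_norm_def real_sqrt_le_iff le)
    qed
  qed
  moreover have "L2_normalize (p t) \<in> L2_sphere \<Omega>" if "t \<in> I" for t
    by (rule L2_normalize_sphere(1)[OF p(1)[OF that] p(2)[OF that]])
  moreover have "AE x in lborel. L2_normalize (p t) x = sgn k * \<phi> x"
    if t: "t \<in> I" and k: "AE x in lborel. p t x = k * \<phi> x" for t k
  proof -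
    have "ip (p t) (p t) = k\<^sup>2"
      using ip_cong_sq[OF p(1)[OF t] N.scale_mem[OF phi_H] k] by (simp add: N.scale_sq[OF phi_H] phi_norm)
    then have q: "L2_normalize (p t) x = p t x / \<bar>k\<bar>" for x unfolding L2_normalize_def by simp
    show ?thesis using k by eventually_elim (simp add: q real_sgn_eq)
  qed
  from this[of "-1" "-a"] this[of 1 b]
  have "AE x in lborel. L2_normalize (p (-1)) x = - \<phi> x" "AE x in lborel. L2_normalize (p 1) x = \<phi> x"
    using e by simp_all
  ultimately show ?thesis unfolding paths_def by blast
qed

lemma combination_path_continuous:
  assumes f: "f \<in> H" "g \<in> H" "h \<in> H"
    and c: "(a \<longlongrightarrow> a t) F" "(b \<longlongrightarrow> b t) F" "(d \<longlongrightarrow> d t) F"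
  defines "p \<equiv> \<lambda>s x. a s * f x + b s * g x + d s * h x"
  shows "((\<lambda>s. sq_dist form_E (p s) (p t)) \<longlongrightarrow> 0) F"
proof -
  let ?B = "\<lambda>s. 4 * (a s - a t)\<^sup>2 * form_E f f + 4 * (b s - b t)\<^sup>2 * form_E g g + 2 * (d s - d t)\<^sup>2 * form_E h h"
  have "(?B \<longlongrightarrow> 4 * (a t - a t)\<^sup>2 * form_E f f + 4 * (b t - b t)\<^sup>2 * form_E g g + 2 * (d t - d t)\<^sup>2 * form_E h h) F"
    by (intro tendsto_intros c)
  then have bl: "(?B \<longlongrightarrow> 0) F" by simp
  have ph: "p s \<in> H" for s unfolding p_def by (intro N.add_mem N.scale_mem f)
  have le: "sq_dist form_E (p s) (p t) \<le> ?B s" for s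
  proof -
    let ?q = "\<lambda>x. (a s - a t) * f x + (b s - b t) * g x"
    have q: "?q \<in> H" by (rule N.lin_mem[OF f(1,2)])
    have e: "(\<lambda>x. p s x - p t x) = (\<lambda>x. 1 * ?q x + (d s - d t) * h x)" unfolding p_def by (auto simp: algebra_simps)
    show ?thesis unfolding e
      using E.lin_sq_le[OF q f(3), of 1 "d s - d t"] E.lin_sq_le[OF f(1,2), of "a s - a t" "b s - b t"] by simp
  qed
  have "\<forall>\<^sub>F s in F. 0 \<le> sq_dist form_E (p s) (p t)"
    by (intro always_eventually allI E.nonneg[OF N.diff_mem[OF ph ph]])
  moreover have "\<forall>\<^sub>F s in F. sq_dist form_E (p s) (p t) \<le> ?B s"
    by (intro always_eventually allI le)
  ultimately show ?thesis by (rule tendsto_sandwich[OF _ _ tendsto_const bl])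
qed

lemma E_r_ge_form_EL:
  assumes u: "u \<in> H" "ip u u = 1" and r: "0 \<le> r"
  shows "form_EL u u - r \<le> E_r \<Omega> r u"
proof -
  have "ip (pos_part u) (pos_part u) \<le> 1"
    using form_EL_decomp(2)[OF u(1)] N.nonneg[OF H_neg[OF u(1)]] u(2) by linarith
  then have "r * ip (pos_part u) (pos_part u) \<le> r" using r by (simp add: mult_left_le)
  then show ?thesis unfolding E_r_eq[OF u(1)] by simp
qed

lemma
  assumes "u \<in> L2_sphere \<Omega>" "0 \<le> r"
  shows E_r_ge: "\<mu> - r \<le> E_r \<Omega> r u" and form_Q_le: "form_Q u u \<le> E_r \<Omega> r u + r + shift"
  using E_r_ge_form_EL[of u r] lambda1_le[of u] assms by (auto simp: L2_sphere_iff form_EL_eq)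

text \<open>Without this bound the supremum in the definition of the minimax value would be meaningless.\<close>
lemma E_r_bdd_above:
  assumes g: "\<gamma> \<in> paths \<Omega> \<phi>" and r: "0 \<le> r"
  shows "bdd_above ((\<lambda>t. E_r \<Omega> r (\<gamma> t)) ` I)"
proof -
  have "continuous_on I (\<lambda>t. form_E (\<gamma> t) (\<gamma> t))"
    unfolding continuous_on_def
  proof
    fix t assume t: "t \<in> I"
    show "((\<lambda>t. form_E (\<gamma> t) (\<gamma> t)) \<longlongrightarrow> form_E (\<gamma> t) (\<gamma> t)) (at t within I)"
      by (rule E.tendsto_sq[where T = I and \<Omega> = \<Omega>, OF pathD(1)[OF g] pathD(1)[OF g t] eventually_in_within pathD(4)[OF g t]])
  qed
  then have "compact ((\<lambda>t. form_E (\<gamma> t) (\<gamma> t)) ` I)" by (intro compact_continuous_image) auto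
  then have "bdd_above ((\<lambda>t. form_E (\<gamma> t) (\<gamma> t)) ` I)"
    by (rule bounded_imp_bdd_above[OF compact_imp_bounded])
  then obtain B where "\<forall>t\<in>I. form_E (\<gamma> t) (\<gamma> t) \<le> B" unfolding bdd_above_def by auto
  then have B: "form_E (\<gamma> t) (\<gamma> t) \<le> B" if "t \<in> I" for t using that by blast
  show ?thesis
  proof (rule bdd_aboveI2[of _ _ "B + 2 * shift"])
    fix t assume t: "t \<in> I"
    note u = pathD(1)[OF g t]
    have "0 \<le> r * ip (pos_part (\<gamma> t)) (pos_part (\<gamma> t))" using r N.nonneg[OF H_pos[OF u]] by simp
    then show "E_r \<Omega> r (\<gamma> t) \<le> B + 2 * shift"
      using B[OF t] form_G_bounds(2)[OF H_L2[OF u]] pathD(2)[OF g t] shift_ge_1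
      unfolding E_r_eq[OF u] form_EL_eq form_Q_def by simp
  qed
qed

lemma minimax_le:
  assumes g: "\<gamma> \<in> paths \<Omega> \<phi>" and r: "0 \<le> r" and le: "\<And>t. t \<in> I \<Longrightarrow> E_r \<Omega> r (\<gamma> t) \<le> B"
  shows "minimax_c \<Omega> \<phi> r \<le> B"
proof -
  have "\<mu> - r \<le> (SUP t\<in>I. E_r \<Omega> r (\<gamma> t))" if g: "\<gamma> \<in> paths \<Omega> \<phi>" for \<gamma>
    using E_r_ge[OF pathD(3)[OF g] r, of 1] cSUP_upper[OF _ E_r_bdd_above[OF g r], of 1] by simp
  then have "bdd_below ((\<lambda>\<gamma>. SUP t\<in>I. E_r \<Omega> r (\<gamma> t)) ` paths \<Omega> \<phi>)" by (rule bdd_belowI2)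
  from cINF_lower[OF this g] have "minimax_c \<Omega> \<phi> r \<le> (SUP t\<in>I. E_r \<Omega> r (\<gamma> t))" unfolding minimax_c_def .
  also have "\<dots> \<le> B" by (rule cSUP_least) (use le in auto)
  finally show ?thesis .
qed

text \<open>
  The minimum of \<open>|\<phi>|\<close> and a translate of it vanishes on the part of the set that the translation
  moves off the set (a cap in the direction of the translation), while \<open>\<phi>\<close> does not.
\<close>
lemma noncollinear_exists:
  "\<exists>w\<in>H. \<forall>a b. (AE x in lborel. a * \<phi> x + b * w x = 0) \<longrightarrow> a = 0 \<and> b = 0"
proof -
  have "\<Omega> \<noteq> {}"
    using phi_norm L2_zero[OF H_L2[OF phi_H]] by (auto simp: ip_def)
  then obtain x0 \<epsilon> where x0: "0 < \<epsilon>" "ball x0 \<epsilon> \<subseteq> \<Omega>" using open_set open_contains_ball by blast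
  obtain e :: 'a where e: "e \<in> Basis" using nonempty_Basis by blast
  define h where "h = (\<epsilon> / 2) *\<^sub>R e"
  define w where "w x = min \<bar>\<phi> x\<bar> \<bar>\<phi> (h + x)\<bar>" for x
  have wH: "w \<in> H" unfolding w_def[abs_def] by (rule H_min_translate[OF phi_H])
  have "AE x in distr lborel borel ((+) h). x \<in> \<Omega> \<longrightarrow> 0 < \<phi> x" unfolding lborel_distr_plus by (rule phi_pos)
  then have pos_h: "AE x in lborel. h + x \<in> \<Omega> \<longrightarrow> 0 < \<phi> (h + x)" by (rule AE_distrD[rotated]) simp
  have "a = 0 \<and> b = 0" if z: "AE x in lborel. a * \<phi> x + b * w x = 0" for a b
  proof -
    have z': "AE x in lborel. a * \<phi> x + b * w x = 0 \<and> (x \<in> \<Omega> \<longrightarrow> 0 < \<phi> x) \<and> (h + x \<in> \<Omega> \<longrightarrow> 0 < \<phi> (h + x))"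
      using z phi_pos pos_h by eventually_elim simp
    define S where "S = (SUP x\<in>\<Omega>. x \<bullet> e)"
    have "bdd_above ((\<lambda>x. x \<bullet> e) ` \<Omega>)"
      using bounded_set by (intro bounded_imp_bdd_above bounded_linear_image[OF _ bounded_linear_inner_left])
    then have S: "x \<bullet> e \<le> S" if "x \<in> \<Omega>" for x unfolding S_def using that by (intro cSUP_upper)
    let ?A = "\<Omega> \<inter> {x. S - \<epsilon> / 2 < x \<bullet> e}"
    have "open ?A" by (intro open_Int open_set open_Collect_less continuous_intros)
    moreover have "?A \<noteq> {}"
      using less_cSupD[of "(\<lambda>x. x \<bullet> e) ` \<Omega>" "S - \<epsilon> / 2"] \<open>\<Omega> \<noteq> {}\<close> x0(1) unfolding S_def by auto
    ultimately obtain x where x: "x \<in> \<Omega>" "S - \<epsilon> / 2 < x \<bullet> e" "a * \<phi> x + b * w x = 0" "0 < \<phi> x"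
      using AE_lborel_open_ex[OF z', of ?A] by blast
    have "h + x \<notin> \<Omega>" using S[of "h + x"] x(2) e by (auto simp: h_def inner_add_left)
    then have "w x = 0" using L2_zero[OF H_L2[OF phi_H]] by (simp add: w_def)
    then have a: "a = 0" using x(3,4) by simp
    obtain y where y: "y \<in> ball x0 (\<epsilon> / 2)" "a * \<phi> y + b * w y = 0"
      "y \<in> \<Omega> \<longrightarrow> 0 < \<phi> y" "h + y \<in> \<Omega> \<longrightarrow> 0 < \<phi> (h + y)"
      using AE_lborel_open_ex[OF z', of "ball x0 (\<epsilon> / 2)"] x0(1) by auto
    have "y \<in> \<Omega>" using y(1) x0 by (auto simp: subset_iff)
    moreover have "h + y \<in> \<Omega>"
    proof -
      have "norm h = \<epsilon> / 2" using e x0(1) by (simp add: h_def)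
      then have "dist x0 (h + y) < \<epsilon>" using norm_triangle_ineq4[of "x0 - y" h] y(1) by (simp add: dist_norm algebra_simps)
      then show ?thesis using x0(2) by auto
    qed
    ultimately have "0 < w y" using y(3,4) by (simp add: w_def)
    then show ?thesis using y(2) a by simp
  qed
  then show ?thesis using wH by blast
qed

lemma paths_nonempty: "paths \<Omega> \<phi> \<noteq> {}"
proof -
  obtain w where w: "w \<in> H" "\<And>a b. (AE x in lborel. a * \<phi> x + b * w x = 0) \<Longrightarrow> a = 0 \<and> b = 0"
    using noncollinear_exists by blast
  define p where "p t x = t * \<phi> x + (1 - \<bar>t\<bar>) * w x + 0 * w x" for t x
  have "(\<lambda>t. L2_normalize (p t)) \<in> paths \<Omega> \<phi>"
  proof (rule L2_normalize_path)
    show pH: "p t \<in> H" for t unfolding p_def[abs_def] by (intro N.add_mem N.scale_mem phi_H w)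
    show "0 < ip (p t) (p t)" for t
    proof (subst ip_pos_iff[OF pH], rule notI)
      assume "AE x in lborel. p t x = 0"
      then have "AE x in lborel. t * \<phi> x + (1 - \<bar>t\<bar>) * w x = 0" by (simp add: p_def)
      from w(2)[OF this] show False by auto
    qed
    show "((\<lambda>s. sq_dist form_E (p s) (p t)) \<longlongrightarrow> 0) (at t within I)" for t
      unfolding p_def by (rule combination_path_continuous[OF phi_H w(1) w(1)]) (intro tendsto_intros)+
    show "AE x in lborel. p (-1) x = - 1 * \<phi> x" "AE x in lborel. p 1 x = 1 * \<phi> x"
      by (auto simp: p_def)
  qed auto
  then show ?thesis by blast
qed

end

section \<open>The minimax value\<close>

text \<open>The tangent inequality of the convex function \<open>t \<mapsto> (t\<^sup>+)\<^sup>2\<close>.\<close>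
lemma pos_part_square_convex:
  "(pos_part v x)\<^sup>2 \<ge> (pos_part u x)\<^sup>2 + 2 * pos_part u x * (v x - u x)"
proof -
  have "pos_part u x * u x = (pos_part u x)\<^sup>2"
    by (auto simp: pos_part_def power2_eq_square max_def)
  moreover have "pos_part u x * v x \<le> pos_part u x * pos_part v x"
    by (intro mult_left_mono) (auto simp: pos_part_def)
  moreover have "0 \<le> (pos_part v x - pos_part u x)\<^sup>2" by simp
  moreover have "(pos_part v x - pos_part u x)\<^sup>2 = (pos_part v x)\<^sup>2 - 2 * (pos_part u x * pos_part v x) + (pos_part u x)\<^sup>2"
    by (simp add: power2_diff)
  moreover have "2 * pos_part u x * (v x - u x) = 2 * (pos_part u x * v x) - 2 * (pos_part u x * u x)"
    by (simp add: algebra_simps)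
  ultimately show ?thesis by linarith
qed

context bounded_open_set
begin

lemma ip_pos_part_convex:
  assumes u: "u \<in> H" and v: "v \<in> H"
  shows "ip (pos_part u) (pos_part u) + 2 * ip (pos_part u) (\<lambda>x. v x - u x) \<le> ip (pos_part v) (pos_part v)"
proof -
  note p = H_pos[OF u] and q = H_pos[OF v] and d = N.diff_mem[OF v u]
  note i = L2_mult_integrable[OF H_L2 H_L2]
  have "ip (pos_part u) (pos_part u) + 2 * ip (pos_part u) (\<lambda>x. v x - u x)
      = (LINT x|lborel. pos_part u x * pos_part u x + 2 * (pos_part u x * (v x - u x)))"
    unfolding ip_def using i[OF p p] i[OF p d] by simp
  also have "\<dots> \<le> (LINT x|lborel. pos_part v x * pos_part v x)"
  proof (rule integral_mono)
    show "integrable lborel (\<lambda>x. pos_part u x * pos_part u x + 2 * (pos_part u x * (v x - u x)))"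
      using i[OF p p] i[OF p d] by simp
    show "pos_part u x * pos_part u x + 2 * (pos_part u x * (v x - u x)) \<le> pos_part v x * pos_part v x" for x
      using pos_part_square_convex[of u x v] by (simp add: power2_eq_square mult.assoc)
  qed (rule i[OF q q])
  finally show ?thesis by (simp add: ip_def)
qed

lemma ip_pos_part_diff:
  assumes u: "u \<in> H" and v: "v \<in> H"
  shows "sq_dist ip (pos_part u) (pos_part v) \<le> sq_dist ip u v"
proof (rule ip_mono)
  show "(\<lambda>x. pos_part u x - pos_part v x) \<in> L2 \<Omega>" by (rule H_L2[OF N.diff_mem[OF H_pos[OF u] H_pos[OF v]]])
  show "(\<lambda>x. u x - v x) \<in> L2 \<Omega>" by (rule H_L2[OF N.diff_mem[OF u v]])
  show "\<bar>pos_part u x - pos_part v x\<bar> \<le> \<bar>u x - v x\<bar>" for x by (auto simp: pos_part_def)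
qed

end

context first_eigenpair
begin

text \<open>
  Suppose that for \<open>\<eta>_n \<rightarrow> 0\<close> there are \<open>u_n\<close> on the sphere with \<open>\<langle>u_n\<^sup>+, u_n\<^sup>+\<rangle> = \<eta>_n\<close> and
  \<open>E_r(u_n) < \<mu> + \<eta>_n\<close>. Since the negative part costs at least \<open>\<mu> (1 - \<eta>_n)\<close> and the interaction is
  favourable, the positive part has energy of order \<open>\<eta>_n\<close>, so \<open>v_n = u_n\<^sup>+ / \<surd>\<eta>_n\<close> is bounded. Limits \<open>u'\<close>
  of \<open>u_n\<close> and \<open>v'\<close> of \<open>v_n\<close> satisfy: \<open>u'\<close> minimizes \<open>E_L\<close> on the sphere, hence is a multiple of \<open>\<phi>\<close>;
  \<open>v' \<ge> 0\<close> has norm one; and \<open>\<langle>v_n, u_n\<rangle> = \<surd>\<eta>_n\<close> tends to zero, so \<open>v'\<close> is orthogonal to \<open>\<phi>\<close>.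
\<close>
lemma E_r_gap:
  assumes r: "0 \<le> r"
  shows "\<exists>\<eta> \<delta>. 0 < \<eta> \<and> \<eta> < 1 \<and> 0 < \<delta> \<and>
    (\<forall>u\<in>L2_sphere \<Omega>. ip (pos_part u) (pos_part u) = \<eta> \<longrightarrow> \<mu> + \<delta> \<le> E_r \<Omega> r u)"
proof (rule ccontr)
  assume neg: "\<not> ?thesis"
  define \<eta> where "\<eta> n = inverse (real (Suc (Suc n)))" for n
  have \<eta>: "0 < \<eta> n" "\<eta> n < 1" for n by (auto simp: \<eta>_def inverse_less_1_iff)
  have \<eta>0: "\<eta> \<longlonglongrightarrow> 0" unfolding \<eta>_def by (rule LIMSEQ_Suc[OF LIMSEQ_inverse_real_of_nat])
  have "\<exists>u. u \<in> L2_sphere \<Omega> \<and> ip (pos_part u) (pos_part u) = \<eta> n \<and> E_r \<Omega> r u < \<mu> + \<eta> n" for n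
    using neg \<eta>[of n] by (meson not_le)
  then obtain u where us: "\<And>n. u n \<in> L2_sphere \<Omega>" and up: "\<And>n. ip (pos_part (u n)) (pos_part (u n)) = \<eta> n"
    and uE: "\<And>n. E_r \<Omega> r (u n) < \<mu> + \<eta> n" by metis
  have u: "u n \<in> H" and u1: "ip (u n) (u n) = 1" for n using us[of n] by (auto simp: L2_sphere_iff)
  define v where "v n = (\<lambda>x. (1 / sqrt (\<eta> n)) * pos_part (u n) x)" for n
  have s2: "(1 / sqrt (\<eta> n))\<^sup>2 = 1 / \<eta> n" for n using \<eta>(1)[of n] by (simp add: power_divide)
  have v: "v n \<in> H" for n unfolding v_def by (rule N.scale_mem[OF H_pos[OF u]])
  have v1: "ip (v n) (v n) = 1" for n
    unfolding v_def N.scale_sq[OF H_pos[OF u]] s2 up using \<eta>(1)[of n] by simp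
  have vE: "form_EL (v n) (v n) \<le> 1 + r + \<mu>" for n
  proof -
    note p = H_pos[OF u[of n]] and q = H_neg[OF u[of n]]
    have "ip (neg_part (u n)) (neg_part (u n)) = 1 - \<eta> n"
      using form_EL_decomp(2)[OF u[of n]] up[of n] u1[of n] by simp
    then have "\<mu> * (1 - \<eta> n) \<le> form_EL (neg_part (u n)) (neg_part (u n))"
      using lambda1_le[OF q] by simp
    moreover have "form_EL (u n) (u n) - r * \<eta> n < \<mu> + \<eta> n"
      using uE[of n] up[of n] unfolding E_r_eq[OF u] by simp
    ultimately have "form_EL (pos_part (u n)) (pos_part (u n)) \<le> \<eta> n * (1 + r + \<mu>)"
      using form_EL_decomp(1)[OF u[of n]] form_EL_parts(1)[OF u[of n]] by (simp add: algebra_simps)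
    then have "(1 / \<eta> n) * form_EL (pos_part (u n)) (pos_part (u n)) \<le> (1 / \<eta> n) * (\<eta> n * (1 + r + \<mu>))"
      using \<eta>(1)[of n] by (intro mult_left_mono) auto
    then show ?thesis unfolding v_def form_EL_scale_sq[OF p] s2 using \<eta>(1)[of n] by simp
  qed
  have bu: "form_E (u n) (u n) + ip (u n) (u n) \<le> \<mu> + 1 + r + shift" for n
    using form_Q_le[OF us r, of n] form_Q_ge[OF u[of n]] uE[of n] \<eta>(2)[of n] by linarith
  obtain r1 :: "nat \<Rightarrow> nat" and u' where r1: "strict_mono r1" and u': "u' \<in> H"
    and ulim: "(\<lambda>n. sq_dist ip (u (r1 n)) u') \<longlonglongrightarrow> 0"
    by (rule H_bounded_subseq[OF u bu])
  have bv: "form_E (v (r1 n)) (v (r1 n)) + ip (v (r1 n)) (v (r1 n)) \<le> 1 + r + \<mu> + shift" for n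
    using form_Q_ge[OF v[of "r1 n"]] vE[of "r1 n"] v1[of "r1 n"] unfolding form_EL_eq by simp
  obtain r2 :: "nat \<Rightarrow> nat" and v' where r2: "strict_mono r2" and v': "v' \<in> H"
    and vlim: "(\<lambda>n. sq_dist ip (v (r1 (r2 n))) v') \<longlonglongrightarrow> 0"
    by (rule H_bounded_subseq[where u = "\<lambda>n. v (r1 n)", OF v bv])
  define k where "k n = r1 (r2 n)" for n
  have ks: "strict_mono k" using strict_mono_o[OF r1 r2] unfolding k_def[abs_def] by (simp add: o_def)
  have ulim: "(\<lambda>n. sq_dist ip (u (k n)) u') \<longlonglongrightarrow> 0"
    using LIMSEQ_subseq_LIMSEQ[OF ulim r2] unfolding k_def by (simp add: o_def)
  note vlim = vlim[folded k_def]
  have \<eta>k: "(\<lambda>n. \<eta> (k n)) \<longlonglongrightarrow> 0" using LIMSEQ_subseq_LIMSEQ[OF \<eta>0 ks] by (simp add: o_def)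
  have "(\<lambda>n. ip (u (k n)) (u (k n))) \<longlonglongrightarrow> ip u' u'"
    by (rule N.tendsto_sq[where T = UNIV, OF u u' _ ulim]) simp
  then have u'1: "ip u' u' = 1" unfolding u1 by (rule LIMSEQ_unique[OF _ tendsto_const])
  have "(\<lambda>n. ip (v (k n)) (v (k n))) \<longlonglongrightarrow> ip v' v'"
    by (rule N.tendsto_sq[where T = UNIV, OF v v' _ vlim]) simp
  then have v'1: "ip v' v' = 1" unfolding v1 by (rule LIMSEQ_unique[OF _ tendsto_const])
  have "form_E u' u' \<le> (\<mu> + 0 + r * 0) - form_G u' u' + shift"
  proof (rule form_E_lsc(2)[OF u H_L2[OF u'] ulim])
    show "(\<lambda>n. (\<mu> + \<eta> (k n) + r * \<eta> (k n)) - form_G (u (k n)) (u (k n)) + shift)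
        \<longlonglongrightarrow> (\<mu> + 0 + r * 0) - form_G u' u' + shift"
      by (intro tendsto_intros \<eta>k form_G_tendsto u u' ulim)
    show "form_E (u (k n)) (u (k n)) \<le> (\<mu> + \<eta> (k n) + r * \<eta> (k n)) - form_G (u (k n)) (u (k n)) + shift" for n
      using uE[of "k n"] up[of "k n"] u1[of "k n"] unfolding E_r_eq[OF u] form_EL_eq form_Q_def by simp
  qed
  then have "form_EL u' u' \<le> \<mu>" unfolding form_EL_eq form_Q_def u'1 by simp
  then have "form_EL u' u' = \<mu> * ip u' u'" using lambda1_le[OF u'] u'1 by simp
  from first_eigenvalue_simple[OF u' this] have u'ae: "AE x in lborel. u' x = ip u' \<phi> * \<phi> x" .
  have t: "ip u' \<phi> \<noteq> 0"
  proof
    assume "ip u' \<phi> = 0"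
    then have "AE x in lborel. u' x = 0" using u'ae by simp
    then show False using ip_zero_iff[OF u'] u'1 by simp
  qed
  have "(\<lambda>n. ip (v (k n)) (u (k n))) \<longlonglongrightarrow> ip v' u'"
    by (rule N.tendsto_form[where T = UNIV, OF v u v' u' _ vlim ulim]) simp
  moreover have "ip (v n) (u n) = sqrt (\<eta> n)" for n
    unfolding v_def N.scale_left[OF H_pos[OF u] u] form_EL_decomp(3)[OF u] up
    using \<eta>(1)[of n] by (simp add: real_div_sqrt)
  moreover have "(\<lambda>n. sqrt (\<eta> (k n))) \<longlonglongrightarrow> sqrt 0" by (intro tendsto_real_sqrt \<eta>k)
  ultimately have vu: "ip v' u' = 0" using LIMSEQ_unique by fastforce
  have "ip u' v' = ip (\<lambda>x. ip u' \<phi> * \<phi> x) v'"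
    by (rule ip_cong[OF u' N.scale_mem[OF phi_H] v' u'ae])
  also have "\<dots> = ip u' \<phi> * ip \<phi> v'" by (rule N.scale_left[OF phi_H v'])
  finally have vphi: "ip v' \<phi> = 0" using vu t N.sym[OF u' v'] N.sym[OF phi_H v'] by simp
  have "ip (neg_part v') (neg_part v') \<le> sq_dist ip (v (k n)) v'" for n
  proof (rule ip_mono[OF H_L2[OF H_neg[OF v']] H_L2[OF N.diff_mem[OF v v']]])
    fix x
    have "0 \<le> v (k n) x" unfolding v_def using \<eta>(1)[of "k n"] pos_part_nonneg[of "u (k n)" x] by simp
    then show "\<bar>neg_part v' x\<bar> \<le> \<bar>v (k n) x - v' x\<bar>" by (auto simp: neg_part_def)
  qed
  then have "ip (neg_part v') (neg_part v') \<le> 0" by (intro LIMSEQ_le_const[OF vlim]) auto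
  then have "ip (neg_part v') (neg_part v') = 0" using N.nonneg[OF H_neg[OF v']] by linarith
  then have "AE x in lborel. neg_part v' x = 0" using ip_zero_iff[OF H_neg[OF v']] by simp
  then have "AE x in lborel. 0 \<le> v' x" by eventually_elim (auto simp: neg_part_def max_def split: if_splits)
  from orthogonal_phi_zero[OF v' this vphi] have "ip v' v' = 0" using ip_zero_iff[OF v'] by simp
  then show False using v'1 by simp
qed

text \<open>
  Along a path \<open>\<langle>u\<^sup>+, u\<^sup>+\<rangle>\<close> moves continuously from 0 to 1 and meets the level \<open>\<eta>\<close> of the preceding
  lemma.
\<close>
lemma minimax_gt:
  assumes r: "0 \<le> r"
  shows "\<mu> < minimax_c \<Omega> \<phi> r"
proof -
  obtain \<eta> \<delta> where h: "0 < \<eta>" "\<eta> < 1" "0 < \<delta>"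
    and gap: "\<And>u. u \<in> L2_sphere \<Omega> \<Longrightarrow> ip (pos_part u) (pos_part u) = \<eta> \<Longrightarrow> \<mu> + \<delta> \<le> E_r \<Omega> r u"
    using E_r_gap[OF r] by blast
  have "\<mu> + \<delta> \<le> (SUP t\<in>I. E_r \<Omega> r (\<gamma> t))" if g: "\<gamma> \<in> paths \<Omega> \<phi>" for \<gamma>
  proof -
    note gH = pathD(1)[OF g]
    define f where "f t = ip (pos_part (\<gamma> t)) (pos_part (\<gamma> t))" for t
    have "continuous_on I f" unfolding continuous_on_def
    proof
      fix t assume t: "t \<in> I"
      have d: "(\<lambda>x. pos_part (\<gamma> s) x - pos_part (\<gamma> t) x) \<in> H" if "s \<in> I" for s
        by (rule N.diff_mem[OF H_pos[OF gH[OF that]] H_pos[OF gH[OF t]]])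
      have "((\<lambda>s. sq_dist ip (pos_part (\<gamma> s)) (pos_part (\<gamma> t))) \<longlongrightarrow> 0) (at t within I)"
      proof (rule tendsto_sandwich[OF _ _ tendsto_const pathD(5)[OF g t]])
        show "\<forall>\<^sub>F s in at t within I. 0 \<le> sq_dist ip (pos_part (\<gamma> s)) (pos_part (\<gamma> t))"
          using eventually_in_within by eventually_elim (rule N.nonneg[OF d])
        show "\<forall>\<^sub>F s in at t within I. sq_dist ip (pos_part (\<gamma> s)) (pos_part (\<gamma> t))
            \<le> sq_dist ip (\<gamma> s) (\<gamma> t)"
          using eventually_in_within by eventually_elim (rule ip_pos_part_diff[OF gH gH[OF t]])
      qed
      from N.tendsto_sq[where T = I, OF H_pos[OF gH] H_pos[OF gH[OF t]] eventually_in_within this]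
      show "(f \<longlongrightarrow> f t) (at t within I)" unfolding f_def .
    qed
    moreover have "f (-1) = 0"
    proof -
      have "AE x in lborel. pos_part (\<gamma> (-1)) x = 0"
        using pathD(6)[OF g] phi_nonneg by eventually_elim (simp add: pos_part_def)
      then show ?thesis unfolding f_def using ip_zero_iff[OF H_pos[OF gH]] by simp
    qed
    moreover have "f 1 = 1"
    proof -
      have "AE x in lborel. pos_part (\<gamma> 1) x = \<phi> x"
        using pathD(7)[OF g] phi_nonneg by eventually_elim (simp add: pos_part_def)
      then show ?thesis unfolding f_def using ip_cong_sq[OF H_pos[OF gH] phi_H] phi_norm by simp
    qed
    ultimately obtain t where t: "t \<in> I" "f t = \<eta>" using IVT'[of f "-1" \<eta> 1] h by auto
    have "\<mu> + \<delta> \<le> E_r \<Omega> r (\<gamma> t)" by (rule gap[OF pathD(3)[OF g t(1)]]) (use t(2) in \<open>simp add: f_def\<close>)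
    also have "\<dots> \<le> (SUP t\<in>I. E_r \<Omega> r (\<gamma> t))" by (rule cSUP_upper[OF t(1) E_r_bdd_above[OF g r]])
    finally show ?thesis .
  qed
  then have "\<mu> + \<delta> \<le> minimax_c \<Omega> \<phi> r" unfolding minimax_c_def by (rule cINF_greatest[OF paths_nonempty])
  then show ?thesis using h(3) by linarith
qed

lemma ip_source:
  assumes "u \<in> H" "w \<in> H"
  shows "ip (\<lambda>x. r * pos_part u x + s * u x) w = r * ip (pos_part u) w + s * ip u w"
  using assms by (simp add: N.add_left N.scale_left N.scale_mem H_pos)

end

text \<open>
  The step that lowers a path without a flow. Up to a factor 2, \<open>source\<close> is the gradient of the
  convex function \<open>F(u) = r \<langle>u\<^sup>+, u\<^sup>+\<rangle> + weight \<langle>u, u\<rangle>\<close>, and \<open>step\<close> is one inverse iteration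
  \<open>Q(step u, w) = \<langle>source u, w\<rangle>\<close>. The Rayleigh quotient of \<open>E_r\<close> lies above \<open>level\<close> where
  \<open>excess\<close>, which is \<open>Q - F\<close>, is positive.
\<close>
locale minimax_level = first_eigenpair +
  fixes r :: real
  assumes r: "0 \<le> r"
begin

definition level :: real where "level = minimax_c \<Omega> \<phi> r"

definition weight :: real where "weight = shift + level"

definition source :: "('a \<Rightarrow> real) \<Rightarrow> 'a \<Rightarrow> real" where
  "source u = (\<lambda>x. r * pos_part u x + weight * u x)"

definition step :: "('a \<Rightarrow> real) \<Rightarrow> 'a \<Rightarrow> real" where
  "step u = (SOME v. v \<in> H \<and> (\<forall>w\<in>H. form_Q v w = ip (source u) w))"

definition excess :: "('a \<Rightarrow> real) \<Rightarrow> real" where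
  "excess w = E_r \<Omega> r w - level * ip w w"

definition lip :: real where "lip = 2 * (r\<^sup>2 + weight\<^sup>2)"

lemma shift_mu: "1 \<le> shift + \<mu>"
  using form_Q_ge[OF phi_H] E.nonneg[OF phi_H] phi_eq[OF phi_H] phi_norm unfolding form_EL_eq by simp

text \<open>Convexity of \<open>F\<close> thus rests on the lower bound for the minimax value.\<close>
lemma weight_gt_1: "1 < weight"
  using shift_mu minimax_gt[OF r] unfolding weight_def level_def by linarith

lemma lip_pos: "0 < lip"
  using weight_gt_1 unfolding lip_def by (simp add: add_nonneg_pos)

lemma source_H: "u \<in> H \<Longrightarrow> source u \<in> H"
  unfolding source_def by (intro N.lin_mem H_pos)

lemma
  assumes "u \<in> H"
  shows step_H: "step u \<in> H" and step_eq: "\<And>w. w \<in> H \<Longrightarrow> form_Q (step u) w = ip (source u) w"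
proof -
  have "\<exists>v. v \<in> H \<and> (\<forall>w\<in>H. form_Q v w = ip (source u) w)"
    using resolvent_exists[OF source_H[OF assms]] by blast
  from someI_ex[OF this] show "step u \<in> H" "\<And>w. w \<in> H \<Longrightarrow> form_Q (step u) w = ip (source u) w"
    unfolding step_def by auto
qed

lemma source_lipschitz:
  assumes u: "u \<in> H" and v: "v \<in> H"
  shows "sq_dist ip (source u) (source v) \<le> lip * sq_dist ip u v"
proof -
  let ?p = "\<lambda>x. pos_part u x - pos_part v x" and ?d = "\<lambda>x. u x - v x"
  have p: "?p \<in> H" by (rule N.diff_mem[OF H_pos[OF u] H_pos[OF v]])
  have e: "(\<lambda>x. source u x - source v x) = (\<lambda>x. r * ?p x + weight * ?d x)"
    unfolding source_def by (auto simp: algebra_simps)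
  have "sq_dist ip (source u) (source v) \<le> 2 * r\<^sup>2 * ip ?p ?p + 2 * weight\<^sup>2 * ip ?d ?d"
    unfolding e by (rule N.lin_sq_le[OF p N.diff_mem[OF u v]])
  moreover have "2 * r\<^sup>2 * ip ?p ?p \<le> 2 * r\<^sup>2 * ip ?d ?d"
    by (intro mult_left_mono ip_pos_part_diff u v) auto
  ultimately show ?thesis by (simp add: lip_def algebra_simps)
qed

lemma ip_le_form_Q:
  assumes "w \<in> H"
  shows "ip w w \<le> form_Q w w"
  using form_Q_ge[OF assms] E.nonneg[OF assms] by linarith

lemma form_Q_step_bound:
  assumes w: "w \<in> H" and g: "g \<in> H" and eq: "form_Q w w = ip g w"
  shows "form_Q w w \<le> ip g g"
proof -
  have "2 * ip g w \<le> ip g g + ip w w"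
    using N.nonneg[OF N.diff_mem[OF g w]] unfolding N.diff_sq[OF g w] by simp
  then show ?thesis using eq ip_le_form_Q[OF w] by linarith
qed

lemma step_lipschitz:
  assumes u: "u \<in> H" and v: "v \<in> H"
  shows "sq_dist form_Q (step u) (step v) \<le> lip * sq_dist ip u v"
proof -
  let ?w = "\<lambda>x. step u x - step v x" and ?g = "\<lambda>x. source u x - source v x"
  have w: "?w \<in> H" by (rule N.diff_mem[OF step_H[OF u] step_H[OF v]])
  have g: "?g \<in> H" by (rule N.diff_mem[OF source_H[OF u] source_H[OF v]])
  have "form_Q ?w ?w = ip ?g ?w"
    unfolding Q.diff_left[OF step_H[OF u] step_H[OF v] w] N.diff_left[OF source_H[OF u] source_H[OF v] w]
      step_eq[OF u w] step_eq[OF v w] ..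
  from form_Q_step_bound[OF w g this] show ?thesis using source_lipschitz[OF u v] by linarith
qed

lemma excess_eq:
  "w \<in> H \<Longrightarrow> excess w = form_Q w w - r * ip (pos_part w) (pos_part w) - weight * ip w w"
  unfolding excess_def form_EL_eq weight_def by (simp add: E_r_eq form_EL_eq algebra_simps)

text \<open>
  For \<open>v = step u\<close> convexity gives \<open>F(v) \<ge> F(u) + 2 \<langle>source u, v - u\<rangle>\<close>, where the inner product is
  \<open>Q(v, v - u)\<close>. As \<open>F\<close> is homogeneous of degree two, \<open>Q(v, u) = \<langle>source u, u\<rangle> = F(u)\<close>; what remains
  is the square \<open>Q(u - v, u - v)\<close>.
\<close>
lemma excess_step:
  assumes u: "u \<in> H"
  shows "excess (step u) \<le> excess u - sq_dist form_Q u (step u)"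
proof -
  let ?v = "step u"
  note v = step_H[OF u] and d = N.diff_mem[OF step_H[OF u] u]
  have "ip u u + 2 * ip u (\<lambda>x. ?v x - u x) \<le> ip ?v ?v"
    using N.nonneg[OF d] unfolding N.diff_sq[OF v u] N.diff_right[OF v u u] N.sym[OF v u] by simp
  then have "weight * (ip u u + 2 * ip u (\<lambda>x. ?v x - u x)) \<le> weight * ip ?v ?v"
    using weight_gt_1 by (intro mult_left_mono) auto
  then have "weight * ip u u + 2 * weight * ip u (\<lambda>x. ?v x - u x) \<le> weight * ip ?v ?v" by (simp add: algebra_simps)
  moreover have "r * ip (pos_part u) (pos_part u) + 2 * r * ip (pos_part u) (\<lambda>x. ?v x - u x)
      \<le> r * ip (pos_part ?v) (pos_part ?v)"
    using mult_left_mono[OF ip_pos_part_convex[OF u v] r] by (simp add: algebra_simps)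
  moreover have "ip (source u) (\<lambda>x. ?v x - u x) = form_Q ?v ?v - form_Q u ?v"
    unfolding step_eq[OF u d, symmetric] Q.diff_right[OF v u v] Q.sym[OF v u] ..
  moreover have "sq_dist form_Q u ?v = form_Q u u - 2 * form_Q u ?v + form_Q ?v ?v"
    by (rule Q.diff_sq[OF u v])
  ultimately show ?thesis
    unfolding excess_eq[OF u] excess_eq[OF v] ip_source[OF u d, of r weight, folded source_def] by linarith
qed

text \<open>Since \<open>Q(\<phi>, w) = (M + \<mu>) \<langle>\<phi>, w\<rangle>\<close>, a step only rescales the eigenfunction.\<close>
lemma step_phi:
  assumes u: "u \<in> H" and s: "AE x in lborel. source u x = (b * (shift + \<mu>)) * \<phi> x"
  shows "AE x in lborel. step u x = b * \<phi> x"
proof -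
  let ?w = "\<lambda>x. step u x - b * \<phi> x"
  have bp: "(\<lambda>x. b * \<phi> x) \<in> H" by (rule N.scale_mem[OF phi_H])
  have w: "?w \<in> H" by (rule N.diff_mem[OF step_H[OF u] bp])
  have "ip (source u) ?w = ip (\<lambda>x. (b * (shift + \<mu>)) * \<phi> x) ?w"
    by (rule ip_cong[OF source_H[OF u] N.scale_mem[OF phi_H] w s])
  also have "\<dots> = b * (shift + \<mu>) * ip \<phi> ?w" by (rule N.scale_left[OF phi_H w])
  also have "\<dots> = form_Q (\<lambda>x. b * \<phi> x) ?w"
    using phi_eq[OF w] unfolding Q.scale_left[OF phi_H w] form_EL_eq by (simp add: algebra_simps)
  finally have "form_Q ?w ?w = 0"
    unfolding Q.diff_left[OF step_H[OF u] bp w] step_eq[OF u w] by simp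
  then have "ip ?w ?w = 0" using ip_le_form_Q[OF w] N.nonneg[OF w] by linarith
  then have "AE x in lborel. ?w x = 0" using ip_zero_iff[OF w] by simp
  then show ?thesis by simp
qed

lemma form_Q_null:
  assumes d: "d \<in> H" and z: "AE x in lborel. d x = 0" and w: "w \<in> H"
  shows "form_Q d w = 0"
proof (rule Q.null_right[OF d w])
  from AE_lborel_pair[OF z] have "AE z in lborel2. grad_k d z * grad_k d z = 0"
    by eventually_elim (simp add: grad_k_def)
  then have "form_E d d = 0" unfolding form_E_grad by (rule integral_eq_zero_AE)
  moreover have "form_G d d = 0" using form_G_bounds[OF H_L2[OF d]] z ip_zero_iff[OF d] by simp
  ultimately show "form_Q d d = 0" by (simp add: form_Q_def)
qed

lemma step_fixed_critical:
  assumes v: "v \<in> H" and fixed: "AE x in lborel. v x = step v x" and ne: "\<not> (AE x in lborel. v x = 0)"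
  shows "(r + level, level) \<in> fucik_spectrum \<Omega>"
proof -
  have "form_EL v w = r * ip (pos_part v) w + level * ip v w" if w: "w \<in> H" for w
  proof -
    have "form_Q (\<lambda>x. v x - step v x) w = 0"
      by (rule form_Q_null[OF N.diff_mem[OF v step_H[OF v]] _ w]) (use fixed in simp)
    then have "form_Q v w = ip (source v) w"
      using Q.diff_left[OF v step_H[OF v] w] step_eq[OF v w] by simp
    then show ?thesis
      unfolding form_EL_eq ip_source[OF v w, of r weight, folded source_def] weight_def by (simp add: algebra_simps)
  qed
  then show ?thesis unfolding fucik_iff using v ne by blast
qed

text \<open>
  The Palais-Smale argument. If \<open>u_n - step u_n\<close> tends to zero along a sequence of bounded
  energy, a subsequence converges in \<open>L\<^sup>2\<close> to some \<open>v\<close> of norm one, and since \<open>step\<close> is Lipschitz in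
  \<open>L\<^sup>2\<close>, \<open>v\<close> is a fixed point.
\<close>
lemma step_gap:
  assumes ncrit: "(r + level, level) \<notin> fucik_spectrum \<Omega>"
  shows "\<exists>\<delta>>0. \<forall>u\<in>L2_sphere \<Omega>. form_E u u + ip u u \<le> B \<longrightarrow> \<delta> \<le> sq_dist form_Q u (step u)"
proof (rule ccontr)
  assume neg: "\<not> ?thesis"
  have "\<exists>u. u \<in> L2_sphere \<Omega> \<and> form_E u u + ip u u \<le> B \<and>
      sq_dist form_Q u (step u) < inverse (real (Suc n))" for n
    using neg by (metis not_le inverse_positive_iff_positive of_nat_0_less_iff zero_less_Suc)
  then obtain u where us: "\<And>n. u n \<in> L2_sphere \<Omega>" and uB: "\<And>n. form_E (u n) (u n) + ip (u n) (u n) \<le> B"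
    and uT: "\<And>n. sq_dist form_Q (u n) (step (u n)) < inverse (real (Suc n))" by metis
  have u: "u n \<in> H" and u1: "ip (u n) (u n) = 1" for n using us[of n] by (auto simp: L2_sphere_iff)
  obtain k :: "nat \<Rightarrow> nat" and v where k: "strict_mono k" and v: "v \<in> H"
    and lim: "(\<lambda>n. sq_dist ip (u (k n)) v) \<longlonglongrightarrow> 0"
    by (rule H_bounded_subseq[OF u uB])
  have "(\<lambda>n. ip (u (k n)) (u (k n))) \<longlonglongrightarrow> ip v v"
    by (rule N.tendsto_sq[where T = UNIV, OF u v _ lim]) simp
  then have v1: "ip v v = 1" unfolding u1 by (rule LIMSEQ_unique[OF _ tendsto_const])
  note Tv = step_H[OF v]
  have "sq_dist ip v (step v) \<le> (2 + 4 * lip) * sq_dist ip (u (k n)) v + 4 * inverse (real (Suc (k n)))" for n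
  proof -
    let ?u = "u (k n)"
    note uk = u[of "k n"]
    have "sq_dist ip v (step v) \<le> 2 * sq_dist ip v ?u + 2 * sq_dist ip ?u (step v)"
      by (rule N.diff_sq_le[OF v uk Tv])
    moreover have "sq_dist ip ?u (step v) \<le> 2 * sq_dist ip ?u (step ?u) + 2 * sq_dist ip (step ?u) (step v)"
      by (rule N.diff_sq_le[OF uk step_H[OF uk] Tv])
    moreover have "sq_dist ip ?u (step ?u) \<le> inverse (real (Suc (k n)))"
      using ip_le_form_Q[OF N.diff_mem[OF uk step_H[OF uk]]] uT[of "k n"] by linarith
    moreover have "sq_dist ip (step ?u) (step v) \<le> lip * sq_dist ip ?u v"
      using ip_le_form_Q[OF N.diff_mem[OF step_H[OF uk] Tv]] step_lipschitz[OF uk v] by linarith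
    ultimately show ?thesis using N.diff_comm[OF v uk] by (simp add: algebra_simps)
  qed
  moreover have "(\<lambda>n. (2 + 4 * lip) * sq_dist ip (u (k n)) v + 4 * inverse (real (Suc (k n))))
      \<longlonglongrightarrow> (2 + 4 * lip) * 0 + 4 * 0"
    using LIMSEQ_subseq_LIMSEQ[OF LIMSEQ_inverse_real_of_nat k]
    by (intro tendsto_intros lim) (simp add: o_def)
  ultimately have "sq_dist ip v (step v) \<le> (2 + 4 * lip) * 0 + 4 * 0"
    by (intro LIMSEQ_le_const) auto
  then have "sq_dist ip v (step v) = 0" using N.nonneg[OF N.diff_mem[OF v Tv]] by simp
  then have "AE x in lborel. v x = step v x" using ip_zero_iff[OF N.diff_mem[OF v Tv]] by simp
  moreover have "\<not> (AE x in lborel. v x = 0)" using ip_zero_iff[OF v] v1 by auto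
  ultimately show False using step_fixed_critical[OF v] ncrit by blast
qed

lemma excess_null:
  assumes v: "v \<in> H" and z: "ip v v = 0"
  shows "0 \<le> excess v"
proof -
  have "ip (pos_part v) (pos_part v) = 0"
    using z form_EL_decomp(2)[OF v] N.nonneg[OF H_pos[OF v]] N.nonneg[OF H_neg[OF v]] by linarith
  then show ?thesis unfolding excess_eq[OF v] using z Q.nonneg[OF v] by simp
qed

lemma step_norm_le:
  assumes u: "u \<in> L2_sphere \<Omega>"
  shows "ip (step u) (step u) \<le> lip"
proof -
  have uH: "u \<in> H" and u1: "ip u u = 1" using u by (auto simp: L2_sphere_iff)
  have "ip (source u) (source u) \<le> 2 * r\<^sup>2 * ip (pos_part u) (pos_part u) + 2 * weight\<^sup>2 * ip u u"
    unfolding source_def by (rule N.lin_sq_le[OF H_pos[OF uH] uH])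
  moreover have "2 * r\<^sup>2 * ip (pos_part u) (pos_part u) \<le> 2 * r\<^sup>2 * 1"
    using form_EL_decomp(2)[OF uH] N.nonneg[OF H_neg[OF uH]] u1 by (intro mult_left_mono) auto
  moreover have "form_Q (step u) (step u) \<le> ip (source u) (source u)"
    by (rule form_Q_step_bound[OF step_H[OF uH] source_H[OF uH] step_eq[OF uH step_H[OF uH]]])
  ultimately show ?thesis using ip_le_form_Q[OF step_H[OF uH]] u1 unfolding lip_def by simp
qed

lemma step_path:
  assumes g: "\<gamma> \<in> paths \<Omega> \<phi>" and pos: "\<And>t. t \<in> I \<Longrightarrow> 0 < ip (step (\<gamma> t)) (step (\<gamma> t))"
  shows "(\<lambda>t. L2_normalize (step (\<gamma> t))) \<in> paths \<Omega> \<phi>"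
proof (rule L2_normalize_path)
  note gH = pathD(1)[OF g]
  show "step (\<gamma> t) \<in> H" if "t \<in> I" for t by (rule step_H[OF gH[OF that]])
  show "0 < ip (step (\<gamma> t)) (step (\<gamma> t))" if "t \<in> I" for t by (rule pos[OF that])
  show "((\<lambda>s. sq_dist form_E (step (\<gamma> s)) (step (\<gamma> t))) \<longlongrightarrow> 0) (at t within I)" if t: "t \<in> I" for t
  proof (rule tendsto_sandwich[OF _ _ tendsto_const])
    have d: "(\<lambda>x. step (\<gamma> s) x - step (\<gamma> t) x) \<in> H" if "s \<in> I" for s
      by (rule N.diff_mem[OF step_H[OF gH[OF that]] step_H[OF gH[OF t]]])
    show "\<forall>\<^sub>F s in at t within I. 0 \<le> sq_dist form_E (step (\<gamma> s)) (step (\<gamma> t))"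
      using eventually_in_within by eventually_elim (rule E.nonneg[OF d])
    show "\<forall>\<^sub>F s in at t within I. sq_dist form_E (step (\<gamma> s)) (step (\<gamma> t)) \<le> lip * sq_dist ip (\<gamma> s) (\<gamma> t)"
      using eventually_in_within
    proof eventually_elim
      case (elim s)
      show ?case using step_lipschitz[OF gH[OF elim] gH[OF t]] form_Q_ge[OF d[OF elim]] N.nonneg[OF d[OF elim]]
        by linarith
    qed
    show "((\<lambda>s. lip * sq_dist ip (\<gamma> s) (\<gamma> t)) \<longlongrightarrow> 0) (at t within I)"
      using tendsto_mult_left[OF pathD(5)[OF g t], of lip] by simp
  qed
  have sm: "0 < shift + \<mu>" using shift_mu by linarith
  have q: "- (weight / (shift + \<mu>)) * (shift + \<mu>) = - weight"
    "(r + weight) / (shift + \<mu>) * (shift + \<mu>) = r + weight" using sm by simp_all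
  show "AE x in lborel. step (\<gamma> (-1)) x = - (weight / (shift + \<mu>)) * \<phi> x"
  proof (rule step_phi[OF gH])
    show "AE x in lborel. source (\<gamma> (- 1)) x = - (weight / (shift + \<mu>)) * (shift + \<mu>) * \<phi> x"
      unfolding q using pathD(6)[OF g] phi_nonneg by eventually_elim (simp add: source_def pos_part_def)
  qed simp
  show "AE x in lborel. step (\<gamma> 1) x = ((r + weight) / (shift + \<mu>)) * \<phi> x"
  proof (rule step_phi[OF gH])
    show "AE x in lborel. source (\<gamma> 1) x = (r + weight) / (shift + \<mu>) * (shift + \<mu>) * \<phi> x"
      unfolding q using pathD(7)[OF g] phi_nonneg
      by eventually_elim (simp add: source_def pos_part_def distrib_right)
  qed simp
  show "0 < weight / (shift + \<mu>)" "0 < (r + weight) / (shift + \<mu>)" using sm weight_gt_1 r by auto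
qed

text \<open>
  Along a path with maximum below \<open>level + \<delta> / 2\<close> the excess is at most \<open>\<delta> / 2\<close>; after a step it is at
  most \<open>- \<delta> / 2\<close>, uniformly, so the new path avoids zero, and as its norms are bounded its levels
  stay below \<open>level\<close> by a fixed amount.
\<close>
lemma minimax_critical: "(r + level, level) \<in> fucik_spectrum \<Omega>"
proof (rule ccontr)
  assume ncrit: "(r + level, level) \<notin> fucik_spectrum \<Omega>"
  define B where "B = level + 1 + r + shift"
  obtain \<delta>' where d': "0 < \<delta>'"
    "\<And>u. u \<in> L2_sphere \<Omega> \<Longrightarrow> form_E u u + ip u u \<le> B \<Longrightarrow> \<delta>' \<le> sq_dist form_Q u (step u)"
    using step_gap[OF ncrit, of B] by blast
  \<comment> \<open>\<open>\<delta> \<le> 1\<close> keeps the path within the energy bound \<open>B\<close>\<close>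
  define \<delta> where "\<delta> = min \<delta>' 1"
  have \<delta>: "0 < \<delta>" "\<delta> \<le> 1" "\<delta> \<le> \<delta>'" using d'(1) by (auto simp: \<delta>_def)
  have "(INF \<gamma>\<in>paths \<Omega> \<phi>. SUP t\<in>I. E_r \<Omega> r (\<gamma> t)) < level + \<delta> / 2"
    using \<delta> unfolding level_def minimax_c_def by simp
  then obtain \<gamma> where g: "\<gamma> \<in> paths \<Omega> \<phi>" and gs: "(SUP t\<in>I. E_r \<Omega> r (\<gamma> t)) < level + \<delta> / 2"
    using cInf_lessD[of "(\<lambda>\<gamma>. SUP t\<in>I. E_r \<Omega> r (\<gamma> t)) ` paths \<Omega> \<phi>"] paths_nonempty by blast
  note gH = pathD(1)[OF g]
  have gE: "E_r \<Omega> r (\<gamma> t) < level + \<delta> / 2" if "t \<in> I" for t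
    using cSUP_upper[OF that E_r_bdd_above[OF g r]] gs by linarith
  have low: "excess (step (\<gamma> t)) \<le> - (\<delta> / 2)" if t: "t \<in> I" for t
  proof -
    have "form_E (\<gamma> t) (\<gamma> t) + ip (\<gamma> t) (\<gamma> t) \<le> B"
      using form_Q_ge[OF gH[OF t]] form_Q_le[OF pathD(3)[OF g t] r] gE[OF t] \<delta> unfolding B_def by linarith
    from d'(2)[OF pathD(3)[OF g t] this]
    have "\<delta> \<le> sq_dist form_Q (\<gamma> t) (step (\<gamma> t))" using \<delta>(3) by linarith
    moreover have "excess (\<gamma> t) \<le> \<delta> / 2" using gE[OF t] pathD(2)[OF g t] unfolding excess_def by simp
    ultimately show ?thesis using excess_step[OF gH[OF t]] by linarith
  qed
  have pos: "0 < ip (step (\<gamma> t)) (step (\<gamma> t))" if t: "t \<in> I" for t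
    using low[OF t] \<delta>(1) excess_null[OF step_H[OF gH[OF t]]] N.nonneg[OF step_H[OF gH[OF t]]] by force
  have "E_r \<Omega> r (L2_normalize (step (\<gamma> t))) \<le> level - (\<delta> / 2) / lip" if t: "t \<in> I" for t
  proof -
    let ?n = "ip (step (\<gamma> t)) (step (\<gamma> t))"
    have "E_r \<Omega> r (step (\<gamma> t)) \<le> level * ?n - \<delta> / 2" using low[OF t] unfolding excess_def by simp
    then have "E_r \<Omega> r (step (\<gamma> t)) / ?n \<le> (level * ?n - \<delta> / 2) / ?n" using pos[OF t] by (intro divide_right_mono) auto
    also have "\<dots> = level - (\<delta> / 2) / ?n" using pos[OF t] by (simp add: diff_divide_distrib)
    also have "\<dots> \<le> level - (\<delta> / 2) / lip"
      using pos[OF t] step_norm_le[OF pathD(3)[OF g t]] \<delta>(1) lip_pos by (intro diff_left_mono divide_left_mono) auto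
    finally show ?thesis unfolding L2_normalize_sphere(2)[OF step_H[OF gH[OF t]] pos[OF t]] .
  qed
  from minimax_le[OF step_path[OF g pos] r this]
  have "level \<le> level - (\<delta> / 2) / lip" unfolding level_def by simp
  moreover have "0 < (\<delta> / 2) / lip" using \<delta>(1) lip_pos by simp
  ultimately show False by linarith
qed

end

context first_eigenpair
begin

text \<open>
  With \<open>m = - E_L(u\<^sup>+, u\<^sup>-) \<ge> 0\<close>, testing the equation with \<open>u\<^sup>+\<close> and \<open>u\<^sup>-\<close> gives
  \<open>E_L(u\<^sup>+, u\<^sup>+) = (r + t) \<langle>u\<^sup>+, u\<^sup>+\<rangle> - m\<close> and \<open>E_L(u\<^sup>-, u\<^sup>-) = t \<langle>u\<^sup>-, u\<^sup>-\<rangle> - m\<close>. Consequently \<open>E_r\<close> at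
  \<open>b u\<^sup>+ - d u\<^sup>-\<close> is \<open>t\<close> times the squared norm minus \<open>m (b - d)\<^sup>2\<close>.
\<close>
lemma minimax_le_nontrivial:
  assumes r: "0 \<le> r" and nt: "nontrivial_fucik_point \<Omega> (r + t, t)"
  shows "minimax_c \<Omega> \<phi> r \<le> t"
proof -
  have ne: "t \<noteq> \<mu>" "r + t \<noteq> \<mu>" and "(r + t, t) \<in> fucik_spectrum \<Omega>"
    using nt by (auto simp: nontrivial_fucik_point_def)
  then obtain u where u: "u \<in> H" and u0: "\<not> (AE x in lborel. u x = 0)"
    and eq: "\<And>v. v \<in> H \<Longrightarrow> form_EL u v = r * ip (pos_part u) v + t * ip u v"
    unfolding fucik_iff by blast
  define p where "p = pos_part u"
  define n where "n = neg_part u"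
  have p: "p \<in> H" and n: "n \<in> H" unfolding p_def n_def by (rule H_pos[OF u], rule H_neg[OF u])
  have pn: "ip p n = 0" unfolding p_def n_def by (rule ip_parts[OF u])
  have p0: "0 \<le> p x" and n0: "0 \<le> n x" and pnx: "p x * n x = 0" and upn: "u x = p x - n x" for x
    unfolding p_def n_def by (simp_all only: pos_part_nonneg neg_part_nonneg parts_mult parts_diff)
  have ulin: "u = (\<lambda>x. p x - n x)" using upn by auto
  have ip_u: "ip u v = ip p v - ip n v" if "v \<in> H" for v
    unfolding ulin by (rule N.diff_left[OF p n that])
  have EL_u: "form_EL u v = form_EL p v - form_EL n v" if "v \<in> H" for v
    unfolding form_EL_eq ulin Q.diff_left[OF p n that] N.diff_left[OF p n that] by (simp add: algebra_simps)
  define m where "m = - form_EL p n"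
  have m0: "0 \<le> m" using form_EL_parts(1)[OF u] unfolding m_def p_def n_def by simp
  have Ep: "form_EL p p = (r + t) * ip p p - m"
    using eq[OF p] EL_u[OF p] ip_u[OF p] form_EL_sym[OF n p] N.sym[OF n p] pn
    unfolding m_def p_def[symmetric] by (simp add: algebra_simps)
  have En: "form_EL n n = t * ip n n - m"
    using eq[OF n] EL_u[OF n] ip_u[OF n] pn unfolding m_def p_def[symmetric] by (simp add: algebra_simps)
  have phi: "(r + t - \<mu>) * ip p \<phi> = (t - \<mu>) * ip n \<phi>"
    using eq[OF phi_H] phi_eq[OF u] form_EL_sym[OF u phi_H] N.sym[OF phi_H u] ip_u[OF phi_H]
    unfolding p_def[symmetric] by (simp add: algebra_simps)
  have zero: "ip w \<phi> = 0" if "w \<in> H" "ip w w = 0" for w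
    using N.null_right[OF that(1) phi_H that(2)] .
  \<comment> \<open>both sides of \<open>phi\<close> have nonzero factors, so one part vanishes only together with the other\<close>
  have both: "ip p p \<noteq> 0 \<or> ip n n \<noteq> 0"
    using form_EL_decomp(2)[OF u] ip_zero_iff[OF u] u0 unfolding p_def n_def by auto
  have "ip w w = 0" if "w \<in> H" "\<And>x. 0 \<le> w x" "ip w \<phi> = 0" for w
    using orthogonal_phi_zero[OF that(1) _ that(3)] that(2) ip_zero_iff[OF that(1)] by simp
  from this[OF p p0] this[OF n n0] have "ip p p \<noteq> 0" "ip n n \<noteq> 0"
    using phi ne both zero[OF p] zero[OF n] by auto
  then have ppos: "0 < ip p p" and npos: "0 < ip n n"
    using N.nonneg[OF p] N.nonneg[OF n] by simp_all
  have mut: "\<mu> \<le> t"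
  proof -
    have "\<mu> * ip n n \<le> t * ip n n" using lambda1_le[OF n] En m0 by linarith
    then show ?thesis using npos by simp
  qed
  \<comment> \<open>segments from \<open>\<phi>\<close> to a nonnegative function do not rise above their higher end\<close>
  have cone: "form_EL (\<lambda>x. b * \<phi> x + d * w x) (\<lambda>x. b * \<phi> x + d * w x) \<le> k * ip (\<lambda>x. b * \<phi> x + d * w x) (\<lambda>x. b * \<phi> x + d * w x)"
    if w: "w \<in> H" "\<And>x. 0 \<le> w x" "form_EL w w \<le> k * ip w w" and k: "\<mu> \<le> k" and bd: "0 \<le> b" "0 \<le> d" for b d w k
  proof -
    have pw: "0 \<le> ip \<phi> w" using ip_nonneg[of w \<phi>, OF w(2) phi_nonneg] N.sym[OF phi_H w(1)] by simp
    have "0 \<le> b\<^sup>2 + 2 * b * d * ip \<phi> w" using bd pw by simp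
    then have "\<mu> * (b\<^sup>2 + 2 * b * d * ip \<phi> w) \<le> k * (b\<^sup>2 + 2 * b * d * ip \<phi> w)" using k by (intro mult_right_mono)
    moreover have "d\<^sup>2 * form_EL w w \<le> d\<^sup>2 * (k * ip w w)" using w(3) by (intro mult_left_mono) auto
    ultimately show ?thesis
      unfolding form_EL_lin_sq[OF phi_H w(1)] N.lin_sq[OF phi_H w(1)] phi_eq[OF phi_H] phi_eq[OF w(1)] phi_norm
      by (simp add: algebra_simps)
  qed
  \<comment> \<open>coefficients of a path through the cones spanned by \<open>-\<phi>, -u\<^sup>-\<close>, then \<open>-u\<^sup>-, u\<^sup>+\<close>, then \<open>u\<^sup>+, \<phi>\<close>, changing at \<open>\<tau> = -1/2\<close> and \<open>\<tau> = 1/2\<close>\<close>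
  define a where "a \<tau> = max 0 (2 * \<tau> - 1) - max 0 (- 2 * \<tau> - 1)" for \<tau> :: real
  define b where "b \<tau> = max 0 (min (\<tau> + 1/2) (1 - \<tau>))" for \<tau> :: real
  define d where "d \<tau> = max 0 (min (1/2 - \<tau>) (1 + \<tau>))" for \<tau> :: real
  define q where "q \<tau> x = a \<tau> * \<phi> x + b \<tau> * p x + - d \<tau> * n x" for \<tau> x
  have qH: "q \<tau> \<in> H" for \<tau> unfolding q_def[abs_def] by (intro N.add_mem N.scale_mem phi_H p n)
  have cont: "((\<lambda>s. sq_dist form_E (q s) (q \<tau>)) \<longlongrightarrow> 0) (at \<tau> within I)" for \<tau>
    unfolding q_def a_def b_def d_def
    by (rule combination_path_continuous[OF phi_H p n]) (intro tendsto_intros)+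
  have cases: "0 < ip (q \<tau>) (q \<tau>) \<and> E_r \<Omega> r (q \<tau>) \<le> t * ip (q \<tau>) (q \<tau>)" if \<tau>: "\<tau> \<in> I" for \<tau>
  proof -
    consider "\<tau> \<le> - (1/2)" | "- (1/2) \<le> \<tau>" "\<tau> \<le> 1/2" | "1/2 \<le> \<tau>" by linarith
    then show ?thesis
    proof cases
      case 1
      have c: "a \<tau> \<le> 0" "b \<tau> = 0" "0 \<le> d \<tau>" "0 < - a \<tau> \<or> 0 < d \<tau>"
        using 1 \<tau> by (auto simp: a_def b_def d_def)
      let ?w = "\<lambda>x. - a \<tau> * \<phi> x + d \<tau> * n x"
      have wH: "?w \<in> H" by (rule N.lin_mem[OF phi_H n])
      have e: "q \<tau> = (\<lambda>x. - ?w x)" unfolding q_def c(2) by (auto simp: algebra_simps)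
      have ipw: "ip (q \<tau>) (q \<tau>) = ip ?w ?w" unfolding e by (rule N.minus_sq[OF wH])
      have pw: "0 \<le> ip \<phi> n" using ip_nonneg[of n \<phi>, OF n0 phi_nonneg] N.sym[OF phi_H n] by simp
      have "0 < ip ?w ?w" unfolding N.lin_sq[OF phi_H n] phi_norm using c npos pw
        by (smt (verit) mult_nonneg_nonneg mult_pos_pos zero_less_power2 zero_le_power2)
      moreover have "E_r \<Omega> r (q \<tau>) \<le> form_EL (q \<tau>) (q \<tau>)"
        unfolding E_r_eq[OF qH] using r N.nonneg[OF H_pos[OF qH]] by simp
      moreover have "form_EL (q \<tau>) (q \<tau>) = form_EL ?w ?w"
        unfolding e form_EL_eq Q.minus_sq[OF wH] N.minus_sq[OF wH] ..
      moreover have "form_EL ?w ?w \<le> t * ip ?w ?w"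
        by (rule cone[OF n n0 _ mut]) (use En m0 c in auto)
      ultimately show ?thesis unfolding ipw by linarith
    next
      case 2
      have c: "a \<tau> = 0" "0 \<le> b \<tau>" "0 \<le> d \<tau>" "0 < b \<tau> \<or> 0 < d \<tau>"
        using 2 by (auto simp: a_def b_def d_def)
      have e: "q \<tau> = (\<lambda>x. b \<tau> * p x + - d \<tau> * n x)" unfolding q_def c(1) by auto
      have ipq: "ip (q \<tau>) (q \<tau>) = (b \<tau>)\<^sup>2 * ip p p + (d \<tau>)\<^sup>2 * ip n n"
        unfolding e N.lin_sq[OF p n] pn by simp
      have "0 < ip (q \<tau>) (q \<tau>)" unfolding ipq using c ppos npos
        by (smt (verit) mult_nonneg_nonneg mult_pos_pos zero_less_power2 zero_le_power2)
      moreover have "pos_part (q \<tau>) = (\<lambda>x. b \<tau> * p x)"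
      proof
        fix x
        have "p x = 0 \<or> n x = 0" using pnx[of x] by simp
        moreover have "0 \<le> b \<tau> * p x" "0 \<le> d \<tau> * n x" using c p0 n0 by simp_all
        ultimately show "pos_part (q \<tau>) x = b \<tau> * p x" unfolding e pos_part_def by (auto simp: max_def)
      qed
      then have "E_r \<Omega> r (q \<tau>) = t * ip (q \<tau>) (q \<tau>) - m * (b \<tau> - d \<tau>)\<^sup>2"
        unfolding E_r_eq[OF qH] ipq
        by (simp only: N.scale_sq[OF p]) (simp add: e form_EL_lin_sq[OF p n, of "b \<tau>" "- d \<tau>", simplified] Ep En m_def power2_eq_square algebra_simps)
      moreover have "0 \<le> m * (b \<tau> - d \<tau>)\<^sup>2" using m0 by simp
      ultimately show ?thesis by linarith
    next
      case 3
      have c: "0 \<le> a \<tau>" "d \<tau> = 0" "0 \<le> b \<tau>" "0 < a \<tau> \<or> 0 < b \<tau>"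
        using 3 \<tau> by (auto simp: a_def b_def d_def)
      let ?w = "\<lambda>x. a \<tau> * \<phi> x + b \<tau> * p x"
      have wH: "?w \<in> H" by (rule N.lin_mem[OF phi_H p])
      have e: "q \<tau> = ?w" unfolding q_def c(2) by auto
      have pw: "0 \<le> ip \<phi> p" using ip_nonneg[of p \<phi>, OF p0 phi_nonneg] N.sym[OF phi_H p] by simp
      have "0 < ip ?w ?w" unfolding N.lin_sq[OF phi_H p] phi_norm using c ppos pw
        by (smt (verit) mult_nonneg_nonneg mult_pos_pos zero_less_power2 zero_le_power2)
      moreover have "ip (pos_part ?w) (pos_part ?w) = ip ?w ?w"
      proof (rule ip_cong_sq[OF H_pos[OF wH] wH])
        show "AE x in lborel. pos_part ?w x = ?w x"
          using phi_nonneg by eventually_elim (use c p0 in \<open>simp add: pos_part_def\<close>)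
      qed
      moreover have "form_EL ?w ?w \<le> (r + t) * ip ?w ?w"
        by (rule cone[OF p p0]) (use Ep m0 c mut r in auto)
      ultimately show ?thesis unfolding e E_r_eq[OF wH] by (simp add: algebra_simps)
    qed
  qed
  have "(\<lambda>\<tau>. L2_normalize (q \<tau>)) \<in> paths \<Omega> \<phi>"
  proof (rule L2_normalize_path[OF qH _ cont])
    show "0 < ip (q \<tau>) (q \<tau>)" if "\<tau> \<in> I" for \<tau> using cases[OF that] by blast
    show "AE x in lborel. q (-1) x = - 1 * \<phi> x" "AE x in lborel. q 1 x = 1 * \<phi> x"
      by (auto simp: q_def a_def b_def d_def)
  qed auto
  then show ?thesis
  proof (rule minimax_le[OF _ r])
    fix \<tau> assume \<tau>: "\<tau> \<in> I"
    show "E_r \<Omega> r (L2_normalize (q \<tau>)) \<le> t"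
      unfolding L2_normalize_sphere(2)[OF qH conjunct1[OF cases[OF \<tau>]]]
      using cases[OF \<tau>] by (simp add: pos_divide_le_eq)
  qed
qed

end

theorem theorem4p5:
  fixes \<Omega> :: "'a::euclidean_space set" and \<phi>1 :: "'a \<Rightarrow> real" and r :: real
  assumes "bounded_C11_domain \<Omega>"
    and "is_first_eigenfunction \<Omega> \<phi>1"
    and "r \<ge> 0"
  shows "nontrivial_fucik_point \<Omega> (r + minimax_c \<Omega> \<phi>1 r, minimax_c \<Omega> \<phi>1 r) \<and>
    \<not> (\<exists>t < minimax_c \<Omega> \<phi>1 r. nontrivial_fucik_point \<Omega> (r + t, t))"
proof -
  interpret minimax_level \<Omega> \<phi>1 r
    by unfold_locales (use assms in \<open>auto simp: bounded_C11_domain_def\<close>)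
  have "nontrivial_fucik_point \<Omega> (r + minimax_c \<Omega> \<phi>1 r, minimax_c \<Omega> \<phi>1 r)"
    unfolding nontrivial_fucik_point_def
    using minimax_critical[unfolded level_def] minimax_gt[OF r] r by auto
  moreover have "minimax_c \<Omega> \<phi>1 r \<le> t" if "nontrivial_fucik_point \<Omega> (r + t, t)" for t
    by (rule minimax_le_nontrivial[OF r that])
  ultimately show ?thesis by (meson not_less)
qed

end
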